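(* Let $l\ge2$. (i) Every differential operator $P(D)$, $D=(D_1,D_2)$, of order $l$ with constant coefficients that is weakly coercive in the isotropic space $\overset{\circ}{W}{}^l_\infty(\mathbb R^2)$ has the form $$P(D)=R(D)\prod_{k=1}^m(\lambda_kD_1+\mu_kD_2+\alpha_k)+Q(D),$$ where $0\le m\le l$, $R(D)$ is an elliptic operator of order $l-m$, $Q(D)$ is an operator of order $\le l-2$, $\alpha_k\in\mathbb C\setminus\mathbb R$ for $k\in\{1,\dots,m\}$, and $(\lambda_k,\mu_k)\in\mathbb R^2$, $k\in\{1,\dots,m\}$, are pairwise non-collinear vectors. (ii) Conversely, any operator of this form is weakly coercive in $\overset{\circ}{W}{}^l_p(\mathbb R^2)$ for every $p\in[1,\infty]$.
   Context: All operators have constant complex coefficients; $D_k=-i\,\partial/\partial x_k$. An operator $R(D)=\sum_{|\alpha|\le r}c_\alpha D^\alpha$ of order $r$ is elliptic if $R^r(\xi)=\sum_{|\alpha|=r}c_\alpha\xi^\alpha\ne0$ for all $\xi\in\mathbb R^2\setminus\{0\}$ (for $r=0$: a non-zero constant). The vectors $(\lambda_k,\mu_k)$ are understood to be non-zero, and pairwise non-collinear means pairwise linearly independent. For $p\in[1,\infty]$, an operator $P(D)$ of order $l$ is weakly coercive in $\overset{\circ}{W}{}^l_p(\mathbb R^2)$ if there are constants $C_1,C_2$ such that $\sum_{|\alpha|<l}\|D^\alpha f\|_{L^p(\mathbb R^2)}\le C_1\|P(D)f\|_{L^p(\mathbb R^2)}+C_2\|f\|_{L^p(\mathbb R^2)}$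 for all $f\in C_0^\infty(\mathbb R^2)$. *)

theory Defs
  imports
    "HOL-Analysis.Analysis"
    "HOL-Library.Poly_Mapping"
    "HOL-Probability.Essential_Supremum"
begin

text \<open>The plane is \<^typ>\<open>real \<times> real\<close> with its Euclidean structure and Lebesgue measure \<^term>\<open>lborel\<close>.\<close>

subsection \<open>Partial derivatives and test functions\<close>

definition partial1 :: "(real \<times> real \<Rightarrow> complex) \<Rightarrow> real \<times> real \<Rightarrow> complex" where
  "partial1 f = (\<lambda>(x, y). vector_derivative (\<lambda>t. f (t, y)) (at x))"

definition partial2 :: "(real \<times> real \<Rightarrow> complex) \<Rightarrow> real \<times> real \<Rightarrow> complex" where
  "partial2 f = (\<lambda>(x, y). vector_derivative (\<lambda>t. f (x, t)) (at y))"

fun Ck :: "nat \<Rightarrow> (real \<times> real \<Rightarrow> complex) \<Rightarrow> bool" where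
  "Ck 0 f \<longleftrightarrow> continuous_on UNIV f"
| "Ck (Suc k) f \<longleftrightarrow> f differentiable_on UNIV \<and> Ck k (partial1 f) \<and> Ck k (partial2 f)"

definition test_function :: "(real \<times> real \<Rightarrow> complex) \<Rightarrow> bool" where
  "test_function f \<longleftrightarrow> (\<forall>k. Ck k f) \<and> compact (closure {z. f z \<noteq> 0})"

definition D1 :: "(real \<times> real \<Rightarrow> complex) \<Rightarrow> real \<times> real \<Rightarrow> complex" where
  "D1 f = (\<lambda>z. - \<i> * partial1 f z)"

definition D2 :: "(real \<times> real \<Rightarrow> complex) \<Rightarrow> real \<times> real \<Rightarrow> complex" where
  "D2 f = (\<lambda>z. - \<i> * partial2 f z)"

type_synonym multi_index = "nat \<times> nat"

definition mi_size :: "multi_index \<Rightarrow> nat" where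
  "mi_size \<alpha> = fst \<alpha> + snd \<alpha>"

lemma finite_mi_size_less [simp]: "finite {\<alpha>. mi_size \<alpha> < n}"
  by (rule finite_subset [of _ "{..<n} \<times> {..<n}"]) (auto simp: mi_size_def)

definition D_pow :: "multi_index \<Rightarrow> (real \<times> real \<Rightarrow> complex) \<Rightarrow> real \<times> real \<Rightarrow> complex" where
  "D_pow \<alpha> f = (D1 ^^ fst \<alpha>) ((D2 ^^ snd \<alpha>) f)"

subsection \<open>Differential operators with constant coefficients\<close>

text \<open>
  An operator \<open>P(D) = (\<Sum>\<alpha>. c\<^sub>\<alpha> D\<^sup>\<alpha>)\<close> is the finitely supported family of its coefficients
  \<open>c\<^sub>\<alpha>\<close>. The ring multiplication of \<^typ>\<open>multi_index \<Rightarrow>\<^sub>0 complex\<close> is convolution of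
  coefficients, i.e. multiplication of polynomials in \<open>D\<^sub>1, D\<^sub>2\<close>; this is the composition of the
  operators, since \<open>D\<^sub>1\<close> and \<open>D\<^sub>2\<close> commute on smooth functions.
\<close>

type_synonym diff_op = "multi_index \<Rightarrow>\<^sub>0 complex"

definition apply_op :: "diff_op \<Rightarrow> (real \<times> real \<Rightarrow> complex) \<Rightarrow> real \<times> real \<Rightarrow> complex" where
  "apply_op P f = (\<lambda>z. \<Sum>\<alpha>\<in>Poly_Mapping.keys P. Poly_Mapping.lookup P \<alpha> * D_pow \<alpha> f z)"

definition order_le :: "diff_op \<Rightarrow> nat \<Rightarrow> bool" where
  "order_le P r \<longleftrightarrow> (\<forall>\<alpha>\<in>Poly_Mapping.keys P. mi_size \<alpha> \<le> r)"

definition has_order :: "diff_op \<Rightarrow> nat \<Rightarrow> bool" where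
  "has_order P r \<longleftrightarrow> order_le P r \<and> (\<exists>\<alpha>\<in>Poly_Mapping.keys P. mi_size \<alpha> = r)"

definition homogeneous_symbol :: "diff_op \<Rightarrow> nat \<Rightarrow> real \<times> real \<Rightarrow> complex" where
  "homogeneous_symbol P r \<xi> =
    (\<Sum>\<alpha>\<in>{\<alpha> \<in> Poly_Mapping.keys P. mi_size \<alpha> = r}.
      Poly_Mapping.lookup P \<alpha> * of_real (fst \<xi>) ^ fst \<alpha> * of_real (snd \<xi>) ^ snd \<alpha>)"

definition elliptic_of_order :: "diff_op \<Rightarrow> nat \<Rightarrow> bool" where
  "elliptic_of_order R r \<longleftrightarrow>
    has_order R r \<and> (\<forall>\<xi>. \<xi> \<noteq> 0 \<longrightarrow> homogeneous_symbol R r \<xi> \<noteq> 0)"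

text \<open>The operator \<open>\<lambda> D\<^sub>1 + \<mu> D\<^sub>2 + a\<close> for \<open>v = (\<lambda>, \<mu>)\<close>.\<close>

definition linear_op :: "real \<times> real \<Rightarrow> complex \<Rightarrow> diff_op" where
  "linear_op v a =
    Poly_Mapping.single (1, 0) (of_real (fst v)) + Poly_Mapping.single (0, 1) (of_real (snd v))
    + Poly_Mapping.single (0, 0) a"

text \<open>Non-zero vectors \<open>v, w\<close> are linearly independent iff \<open>0, v, w\<close> are not on a common line.\<close>

definition product_form :: "nat \<Rightarrow> diff_op \<Rightarrow> bool" where
  "product_form l P \<longleftrightarrow>
    (\<exists>(m::nat) R Q v a.
      m \<le> l \<and> elliptic_of_order R (l - m) \<and> order_le Q (l - 2) \<and>
      (\<forall>k\<in>{1..m}. a k \<notin> \<real>) \<and>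
      (\<forall>k\<in>{1..m}. v k \<noteq> 0) \<and>
      (\<forall>j\<in>{1..m}. \<forall>k\<in>{1..m}. j \<noteq> k \<longrightarrow> \<not> collinear {0, v j, v k}) \<and>
      P = R * (\<Prod>k=1..m. linear_op (v k) (a k)) + Q)"

subsection \<open>Weak coercivity\<close>

text \<open>
  The norm is real-valued. It is only applied to continuous functions of compact support, for which
  the integral and the essential supremum are finite.
\<close>

definition Lp_norm :: "ennreal \<Rightarrow> (real \<times> real \<Rightarrow> complex) \<Rightarrow> real" where
  "Lp_norm p f =
    (if p = \<infinity> then enn2real (esssup lborel (\<lambda>z. ennreal (norm (f z))))
     else (\<integral>z. norm (f z) powr enn2real p \<partial>lborel) powr (1 / enn2real p))"

text \<open>Here \<open>l\<close> is meant to be the order of \<open>P\<close>.\<close>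

definition weakly_coercive :: "ennreal \<Rightarrow> nat \<Rightarrow> diff_op \<Rightarrow> bool" where
  "weakly_coercive p l P \<longleftrightarrow>
    (\<exists>C1 C2 :: real. \<forall>f. test_function f \<longrightarrow>
      (\<Sum>\<alpha> | mi_size \<alpha> < l. Lp_norm p (D_pow \<alpha> f))
        \<le> C1 * Lp_norm p (apply_op P f) + C2 * Lp_norm p f)"

end

theory Submission
  imports Defs "HOL-Computational_Algebra.Fundamental_Theorem_Algebra"
begin

text \<open>
  Necessity. Apply the estimate to plane waves \<open>exp (\<i> t \<xi>\<cdot>x) \<phi>\<close>, \<open>t \<rightarrow> \<infinity>\<close>, in a characteristic direction \<open>\<xi>\<close>,
  where the principal symbol is \<open>P\<^sub>l = L G\<close> with \<open>L \<xi> = 0\<close>. Then \<open>P(D)\<close> acts on \<open>\<phi>\<close>, up to \<open>O(t\<^sup>l\<^sup>-\<^sup>2)\<close>, as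
  \<open>t\<^sup>l\<^sup>-\<^sup>1 (G(\<xi>) L(D) + P\<^sub>l\<^sub>-\<^sub>1(\<xi>))\<close>, whereas some monomial of degree \<open>l - 1\<close> has size \<open>t\<^sup>l\<^sup>-\<^sup>1\<close>. If \<open>G(\<xi>) \<noteq> 0\<close>, the
  quotient \<open>P\<^sub>l\<^sub>-\<^sub>1(\<xi>) / G(\<xi>)\<close> cannot be real, since a real one is removed by a shift of the frequency; these
  quotients are the \<open>\<alpha>\<^sub>k\<close>. If \<open>G(\<xi>) = 0\<close> and \<open>c = P\<^sub>l\<^sub>-\<^sub>1(\<xi>) \<noteq> 0\<close>, two waves, in the direction \<open>\<xi>\<close> and in a
  non-characteristic direction, are normalized so that their images under \<open>P(D)\<close> cancel at the origin, although only
  the first has a large derivative of order \<open>l - 1\<close>; a gliding hump of such differences contradicts the estimate.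

  Sufficiency. A factor \<open>L(D) + \<alpha>\<close> with \<open>L\<close> real and \<open>\<alpha>\<close> not real is bounded below because it is an ordinary
  differential operator along lines. For \<open>w = D\<^sub>1 + z D\<^sub>2\<close> with \<open>z\<close> not real, \<open>D\<^sub>2\<^sup>n\<close> is controlled by \<open>w\<^sup>n\<^sup>+\<^sup>1\<close> with
  arbitrarily small constant, up to a smoothing operator: sum a dyadic decomposition of the fundamental solution,
  whose kernel is weakly singular. All monomials of order \<open>l - 1\<close> follow by induction on the number of factors, since
  two independent factors span the linear forms; terms of lower order are absorbed by interpolation.
\<close>

subsection \<open>Smooth functions and partial derivatives\<close>

text \<open>For p = 1 and p = \<infinity> singular integrals are in general unbounded, so
  derivatives of full order cannot be expected from an elliptic operator. One order is given up from
  the outset: products of n + 1 first-order factors are compared with derivatives of order n only.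
  There the kernels are integrable and Young's inequality treats all p alike.

  Necessity must also produce R and Q, not only the \<alpha>'s. Write the principal part as
  \<open>R\<^sub>0 L\<^sub>1 ... L\<^sub>m\<close> with \<open>R\<^sub>0\<close> elliptic and put
  \<open>G\<^sub>k = R\<^sub>0 (\<Prod>j\<noteq>k. L\<^sub>j)\<close>. In the direction where
  \<open>L\<^sub>k\<close> vanishes, every \<open>G\<^sub>j\<close> with j \<noteq> k vanishes too.
  Hence \<open>P\<^sub>l\<^sub>-\<^sub>1 - (\<Sum>k. \<alpha>\<^sub>k G\<^sub>k)\<close> is zero in
  all m characteristic directions, as in Lagrange interpolation, and is divisible by the product of
  the \<open>L\<^sub>k\<close>. The quotient, of degree l - m - 1, is the lower part of R;
  everything left over has order at most l - 2 and goes into Q.\<close>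

definition grad ::
    "(real \<times> real \<Rightarrow> complex) \<Rightarrow> (real \<times> real \<Rightarrow> complex) \<Rightarrow> (real \<times> real \<Rightarrow> complex) \<Rightarrow> bool" where
  "grad f f1 f2 \<longleftrightarrow> (\<forall>z. (f has_derivative (\<lambda>h. fst h *\<^sub>R f1 z + snd h *\<^sub>R f2 z)) (at z))"

lemma grad_slice1:
  assumes "grad f f1 f2"
  shows "((\<lambda>t. f (t, y)) has_vector_derivative f1 (x, y)) (at x within S)"
proof -
  have "((\<lambda>t. (t, y)) has_derivative (\<lambda>h. (h, 0))) (at x within S)"
    by (auto intro!: derivative_eq_intros)
  from has_derivative_in_compose[OF this, of f "\<lambda>h. fst h *\<^sub>R f1 (x,y) + snd h *\<^sub>R f2 (x,y)"]
    has_derivative_at_withinI assms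
  show ?thesis unfolding has_vector_derivative_def grad_def by fastforce
qed

lemma grad_slice2:
  assumes "grad f f1 f2"
  shows "((\<lambda>t. f (x, t)) has_vector_derivative f2 (x, y)) (at y within S)"
proof -
  have "((\<lambda>t. (x, t)) has_derivative (\<lambda>h. (0, h))) (at y within S)"
    by (auto intro!: derivative_eq_intros)
  from has_derivative_in_compose[OF this, of f "\<lambda>h. fst h *\<^sub>R f1 (x,y) + snd h *\<^sub>R f2 (x,y)"]
    has_derivative_at_withinI assms
  show ?thesis unfolding has_vector_derivative_def grad_def by fastforce
qed

lemma grad_partial1: "grad f f1 f2 \<Longrightarrow> partial1 f = f1"
  unfolding partial1_def by (auto simp: fun_eq_iff intro!: vector_derivative_at grad_slice1)

lemma grad_partial2: "grad f f1 f2 \<Longrightarrow> partial2 f = f2"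
  unfolding partial2_def by (auto simp: fun_eq_iff intro!: vector_derivative_at grad_slice2)

lemma grad_differentiable: "grad f f1 f2 \<Longrightarrow> f differentiable_on UNIV"
  unfolding grad_def differentiable_on_def differentiable_def by (metis has_derivative_at_withinI)

lemma differentiable_grad:
  assumes "f differentiable_on UNIV"
  shows "grad f (partial1 f) (partial2 f)"
proof -
  have "\<exists>f'. (f has_derivative f') (at z)" for z
    using assms unfolding differentiable_on_def differentiable_def by (metis UNIV_I)
  then obtain f' where f': "\<And>z. (f has_derivative f' z) (at z)" by metis
  have eq: "f' z = (\<lambda>h. fst h *\<^sub>R f' z (1,0) + snd h *\<^sub>R f' z (0,1))" for z
  proof
    fix h
    interpret bounded_linear "f' z" using f' has_derivative_bounded_linear by blast
    have "h = fst h *\<^sub>R (1,0) + snd h *\<^sub>R (0,1)" by (cases h) auto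
    then have "f' z h = f' z (fst h *\<^sub>R (1,0) + snd h *\<^sub>R (0,1))" by simp
    then show "f' z h = fst h *\<^sub>R f' z (1,0) + snd h *\<^sub>R f' z (0,1)" by (simp only: add scaleR)
  qed
  have "grad f (\<lambda>z. f' z (1,0)) (\<lambda>z. f' z (0,1))"
    unfolding grad_def using f' by (simp flip: eq)
  from grad_partial1[OF this] grad_partial2[OF this] this show ?thesis by simp
qed

text \<open>The working form of \<open>Ck\<close>: closure proofs supply the two derivatives as
  witnesses from \<open>grad\<close> rules and never compute with
  \<open>vector_derivative\<close>.\<close>

lemma Ck_Suc_iff: "Ck (Suc k) f \<longleftrightarrow> (\<exists>f1 f2. grad f f1 f2 \<and> Ck k f1 \<and> Ck k f2)"
proof
  assume "Ck (Suc k) f"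
  then show "\<exists>f1 f2. grad f f1 f2 \<and> Ck k f1 \<and> Ck k f2"
    by (metis Ck.simps(2) differentiable_grad)
next
  assume "\<exists>f1 f2. grad f f1 f2 \<and> Ck k f1 \<and> Ck k f2"
  then show "Ck (Suc k) f"
    using grad_partial1 grad_partial2 grad_differentiable by auto
qed

lemma Ck_Suc_grad: "Ck (Suc k) f \<Longrightarrow> grad f (partial1 f) (partial2 f)"
  by (simp add: differentiable_grad)

lemma Ck_lower: "Ck (Suc k) f \<Longrightarrow> Ck k f"
proof (induction k arbitrary: f)
  case 0
  then show ?case by (simp add: differentiable_imp_continuous_on)
next
  case (Suc k)
  then show ?case by (metis Ck.simps(2))
qed

lemma Ck_continuous: "Ck k f \<Longrightarrow> continuous_on UNIV f"
proof (induction k)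
  case (Suc k) then show ?case using Ck_lower by blast
qed simp

lemma grad_add: "grad f f1 f2 \<Longrightarrow> grad g g1 g2 \<Longrightarrow> grad (\<lambda>z. f z + g z) (\<lambda>z. f1 z + g1 z) (\<lambda>z. f2 z + g2 z)"
  unfolding grad_def by (auto intro!: derivative_eq_intros simp: algebra_simps)

lemma grad_mult: "grad f f1 f2 \<Longrightarrow> grad g g1 g2 \<Longrightarrow>
    grad (\<lambda>z. f z * g z) (\<lambda>z. f z * g1 z + f1 z * g z) (\<lambda>z. f z * g2 z + f2 z * g z)"
  unfolding grad_def by (auto intro!: derivative_eq_intros simp: algebra_simps)

lemma grad_const: "grad (\<lambda>z. c) (\<lambda>z. 0) (\<lambda>z. 0)"
  unfolding grad_def by (auto intro!: derivative_eq_intros)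

lemma grad_cmult: "grad f f1 f2 \<Longrightarrow> grad (\<lambda>z. c * f z) (\<lambda>z. c * f1 z) (\<lambda>z. c * f2 z)"
  using grad_mult[OF grad_const] by fastforce

lemma grad_affine_arg:
  assumes "grad f f1 f2"
  shows "grad (\<lambda>z. f (a + s *\<^sub>R z)) (\<lambda>z. of_real s * f1 (a + s *\<^sub>R z)) (\<lambda>z. of_real s * f2 (a + s *\<^sub>R z))"
  unfolding grad_def
proof
  fix z
  have "((\<lambda>z. a + s *\<^sub>R z) has_derivative (\<lambda>h. s *\<^sub>R h)) (at z)"
    by (auto intro!: derivative_eq_intros)
  moreover have "(f has_derivative (\<lambda>h. fst h *\<^sub>R f1 (a + s *\<^sub>R z) + snd h *\<^sub>R f2 (a + s *\<^sub>R z))) (at (a + s *\<^sub>R z))"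
    using assms unfolding grad_def by blast
  ultimately have "((\<lambda>z. f (a + s *\<^sub>R z)) has_derivative (\<lambda>h. fst (s *\<^sub>R h) *\<^sub>R f1 (a + s *\<^sub>R z) + snd (s *\<^sub>R h) *\<^sub>R f2 (a + s *\<^sub>R z))) (at z)"
    by (rule has_derivative_compose)
  then show "((\<lambda>z. f (a + s *\<^sub>R z)) has_derivative (\<lambda>h. fst h *\<^sub>R (of_real s * f1 (a + s *\<^sub>R z)) + snd h *\<^sub>R (of_real s * f2 (a + s *\<^sub>R z)))) (at z)"
    by (simp add: scaleR_conv_of_real mult_ac)
qed

lemma Ck_const [simp]: "Ck k (\<lambda>z. c)"
proof (induction k arbitrary: c)
  case (Suc k) then show ?case unfolding Ck_Suc_iff using grad_const by blast
qed simp

lemma Ck_add: "Ck k f \<Longrightarrow> Ck k g \<Longrightarrow> Ck k (\<lambda>z. f z + g z)"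
proof (induction k arbitrary: f g)
  case 0 then show ?case by (auto intro!: continuous_intros)
next
  case (Suc k) then show ?case unfolding Ck_Suc_iff by (metis grad_add)
qed

lemma Ck_mult: "Ck k f \<Longrightarrow> Ck k g \<Longrightarrow> Ck k (\<lambda>z. f z * g z)"
proof (induction k arbitrary: f g)
  case 0 then show ?case by (auto intro!: continuous_intros)
next
  case (Suc k)
  then obtain f1 f2 g1 g2 where *: "grad f f1 f2" "Ck k f1" "Ck k f2" "grad g g1 g2" "Ck k g1" "Ck k g2"
    unfolding Ck_Suc_iff by metis
  have "Ck k f" "Ck k g" using Suc.prems by (simp_all only: Ck_lower)
  then have "Ck k (\<lambda>z. f z * g1 z + f1 z * g z)" "Ck k (\<lambda>z. f z * g2 z + f2 z * g z)"
    using * Suc.IH Ck_add by simp_all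
  then show ?case unfolding Ck_Suc_iff using grad_mult[OF *(1,4)] by blast
qed

lemma Ck_cmult: "Ck k f \<Longrightarrow> Ck k (\<lambda>z. c * f z)"
  by (rule Ck_mult) auto

lemma Ck_sum: "(\<And>i. i \<in> I \<Longrightarrow> Ck k (f i)) \<Longrightarrow> Ck k (\<lambda>z. \<Sum>i\<in>I. f i z)"
  by (induction I rule: infinite_finite_induct) (auto intro: Ck_add)

lemma Ck_affine_arg: "Ck k f \<Longrightarrow> Ck k (\<lambda>z. f (a + s *\<^sub>R z))"
proof (induction k arbitrary: f)
  case 0 then show ?case by (auto intro!: continuous_intros continuous_on_compose2[of UNIV f])
next
  case (Suc k) then show ?case unfolding Ck_Suc_iff by (metis grad_affine_arg Ck_cmult)
qed

lemma grad_fst: "grad (\<lambda>z. of_real (fst z)) (\<lambda>z. 1) (\<lambda>z. 0)"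
  unfolding grad_def
  by (auto intro!: derivative_eq_intros has_derivative_of_real simp: scaleR_conv_of_real)

lemma grad_snd: "grad (\<lambda>z. of_real (snd z)) (\<lambda>z. 0) (\<lambda>z. 1)"
  unfolding grad_def
  by (auto intro!: derivative_eq_intros has_derivative_of_real simp: scaleR_conv_of_real)

lemma Ck_fst [simp]: "Ck k (\<lambda>z. of_real (fst z))"
proof (cases k)
  case (Suc k) then show ?thesis unfolding Suc Ck_Suc_iff using grad_fst Ck_const by blast
qed (auto intro!: continuous_intros)

lemma Ck_snd [simp]: "Ck k (\<lambda>z. of_real (snd z))"
proof (cases k)
  case (Suc k) then show ?thesis unfolding Suc Ck_Suc_iff using grad_snd Ck_const by blast
qed (auto intro!: continuous_intros)

lemma grad_exp: "grad f f1 f2 \<Longrightarrow> grad (\<lambda>z. exp (f z)) (\<lambda>z. exp (f z) * f1 z) (\<lambda>z. exp (f z) * f2 z)"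
  unfolding grad_def
proof safe
  fix a b assume *: "\<forall>z. (f has_derivative (\<lambda>h. fst h *\<^sub>R f1 z + snd h *\<^sub>R f2 z)) (at z)"
  have "((\<lambda>z. exp (f z)) has_derivative (\<lambda>h. exp (f (a,b)) * (fst h *\<^sub>R f1 (a,b) + snd h *\<^sub>R f2 (a,b)))) (at (a,b))"
    using has_derivative_compose[OF *[rule_format] DERIV_exp[THEN has_field_derivative_imp_has_derivative]] by (simp add: o_def)
  then show "((\<lambda>z. exp (f z)) has_derivative (\<lambda>h. fst h *\<^sub>R (exp (f (a,b)) * f1 (a,b)) + snd h *\<^sub>R (exp (f (a,b)) * f2 (a,b)))) (at (a,b))"
    by (simp add: algebra_simps)
qed

lemma Ck_exp: "Ck k f \<Longrightarrow> Ck k (\<lambda>z. exp (f z))"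
proof (induction k arbitrary: f)
  case 0 then show ?case by (auto intro!: continuous_intros)
next
  case (Suc k)
  then obtain f1 f2 where *: "grad f f1 f2" "Ck k f1" "Ck k f2"
    unfolding Ck_Suc_iff by metis
  have "Ck k f" using Suc.prems by (rule Ck_lower)
  then show ?case unfolding Ck_Suc_iff using * grad_exp[OF *(1)] Suc.IH Ck_mult by meson
qed

definition smooth :: "(real \<times> real \<Rightarrow> complex) \<Rightarrow> bool" where
  "smooth f \<longleftrightarrow> (\<forall>k. Ck k f)"

lemma smooth_grad: "smooth f \<Longrightarrow> grad f (partial1 f) (partial2 f)"
  unfolding smooth_def using Ck_Suc_grad by blast

lemma smooth_partial: "smooth f \<Longrightarrow> smooth (partial1 f)" "smooth f \<Longrightarrow> smooth (partial2 f)"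
  unfolding smooth_def by (metis Ck.simps(2))+

lemma smooth_continuous: "smooth f \<Longrightarrow> continuous_on S f"
  unfolding smooth_def by (meson Ck_continuous continuous_on_subset subset_UNIV)

lemma smooth_const [simp]: "smooth (\<lambda>z. c)"
  and smooth_fst [simp]: "smooth (\<lambda>z. of_real (fst z))"
  and smooth_snd [simp]: "smooth (\<lambda>z. of_real (snd z))"
  by (simp_all add: smooth_def)

lemma smooth_add: "smooth f \<Longrightarrow> smooth g \<Longrightarrow> smooth (\<lambda>z. f z + g z)"
  and smooth_mult: "smooth f \<Longrightarrow> smooth g \<Longrightarrow> smooth (\<lambda>z. f z * g z)"
  and smooth_exp: "smooth f \<Longrightarrow> smooth (\<lambda>z. exp (f z))"
  and smooth_affine_arg: "smooth f \<Longrightarrow> smooth (\<lambda>z. f (a + s *\<^sub>R z))"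
  by (simp_all add: smooth_def Ck_add Ck_mult Ck_exp Ck_affine_arg)

lemma smooth_sum: "(\<And>i. i \<in> I \<Longrightarrow> smooth (f i)) \<Longrightarrow> smooth (\<lambda>z. \<Sum>i\<in>I. f i z)"
  by (simp add: smooth_def Ck_sum)

(* Differentiating f(x,y) - f(x,b) = \<integral> \<partial>\<^sub>2 f(x,t) dt under the integral sign shows that \<partial>\<^sub>1\<partial>\<^sub>2 f is
   the y-derivative of \<partial>\<^sub>1 f. *)
lemma partial_commute:
  assumes "smooth f"
  shows "partial1 (partial2 f) = partial2 (partial1 f)"
proof
  fix z :: "real \<times> real"
  obtain x y where z: "z = (x, y)" by (cases z)
  define g where "g = partial2 f"
  note sf = assms smooth_partial[OF assms]
  have sg: "smooth g" unfolding g_def using sf by auto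
  have g': "smooth (partial1 g)" using sg smooth_partial by auto
  define b where "b = y - 1"
  have int: "integral (cbox b u) (\<lambda>t. g (a, t)) = f (a, u) - f (a, b)" if "b \<le> u" for a u
    using fundamental_theorem_of_calculus[OF that, of "\<lambda>t. f (a, t)" "\<lambda>t. g (a, t)"]
      grad_slice2[OF smooth_grad[OF assms]] unfolding g_def
    by (simp add: integral_unique)
  have cg: "continuous_on (cbox b u) (\<lambda>t. h (a, t))" if "smooth h" for a u h
    by (rule continuous_on_compose2[OF smooth_continuous[OF that, of UNIV]]) (auto intro!: continuous_intros)
  have d: "integral (cbox b u) (\<lambda>t. partial1 g (x, t)) = partial1 f (x, u) - partial1 f (x, b)" if "b \<le> u" for u
  proof -
    have "((\<lambda>a. integral (cbox b u) (\<lambda>t. g (a, t))) has_vector_derivative integral (cbox b u) (\<lambda>t. partial1 g (x, t))) (at x within UNIV)"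
    proof (rule leibniz_rule_vector_derivative)
      show "((\<lambda>x. g (x, t)) has_vector_derivative partial1 g (x, t)) (at x within UNIV)" for x t
        by (rule grad_slice1[OF smooth_grad[OF sg]])
      show "(\<lambda>t. g (x, t)) integrable_on cbox b u" for x
        by (rule integrable_continuous[OF cg[OF sg]])
      show "continuous_on (UNIV \<times> cbox b u) (\<lambda>(x, t). partial1 g (x, t))"
        using smooth_continuous[OF g'] by simp
    qed auto
    then have "((\<lambda>a. f (a, u) - f (a, b)) has_vector_derivative integral (cbox b u) (\<lambda>t. partial1 g (x, t))) (at x)"
      by (simp only: int[OF that])
    moreover have "((\<lambda>a. f (a, u) - f (a, b)) has_vector_derivative partial1 f (x, u) - partial1 f (x, b)) (at x)"
      by (intro has_vector_derivative_diff grad_slice1[OF smooth_grad[OF assms]])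
    ultimately show ?thesis by (rule vector_derivative_unique_at)
  qed
  have "((\<lambda>u. integral {b..u} (\<lambda>t. partial1 g (x, t))) has_vector_derivative partial1 g (x, y)) (at y within {b..y+1})"
    by (rule integral_has_vector_derivative) (use cg[OF g', of "y+1" x] in \<open>auto simp: b_def\<close>)
  then have "((\<lambda>u. integral {b..u} (\<lambda>t. partial1 g (x, t))) has_vector_derivative partial1 g (x, y)) (at y)"
    by (simp add: at_within_Icc_at b_def)
  then have "((\<lambda>u. partial1 f (x, u) - partial1 f (x, b)) has_vector_derivative partial1 g (x, y)) (at y)"
    by (rule has_vector_derivative_transform_within_open[of _ _ _ "{b<..}"])
       (use d in \<open>auto simp: b_def\<close>)
  moreover have "((\<lambda>u. partial1 f (x, u) - partial1 f (x, b)) has_vector_derivative partial2 (partial1 f) (x, y) - 0) (at y)"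
    by (intro has_vector_derivative_diff grad_slice2[OF smooth_grad[OF sf(2)]]) auto
  ultimately show "partial1 (partial2 f) z = partial2 (partial1 f) z"
    using vector_derivative_unique_at unfolding z g_def by fastforce
qed

subsection \<open>Test functions\<close>

text \<open>Supports are measured by centred balls, because radii can be tracked through
  convolutions and translations and prescribed for the humps of the necessity half.\<close>

definition supp_in :: "real \<Rightarrow> (real \<times> real \<Rightarrow> complex) \<Rightarrow> bool" where
  "supp_in r f \<longleftrightarrow> (\<forall>z. norm z > r \<longrightarrow> f z = 0)"

lemma test_function_iff: "test_function f \<longleftrightarrow> smooth f \<and> (\<exists>r. supp_in r f)"
proof -
  have "bounded {z. f z \<noteq> 0} \<longleftrightarrow> (\<exists>r. supp_in r f)"
    unfolding bounded_iff supp_in_def by (auto simp: not_less) (metis linorder_not_less)+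
  then show ?thesis by (simp add: test_function_def smooth_def)
qed

lemma supp_in_mono: "supp_in r f \<Longrightarrow> r \<le> r' \<Longrightarrow> supp_in r' f"
  by (auto simp: supp_in_def)

lemma supp_in_add: "supp_in r f \<Longrightarrow> supp_in r g \<Longrightarrow> supp_in r (\<lambda>z. f z + g z)"
  and supp_in_mult: "supp_in r f \<Longrightarrow> supp_in r (\<lambda>z. h z * f z)"
  and supp_in_mult': "supp_in r f \<Longrightarrow> supp_in r (\<lambda>z. f z * h z)"
  and supp_in_diff: "supp_in r f \<Longrightarrow> supp_in r g \<Longrightarrow> supp_in r (\<lambda>z. f z - g z)"
  by (auto simp: supp_in_def)

lemma supp_in_sum: "(\<And>i. i \<in> I \<Longrightarrow> supp_in r (f i)) \<Longrightarrow> supp_in r (\<lambda>z. \<Sum>i\<in>I. f i z)"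
  by (auto simp: supp_in_def)

lemma grad_local_zero:
  assumes "grad f f1 f2" "open U" "\<And>z. z \<in> U \<Longrightarrow> f z = 0" "z \<in> U"
  shows "f1 z = 0" "f2 z = 0"
proof -
  have "((\<lambda>_. 0) has_derivative (\<lambda>_. 0)) (at z)" by simp
  then have "(f has_derivative (\<lambda>_. 0)) (at z)"
    by (rule has_derivative_transform_within_open[OF _ assms(2,4)]) (use assms(3) in auto)
  moreover have "(f has_derivative (\<lambda>h. fst h *\<^sub>R f1 z + snd h *\<^sub>R f2 z)) (at z)"
    using assms(1) unfolding grad_def by blast
  ultimately have "(\<lambda>h. fst h *\<^sub>R f1 z + snd h *\<^sub>R f2 z) = (\<lambda>_. 0)"
    using has_derivative_unique by blast
  from fun_cong[OF this, of "(1,0)"] fun_cong[OF this, of "(0,1)"]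
  show "f1 z = 0" "f2 z = 0" by simp_all
qed

lemma supp_in_grad:
  assumes "grad f f1 f2" "supp_in r f"
  shows "supp_in r f1" "supp_in r f2"
proof -
  have o: "open {z::real\<times>real. norm z > r}" by (intro open_Collect_less continuous_intros)
  show "supp_in r f1" "supp_in r f2"
    using grad_local_zero[OF assms(1) o] assms(2) by (auto simp: supp_in_def)
qed

lemma test_add: "test_function f \<Longrightarrow> test_function g \<Longrightarrow> test_function (\<lambda>z. f z + g z)"
  unfolding test_function_iff using smooth_add supp_in_add supp_in_mono
  by (metis max.cobounded1 max.cobounded2)

lemma test_mult: "smooth h \<Longrightarrow> test_function f \<Longrightarrow> test_function (\<lambda>z. h z * f z)"
  unfolding test_function_iff using smooth_mult supp_in_mult by blast

lemma test_cmult: "test_function f \<Longrightarrow> test_function (\<lambda>z. c * f z)"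
  by (rule test_mult) auto

lemma test_zero [simp]: "test_function (\<lambda>z. 0)"
  by (auto simp: test_function_iff supp_in_def)

lemma test_smooth: "test_function f \<Longrightarrow> smooth f"
  by (simp add: test_function_iff)

lemma grad_D1: "grad f f1 f2 \<Longrightarrow> D1 f = (\<lambda>z. - \<i> * f1 z)"
  by (simp add: D1_def grad_partial1)

lemma grad_D2: "grad f f1 f2 \<Longrightarrow> D2 f = (\<lambda>z. - \<i> * f2 z)"
  by (simp add: D2_def grad_partial2)

lemma smooth_D: assumes "smooth f" shows "smooth (D1 f)" "smooth (D2 f)"
  using smooth_mult[OF smooth_const[of "-\<i>"]] smooth_partial[OF assms] by (auto simp: D1_def D2_def)

lemma supp_in_D: assumes "smooth f" "supp_in r f" shows "supp_in r (D1 f)" "supp_in r (D2 f)"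
  using supp_in_grad[OF smooth_grad[OF assms(1)] assms(2)] by (auto simp: D1_def D2_def supp_in_def)

lemma test_D: assumes "test_function f" shows "test_function (D1 f)" "test_function (D2 f)"
  using assms smooth_D supp_in_D unfolding test_function_iff by blast+

lemma D_commute: "smooth f \<Longrightarrow> D1 (D2 f) = D2 (D1 f)"
proof -
  assume s: "smooth f"
  have "grad (D2 f) (\<lambda>z. -\<i> * partial1 (partial2 f) z) (\<lambda>z. -\<i> * partial2 (partial2 f) z)"
    unfolding D2_def by (intro grad_cmult smooth_grad smooth_partial s)
  moreover have "grad (D1 f) (\<lambda>z. -\<i> * partial1 (partial1 f) z) (\<lambda>z. -\<i> * partial2 (partial1 f) z)"
    unfolding D1_def by (intro grad_cmult smooth_grad smooth_partial s)
  ultimately show ?thesis by (simp add: grad_D1 grad_D2 partial_commute[OF s])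
qed

lemma D_add:
  assumes "smooth f" "smooth g"
  shows "D1 (\<lambda>z. f z + g z) = (\<lambda>z. D1 f z + D1 g z)" "D2 (\<lambda>z. f z + g z) = (\<lambda>z. D2 f z + D2 g z)"
  using grad_partial1[OF grad_add[OF assms[THEN smooth_grad]]] grad_partial2[OF grad_add[OF assms[THEN smooth_grad]]]
  by (simp_all add: D1_def D2_def fun_eq_iff algebra_simps)

lemma D_mult:
  assumes "smooth f" "smooth g"
  shows "D1 (\<lambda>z. f z * g z) = (\<lambda>z. f z * D1 g z + D1 f z * g z)"
    "D2 (\<lambda>z. f z * g z) = (\<lambda>z. f z * D2 g z + D2 f z * g z)"
  using grad_partial1[OF grad_mult[OF assms[THEN smooth_grad]]] grad_partial2[OF grad_mult[OF assms[THEN smooth_grad]]]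
  by (simp_all add: D1_def D2_def fun_eq_iff algebra_simps)

lemma D_cmult:
  assumes "smooth f"
  shows "D1 (\<lambda>z. c * f z) = (\<lambda>z. c * D1 f z)" "D2 (\<lambda>z. c * f z) = (\<lambda>z. c * D2 f z)"
  using grad_partial1[OF grad_cmult[OF smooth_grad[OF assms], of c]] grad_partial2[OF grad_cmult[OF smooth_grad[OF assms], of c]]
  by (simp_all add: D1_def D2_def fun_eq_iff algebra_simps)

lemma D_funpow_props:
  assumes "smooth f"
  shows "smooth ((D1 ^^ n) f)" "smooth ((D2 ^^ n) f)"
  using assms by (induction n) (auto intro: smooth_D)

lemma D_funpow_supp:
  assumes "smooth f" "supp_in r f"
  shows "supp_in r ((D1 ^^ n) f)" "supp_in r ((D2 ^^ n) f)"
  using assms by (induction n) (auto intro: supp_in_D D_funpow_props)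

lemma smooth_D_pow: "smooth f \<Longrightarrow> smooth (D_pow \<alpha> f)"
  unfolding D_pow_def by (intro D_funpow_props)

lemma supp_in_D_pow: "smooth f \<Longrightarrow> supp_in r f \<Longrightarrow> supp_in r (D_pow \<alpha> f)"
  unfolding D_pow_def by (intro D_funpow_props D_funpow_supp)

lemma D_funpow_commute1: "smooth f \<Longrightarrow> D1 ((D2 ^^ n) f) = (D2 ^^ n) (D1 f)"
  by (induction n) (auto simp: D_commute D_funpow_props)

lemma D_pow_D_pow: "smooth f \<Longrightarrow> D_pow \<alpha> (D_pow \<beta> f) = D_pow (\<alpha> + \<beta>) f"
proof -
  assume s: "smooth f"
  obtain a b c d where ab: "\<alpha> = (a, b)" "\<beta> = (c, d)" by (cases \<alpha>, cases \<beta>)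
  have *: "(D2 ^^ b) ((D1 ^^ c) g) = (D1 ^^ c) ((D2 ^^ b) g)" if "smooth g" for g
    using that by (induction c arbitrary: g)
      (simp_all add: D_funpow_commute1[symmetric] D_funpow_props funpow_swap1 smooth_D)
  show ?thesis using s
    by (simp add: D_pow_def ab * D_funpow_props funpow_add)
qed

lemma D_pow_add:
  assumes "smooth f" "smooth g"
  shows "D_pow \<alpha> (\<lambda>z. f z + g z) = (\<lambda>z. D_pow \<alpha> f z + D_pow \<alpha> g z)"
proof -
  have 1: "(D1 ^^ n) (\<lambda>z. f z + g z) = (\<lambda>z. (D1 ^^ n) f z + (D1 ^^ n) g z)" if "smooth f" "smooth g" for n f g
    using that by (induction n) (auto simp: D_add D_funpow_props)
  have 2: "(D2 ^^ n) (\<lambda>z. f z + g z) = (\<lambda>z. (D2 ^^ n) f z + (D2 ^^ n) g z)" if "smooth f" "smooth g" for n f g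
    using that by (induction n) (auto simp: D_add D_funpow_props)
  show ?thesis unfolding D_pow_def using assms by (simp add: 1 2 D_funpow_props)
qed

lemma D_pow_cmult:
  assumes "smooth f"
  shows "D_pow \<alpha> (\<lambda>z. c * f z) = (\<lambda>z. c * D_pow \<alpha> f z)"
proof -
  have 1: "(D1 ^^ n) (\<lambda>z. c * f z) = (\<lambda>z. c * (D1 ^^ n) f z)" if "smooth f" for n f
    using that by (induction n) (auto simp: D_cmult D_funpow_props)
  have 2: "(D2 ^^ n) (\<lambda>z. c * f z) = (\<lambda>z. c * (D2 ^^ n) f z)" if "smooth f" for n f
    using that by (induction n) (auto simp: D_cmult D_funpow_props)
  show ?thesis unfolding D_pow_def using assms by (simp add: 1 2 D_funpow_props)
qed

subsection \<open>The algebra of differential operators\<close>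

abbreviation "look \<equiv> Poly_Mapping.lookup"
abbreviation "keys \<equiv> Poly_Mapping.keys"

text \<open>With the constants \<open>cst c\<close> and the generators \<open>X1\<close>,
  \<open>X2\<close>, identities between operators become ring computations.\<close>

definition cst :: "complex \<Rightarrow> diff_op" where "cst c = Poly_Mapping.single 0 c"
definition X1 :: diff_op where "X1 = Poly_Mapping.single (1, 0) 1"
definition X2 :: diff_op where "X2 = Poly_Mapping.single (0, 1) 1"

lemma diff_op_sum: "(P :: diff_op) = (\<Sum>\<alpha>\<in>keys P. Poly_Mapping.single \<alpha> (look P \<alpha>))"
  by (rule poly_mapping_eqI) (auto simp: lookup_sum lookup_single when_def in_keys_iff)

lemma cst_add: "cst (a + b) = cst a + cst b"
  and cst_mult: "cst (a * b) = cst a * cst b"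
  and cst_uminus: "cst (- a) = - cst a"
  and cst_diff: "cst (a - b) = cst a - cst b"
  and cst_0 [simp]: "cst 0 = 0"
  and cst_1 [simp]: "cst 1 = 1"
  by (simp_all add: cst_def single_add mult_single single_uminus single_diff)

lemma X_powers: "X1 ^ a * X2 ^ b = Poly_Mapping.single (a, b) 1"
proof -
  have 1: "X1 ^ a = Poly_Mapping.single (a, 0) 1" for a
    by (induction a) (auto simp: X1_def mult_single simp flip: single_one zero_prod_def)
  have 2: "X2 ^ a = Poly_Mapping.single (0, a) 1" for a
    by (induction a) (auto simp: X2_def mult_single simp flip: single_one zero_prod_def)
  show ?thesis by (simp add: 1 2 mult_single)
qed

lemma single_eq: "Poly_Mapping.single \<alpha> c = cst c * (X1 ^ fst \<alpha> * X2 ^ snd \<alpha>)"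
  unfolding X_powers by (simp add: cst_def mult_single)

lemma diff_op_induct_single [case_names add single]:
  fixes P :: diff_op
  assumes "\<And>P Q. Pr P \<Longrightarrow> Pr Q \<Longrightarrow> Pr (P + Q)" "\<And>\<alpha> c. Pr (Poly_Mapping.single \<alpha> c)"
  shows "Pr P"
proof -
  have "Pr (\<Sum>\<alpha>\<in>A. Poly_Mapping.single \<alpha> (look P \<alpha>))" if "finite A" for A
    using that
  proof (induction A)
    case empty then show ?case using assms(2)[of 0 0] by simp
  qed (auto intro: assms)
  then show ?thesis by (subst diff_op_sum) auto
qed

text \<open>One derivative is peeled off from the left at a time; in \<open>conv_apply_bound\<close>
  each of them is moved onto the kernel.\<close>

lemma diff_op_induct [case_names cst X1 X2 add]:
  fixes P :: diff_op
  assumes "\<And>c. Pr (cst c)" "\<And>P. Pr P \<Longrightarrow> Pr (X1 * P)" "\<And>P. Pr P \<Longrightarrow> Pr (X2 * P)"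
    "\<And>P Q. Pr P \<Longrightarrow> Pr Q \<Longrightarrow> Pr (P + Q)"
  shows "Pr P"
proof (induction P rule: diff_op_induct_single)
  case (single \<alpha> c)
  have 2: "Pr (X2 ^ b * cst c)" for b
    by (induction b) (auto intro: assms simp: mult.assoc)
  have "Pr (X1 ^ a * (X2 ^ b * cst c))" for a b
    by (induction a) (auto intro: assms 2 simp: mult.assoc)
  then show ?case by (simp add: single_eq mult_ac)
qed (use assms in auto)

lemma apply_op_superset:
  assumes "finite S" "keys P \<subseteq> S"
  shows "apply_op P f z = (\<Sum>\<alpha>\<in>S. look P \<alpha> * D_pow \<alpha> f z)"
  unfolding apply_op_def by (rule sum.mono_neutral_left) (use assms in \<open>auto simp: in_keys_iff\<close>)

lemma apply_op_add: "apply_op (P + Q) f = (\<lambda>z. apply_op P f z + apply_op Q f z)"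
proof
  fix z
  let ?S = "keys P \<union> keys Q"
  have "keys (P + Q) \<subseteq> ?S" by (rule keys_add)
  then show "apply_op (P + Q) f z = apply_op P f z + apply_op Q f z"
    by (simp add: apply_op_superset[of ?S] lookup_add ring_distribs sum.distrib)
qed

lemma apply_op_single: "apply_op (Poly_Mapping.single \<alpha> c) f = (\<lambda>z. c * D_pow \<alpha> f z)"
  by (simp add: fun_eq_iff apply_op_superset[of "{\<alpha>}"])

lemma apply_op_cst [simp]: "apply_op (cst c) f = (\<lambda>z. c * f z)"
  by (simp add: cst_def apply_op_single D_pow_def)

lemma apply_op_X: "apply_op X1 f = D1 f" "apply_op X2 f = D2 f"
  by (simp_all add: X1_def X2_def apply_op_single D_pow_def)

lemma apply_op_0 [simp]: "apply_op 0 f = (\<lambda>z. 0)"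
  by (simp add: apply_op_def)

lemma apply_op_1 [simp]: "apply_op 1 f = f"
  using apply_op_cst[of 1 f] by simp

lemma smooth_apply_op: "smooth f \<Longrightarrow> smooth (apply_op P f)"
  unfolding apply_op_def by (intro smooth_sum smooth_mult smooth_D_pow) auto

lemma supp_in_apply_op: "smooth f \<Longrightarrow> supp_in r f \<Longrightarrow> supp_in r (apply_op P f)"
  unfolding apply_op_def by (intro supp_in_sum supp_in_mult supp_in_D_pow) auto

lemma test_apply_op: "test_function f \<Longrightarrow> test_function (apply_op P f)"
  unfolding test_function_iff using smooth_apply_op supp_in_apply_op by blast

lemma apply_op_fun_add: "smooth f \<Longrightarrow> smooth g \<Longrightarrow>
    apply_op P (\<lambda>z. f z + g z) = (\<lambda>z. apply_op P f z + apply_op P g z)"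
  by (simp add: apply_op_def D_pow_add ring_distribs sum.distrib)

lemma apply_op_fun_cmult: "smooth f \<Longrightarrow> apply_op P (\<lambda>z. c * f z) = (\<lambda>z. c * apply_op P f z)"
  by (simp add: apply_op_def D_pow_cmult sum_distrib_left mult_ac)

lemma apply_op_mult:
  assumes "smooth f"
  shows "apply_op (P * Q) f = apply_op P (apply_op Q f)"
proof (induction P rule: diff_op_induct_single)
  case (add P Q) then show ?case by (simp add: ring_distribs apply_op_add)
next
  case (single \<alpha> c)
  show ?case
  proof (induction Q rule: diff_op_induct_single)
    case (add P Q)
    then show ?case using assms
      by (simp add: ring_distribs apply_op_add apply_op_fun_add smooth_apply_op)
  next
    case (single \<beta> d)
    then show ?case using assms
      by (simp add: mult_single apply_op_single D_pow_cmult smooth_D_pow D_pow_D_pow mult.assoc)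
  qed
qed

lemma D_pow_eq_apply: "D_pow \<alpha> f = apply_op (X1 ^ fst \<alpha> * X2 ^ snd \<alpha>) f"
  by (simp add: X_powers apply_op_single)

declare split_paired_All [simp del] split_paired_Ex [simp del]

subsection \<open>The \<open>L\<^sup>p\<close> norm on continuous functions of compact support\<close>

lemma Cc_integrable:
  fixes f :: "'a::euclidean_space \<Rightarrow> 'b::{banach, second_countable_topology}"
  assumes "continuous_on UNIV f" "\<And>z. norm z > r \<Longrightarrow> f z = 0"
  shows "integrable lborel f"
proof -
  have "integrable lborel (\<lambda>x. indicator (cball 0 r) x *\<^sub>R f x)"
    by (rule borel_integrable_compact[OF compact_cball continuous_on_subset[OF assms(1)]]) simp
  moreover have "(\<lambda>x. indicator (cball 0 r) x *\<^sub>R f x) = f"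
    using assms(2) by (auto simp: fun_eq_iff indicator_def not_le)
  ultimately show ?thesis by simp
qed

lemma Cc_Fubini:
  fixes f :: "'a::euclidean_space \<Rightarrow> 'b::euclidean_space \<Rightarrow> 'c::{banach, second_countable_topology}"
  assumes "continuous_on UNIV (\<lambda>(x, y). f x y)" "\<And>x y. norm (x, y) > r \<Longrightarrow> f x y = 0"
  shows "(\<integral>y. (\<integral>x. f x y \<partial>lborel) \<partial>lborel) = (\<integral>x. (\<integral>y. f x y \<partial>lborel) \<partial>lborel)"
proof (rule lborel_pair.Fubini_integral)
  show "integrable (lborel \<Otimes>\<^sub>M lborel) (\<lambda>(x, y). f x y)"
    unfolding lborel_prod using assms by (intro Cc_integrable[of _ r]) auto
qed

lemma integral_lborel_translate:
  fixes f :: "'a::euclidean_space \<Rightarrow> 'b::{banach, second_countable_topology}"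
  assumes "f \<in> borel_measurable borel"
  shows "(\<integral>x. f (a + x) \<partial>lborel) = (\<integral>x. f x \<partial>lborel)"
  using integral_distr[of "(+) a" lborel borel f] assms by (simp add: lborel_distr_plus)

lemma integral_lborel_scale:
  fixes f :: "real \<times> real \<Rightarrow> complex"
  assumes "f \<in> borel_measurable borel" "c > 0"
  shows "(\<integral>x. f x \<partial>lborel) = of_real (c\<^sup>2) * (\<integral>x. f (c *\<^sub>R x) \<partial>lborel)"
proof -
  have *: "lborel = density (distr lborel borel (\<lambda>x::real\<times>real. c *\<^sub>R x)) (\<lambda>_. ennreal (c\<^sup>2))"
    using lborel_affine[of c "0::real\<times>real"] assms(2) by (simp add: power2_eq_square)
  have "(\<integral>x. f x \<partial>lborel) = (\<integral>x. c\<^sup>2 *\<^sub>R f x \<partial>distr lborel borel (\<lambda>x. c *\<^sub>R x))"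
    by (subst *, subst integral_density) (use assms in auto)
  also have "\<dots> = (\<integral>x. c\<^sup>2 *\<^sub>R f (c *\<^sub>R x) \<partial>lborel)"
    by (rule integral_distr) (use assms in auto)
  also have "\<dots> = of_real (c\<^sup>2) * (\<integral>x. f (c *\<^sub>R x) \<partial>lborel)"
    by (simp add: scaleR_conv_of_real)
  finally show ?thesis .
qed

text \<open>The norm estimates need no smoothness. This class is closed under the convolutions and
  dilations below, so their results need not be shown to be test functions.\<close>

definition Cc :: "(real \<times> real \<Rightarrow> complex) \<Rightarrow> bool" where
  "Cc f \<longleftrightarrow> continuous_on UNIV f \<and> (\<exists>r. supp_in r f)"

lemma test_Cc: "test_function f \<Longrightarrow> Cc f"
  by (simp add: test_function_iff Cc_def smooth_continuous)

lemma Cc_cont: "Cc f \<Longrightarrow> continuous_on S f"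
  unfolding Cc_def by (meson continuous_on_subset subset_UNIV)

lemma Cc_measurable: "Cc f \<Longrightarrow> f \<in> borel_measurable borel"
  using Cc_cont borel_measurable_continuous_onI by blast

lemma Cc_add: "Cc f \<Longrightarrow> Cc g \<Longrightarrow> Cc (\<lambda>z. f z + g z)"
  unfolding Cc_def using supp_in_add supp_in_mono
  by (metis max.cobounded1 max.cobounded2 continuous_on_add)

lemma Cc_mult: "continuous_on UNIV h \<Longrightarrow> Cc f \<Longrightarrow> Cc (\<lambda>z. h z * f z)"
  unfolding Cc_def using supp_in_mult by (metis continuous_on_mult)

lemma Cc_cmult: "Cc f \<Longrightarrow> Cc (\<lambda>z. c * f z)"
  by (rule Cc_mult) auto

lemma Cc_translate: "Cc f \<Longrightarrow> Cc (\<lambda>z. f (a + z))"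
proof -
  assume *: "Cc f"
  then obtain r where r: "supp_in r f" by (auto simp: Cc_def)
  have "supp_in (r + norm a) (\<lambda>z. f (a + z))"
    unfolding supp_in_def
  proof (intro allI impI)
    fix z :: "real \<times> real" assume "norm z > r + norm a"
    then have "norm (a + z) > r" using norm_triangle_ineq2[of z "- a"] by (simp add: add.commute)
    then show "f (a + z) = 0" using r unfolding supp_in_def by blast
  qed
  moreover have "continuous_on UNIV (\<lambda>z. f (a + z))"
    by (rule continuous_on_compose2[OF Cc_cont[OF *, of UNIV]]) (auto intro!: continuous_intros)
  ultimately show ?thesis by (auto simp: Cc_def)
qed

lemma Cc_bounded: assumes "Cc f" shows "\<exists>M\<ge>0. \<forall>z. norm (f z) \<le> M"
proof -
  obtain r where r: "supp_in r f" using assms by (auto simp: Cc_def)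
  have "bounded (f ` cball 0 r)"
    by (intro compact_imp_bounded compact_continuous_image Cc_cont[OF assms] compact_cball)
  then obtain M where M: "\<And>z. norm z \<le> r \<Longrightarrow> norm (f z) \<le> M"
    unfolding bounded_iff by (meson imageI mem_cball_0)
  have "norm (f z) \<le> max 0 M" for z
    using M[of z] r by (cases "norm z \<le> r") (auto simp: supp_in_def)
  then show ?thesis by (intro exI[of _ "max 0 M"]) auto
qed

lemma Cc_uniformly_continuous:
  assumes "Cc f" "e > 0"
  shows "\<exists>d>0. \<forall>x y. norm (x - y) < d \<longrightarrow> norm (f x - f y) < e"
proof -
  obtain r where r: "supp_in r f" using assms by (auto simp: Cc_def)
  \<comment> \<open>The margin 1 suffices: if two points are closer than 1 and one of them has norm
    above r + 1, both lie outside radius r, where f vanishes.\<close>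
  have "uniformly_continuous_on (cball 0 (r + 1)) f"
    by (intro compact_uniformly_continuous Cc_cont[OF assms(1)] compact_cball)
  then obtain d where d: "d > 0" "\<And>x y. x \<in> cball 0 (r + 1) \<Longrightarrow> y \<in> cball 0 (r + 1) \<Longrightarrow> dist y x < d \<Longrightarrow> dist (f y) (f x) < e"
    unfolding uniformly_continuous_on_def using assms(2) by metis
  show ?thesis
  proof (intro exI[of _ "min d 1"] conjI allI impI)
    fix x y :: "real \<times> real" assume xy: "norm (x - y) < min d 1"
    show "norm (f x - f y) < e"
    proof (cases "norm x \<le> r + 1 \<and> norm y \<le> r + 1")
      case True
      then show ?thesis using d(2)[of y x] xy by (simp add: dist_norm)
    next
      case False
      have "norm x \<le> norm y + 1" "norm y \<le> norm x + 1"
        using xy norm_triangle_ineq2[of x y] norm_triangle_ineq2[of y x] by (auto simp: norm_minus_commute)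
      then have "norm x > r" "norm y > r" using False by auto
      then have "f x = 0" "f y = 0" using r unfolding supp_in_def by blast+
      then show ?thesis using assms(2) by simp
    qed
  qed (use d in auto)
qed

lemma open_positive_measure:
  assumes "open S" "S \<noteq> {}" shows "S \<notin> null_sets (lborel :: (real\<times>real) measure)"
  using open_not_negligible[OF assms] null_sets_completionI[of S lborel]
  by (auto simp: negligible_iff_null_sets)

lemma Linf_le:
  assumes "Cc f" "\<And>z. norm (f z) \<le> M" "M \<ge> 0"
  shows "Lp_norm \<infinity> f \<le> M"
proof -
  have "esssup lborel (\<lambda>z. ennreal (norm (f z))) \<le> ennreal M"
    using assms Cc_measurable[OF assms(1)] by (intro esssup_I) (auto intro: ennreal_leI)
  then show ?thesis using assms(3) by (simp add: Lp_norm_def enn2real_leI)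
qed

text \<open>The set on which a continuous function exceeds its essential supremum is open and null,
  hence empty. This makes the norm for p = \<infinity> an honest pointwise supremum.\<close>

lemma Linf_ge:
  assumes "Cc f"
  shows "norm (f z) \<le> Lp_norm \<infinity> f"
proof -
  let ?e = "esssup lborel (\<lambda>z. ennreal (norm (f z)))"
  obtain M where M: "M \<ge> 0" "\<And>z. norm (f z) \<le> M" using Cc_bounded[OF assms] by blast
  have "?e \<le> ennreal M"
    using M Cc_measurable[OF assms] by (intro esssup_I) (auto intro: ennreal_leI)
  then have fin: "?e < top" using le_less_trans ennreal_less_top by blast
  let ?S = "{z. norm (f z) > enn2real ?e}"
  have "AE z in lborel. ennreal (norm (f z)) \<le> ?e" by (rule esssup_AE)
  then have "AE z in lborel. z \<notin> ?S"
  proof eventually_elim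
    case (elim z)
    then have "norm (f z) \<le> enn2real ?e" using enn2real_mono[OF elim fin] by simp
    then show ?case by simp
  qed
  then have "{z \<in> space lborel. \<not> z \<notin> ?S} \<in> null_sets lborel"
    by (subst (asm) AE_iff_null_sets[symmetric]) (use Cc_measurable[OF assms] in auto)
  moreover have "open ?S"
    by (intro open_Collect_less continuous_intros Cc_cont assms)
  ultimately have "?S = {}" using open_positive_measure[of ?S] by auto
  then have "\<not> norm (f z) > enn2real ?e" by blast
  then show ?thesis by (simp add: Lp_norm_def)
qed

lemma Cc_powr_integrable:
  assumes "Cc f" "q \<ge> 1"
  shows "integrable lborel (\<lambda>z. norm (f z) powr q)"
proof -
  obtain r where "supp_in r f" using assms by (auto simp: Cc_def)
  then show ?thesis
    by (intro Cc_integrable[of _ r] continuous_on_powr' continuous_intros Cc_cont assms(1))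
       (use assms in \<open>auto simp: supp_in_def\<close>)
qed

text \<open>The convex function \<open>t powr q\<close> lies above its tangent at c. In the variable
  t / c this is Bernoulli's inequality, which comes from Young's. Minkowski's inequality and the
  Jensen step in \<open>conv_Lp\<close> both rest on it.\<close>

lemma powr_tangent:
  fixes c t q :: real
  assumes "c > 0" "t \<ge> 0" "q \<ge> 1"
  shows "c powr q + q * c powr (q - 1) * (t - c) \<le> t powr q"
proof (cases "t = 0")
  case True
  have "c powr (q - 1) * c = c powr q" using assms powr_add[of c "q-1" 1] by simp
  then have "q * c powr (q - 1) * c = q * c powr q" by (simp add: mult.assoc)
  moreover have "q * c powr q \<ge> c powr q" using assms by (simp add: mult_le_cancel_right1)
  ultimately show ?thesis using True assms by (simp add: algebra_simps)
next
  case False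
  define x where "x = t / c"
  have x: "x > 0" "t = x * c" using False assms by (auto simp: x_def)
  have "(x powr q) powr (1/q) * 1 powr (1 - 1/q) \<le> (1/q) * x powr q + (1 - 1/q) * 1"
    using assms x by (intro Youngs_inequality_0) auto
  then have "x \<le> (1/q) * x powr q + (1 - 1/q)" using assms x by (simp add: powr_powr)
  then have "q * x \<le> q * ((1/q) * x powr q + (1 - 1/q))" using assms by (intro mult_left_mono) auto
  then have "q * x \<le> x powr q + (q - 1)" using assms by (simp add: right_diff_distrib distrib_left)
  then have "(1 + q * (x - 1)) * c powr q \<le> x powr q * c powr q"
    by (intro mult_right_mono) (auto simp: algebra_simps)
  moreover have "c powr q = c powr (q - 1) * c" using assms powr_add[of c "q-1" 1] by simp
  then have "(1 + q * (x - 1)) * c powr q = c powr q + q * c powr (q - 1) * (t - c)"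
    using x by (simp add: algebra_simps)
  moreover have "x powr q * c powr q = t powr q" using x assms by (simp add: powr_mult)
  ultimately show ?thesis by simp
qed

lemma powr_convex_combination:
  fixes u v :: real
  assumes "a \<ge> 0" "b \<ge> 0" "a + b = 1" "u \<ge> 0" "v \<ge> 0" "q \<ge> 1"
  shows "(a * u + b * v) powr q \<le> a * u powr q + b * v powr q"
proof (cases "a * u + b * v = 0")
  case True
  then show ?thesis using assms by simp
next
  case False
  define c where "c = a * u + b * v"
  have c: "c > 0" using False assms unfolding c_def
    by (metis add_nonneg_nonneg mult_nonneg_nonneg order_le_less)
  have "a * (c powr q + q * c powr (q - 1) * (u - c)) + b * (c powr q + q * c powr (q - 1) * (v - c)) \<le> a * u powr q + b * v powr q"
    using assms c by (intro add_mono mult_left_mono powr_tangent) auto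
  moreover have "a * (c powr q + q * c powr (q - 1) * (u - c)) + b * (c powr q + q * c powr (q - 1) * (v - c))
     = (a + b) * c powr q + q * c powr (q - 1) * (a * u + b * v - (a + b) * c)"
    by (simp add: algebra_simps)
  ultimately show ?thesis using assms(3) by (simp add: c_def[symmetric])
qed

lemma Lq_def:
  assumes "q \<ge> 1" shows "Lp_norm (ennreal q) f = (\<integral>z. norm (f z) powr q \<partial>lborel) powr (1 / q)"
  using assms by (simp add: Lp_norm_def)

lemma Lp_nonneg: "Lp_norm p f \<ge> 0"
  by (simp add: Lp_norm_def)

lemma Lq_powr:
  assumes "q \<ge> 1" shows "Lp_norm (ennreal q) f powr q = (\<integral>z. norm (f z) powr q \<partial>lborel)"
  using assms integral_nonneg[of "\<lambda>z. norm (f z) powr q"] by (simp add: Lq_def powr_powr)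

lemma Lq_leI:
  assumes "q \<ge> 1" "(\<integral>z. norm (f z) powr q \<partial>lborel) \<le> M powr q" "M \<ge> 0"
  shows "Lp_norm (ennreal q) f \<le> M"
proof -
  have "Lp_norm (ennreal q) f \<le> (M powr q) powr (1/q)"
    unfolding Lq_def[OF assms(1)] using assms by (intro powr_mono2) auto
  then show ?thesis using assms by (simp add: powr_powr)
qed

lemma p_cases:
  assumes "(p::ennreal) \<ge> 1"
  obtains "p = \<infinity>" | q where "q \<ge> 1" "p = ennreal q"
proof (cases p)
  case (real q) then show ?thesis using assms that(2)[of q] by (simp add: ennreal_le_1)
qed (use that in auto)

text \<open>Minkowski's inequality by convexity: f and g are divided by (slightly enlarged) norms
  and recombined with weights proportional to these norms.\<close>

lemma Lp_triangle:
  assumes "p \<ge> 1" "Cc f" "Cc g"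
  shows "Lp_norm p (\<lambda>z. f z + g z) \<le> Lp_norm p f + Lp_norm p g"
  using assms(1)
proof (cases rule: p_cases)
  case 1
  have "norm (f z + g z) \<le> Lp_norm \<infinity> f + Lp_norm \<infinity> g" for z
    using Linf_ge[OF assms(2), of z] Linf_ge[OF assms(3), of z] norm_triangle_ineq[of "f z" "g z"] by linarith
  then show ?thesis unfolding 1 by (intro Linf_le Cc_add assms add_nonneg_nonneg Lp_nonneg)
next
  case (2 q)
  let ?a = "Lp_norm p f" and ?b = "Lp_norm p g"
  have "Lp_norm p (\<lambda>z. f z + g z) \<le> ?a + ?b + 2 * e" if "e > 0" for e
  proof -
    \<comment> \<open>The norms are enlarged by e so that A and B may be divided by even if f or g
      vanishes.\<close>
    define A B where "A = ?a + e" and "B = ?b + e"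
    have AB: "A > 0" "B > 0" using Lp_nonneg[of p f] Lp_nonneg[of p g] that by (auto simp: A_def B_def)
    define K where "K = (A + B) powr q"
    have pw: "norm (f z + g z) powr q \<le> K * (A / (A + B) * (norm (f z) powr q / A powr q)) + K * (B / (A + B) * (norm (g z) powr q / B powr q))" for z
    proof -
      have "norm (f z + g z) powr q \<le> (norm (f z) + norm (g z)) powr q"
        using 2 by (intro powr_mono2 norm_triangle_ineq) auto
      also have "norm (f z) + norm (g z) = (A + B) * (A / (A + B) * (norm (f z) / A) + B / (A + B) * (norm (g z) / B))"
        using AB by (simp add: distrib_left)
      also have "\<dots> powr q = K * (A / (A + B) * (norm (f z) / A) + B / (A + B) * (norm (g z) / B)) powr q"
        using AB by (simp add: K_def powr_mult)
      also have "\<dots> \<le> K * (A / (A + B) * (norm (f z) / A) powr q + B / (A + B) * (norm (g z) / B) powr q)"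
        using AB 2 by (intro mult_left_mono powr_convex_combination) (auto simp: K_def simp flip: add_divide_distrib)
      finally show ?thesis using AB by (simp add: powr_divide ring_distribs)
    qed
    have If: "(\<integral>z. norm (f z) powr q \<partial>lborel) \<le> A powr q"
      using Lq_powr[of q f] 2 AB Lp_nonneg[of p f] that powr_mono2[of q ?a A] by (simp add: A_def)
    have Ig: "(\<integral>z. norm (g z) powr q \<partial>lborel) \<le> B powr q"
      using Lq_powr[of q g] 2 AB Lp_nonneg[of p g] that powr_mono2[of q ?b B] by (simp add: B_def)
    note int = Cc_powr_integrable[OF assms(2) 2(1)] Cc_powr_integrable[OF assms(3) 2(1)]
    have "(\<integral>z. norm (f z + g z) powr q \<partial>lborel) \<le>
      (\<integral>z. K * (A / (A + B) * (norm (f z) powr q / A powr q)) + K * (B / (A + B) * (norm (g z) powr q / B powr q)) \<partial>lborel)"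
      using int Cc_powr_integrable[OF Cc_add[OF assms(2,3)] 2(1)] pw
      by (intro integral_mono) auto
    also have "\<dots> = K * (A / (A + B) * ((\<integral>z. norm (f z) powr q \<partial>lborel) / A powr q)) + K * (B / (A + B) * ((\<integral>z. norm (g z) powr q \<partial>lborel) / B powr q))"
      using int by (subst Bochner_Integration.integral_add) auto
    also have "\<dots> \<le> K * (A / (A + B) * 1) + K * (B / (A + B) * 1)"
      using If Ig AB by (intro add_mono mult_left_mono) (auto simp: K_def divide_le_eq)
    also have "\<dots> = (A + B) powr q" using AB by (simp add: K_def flip: ring_distribs add_divide_distrib)
    finally have "Lp_norm p (\<lambda>z. f z + g z) \<le> A + B"
      unfolding 2(2) using 2 AB by (intro Lq_leI) auto
    then show ?thesis by (simp add: A_def B_def)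
  qed
  then have "Lp_norm p (\<lambda>z. f z + g z) \<le> ?a + ?b + e" if "e > 0" for e
    using that half_gt_zero[OF that] by fastforce
  then show ?thesis by (rule field_le_epsilon)
qed

lemma Lp_cmult:
  assumes "p \<ge> 1" "Cc f"
  shows "Lp_norm p (\<lambda>z. c * f z) \<le> norm c * Lp_norm p f"
  using assms(1)
proof (cases rule: p_cases)
  case 1
  have "norm (c * f z) \<le> norm c * Lp_norm \<infinity> f" for z
    unfolding norm_mult by (intro mult_left_mono Linf_ge assms norm_ge_zero)
  then show ?thesis unfolding 1
    by (intro Linf_le Cc_cmult assms mult_nonneg_nonneg Lp_nonneg norm_ge_zero)
next
  case (2 q)
  have "(\<integral>z. norm (c * f z) powr q \<partial>lborel) = (norm c * Lp_norm p f) powr q"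
    using 2 by (simp add: norm_mult powr_mult Lp_nonneg Lq_powr)
  then show ?thesis unfolding 2(2) using 2 by (intro Lq_leI) (auto simp: Lp_nonneg)
qed

lemma Lp_translate:
  assumes "p \<ge> 1" "Cc f"
  shows "Lp_norm p (\<lambda>z. f (a + z)) \<le> Lp_norm p f"
  using assms(1)
proof (cases rule: p_cases)
  case 1
  show ?thesis unfolding 1
    by (rule Linf_le[OF Cc_translate[OF assms(2)]]) (rule Linf_ge[OF assms(2)] Lp_nonneg)+
next
  case (2 q)
  have "(\<integral>z. norm (f (a + z)) powr q \<partial>lborel) = (\<integral>z. norm (f z) powr q \<partial>lborel)"
    using Cc_measurable[OF assms(2)] by (intro integral_lborel_translate[of "\<lambda>z. norm (f z) powr q"]) simp
  then show ?thesis unfolding 2(2) using 2 by (simp add: Lq_def)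
qed

text \<open>For a fixed ball K is independent of f, so uniformly small errors with support in that
  ball are small in every norm. Both the approximate identity and the short-time expansion along
  lines use it.\<close>

lemma Lp_uniform_bound:
  assumes "p \<ge> 1"
  shows "\<exists>K\<ge>0. \<forall>f M. Cc f \<longrightarrow> supp_in r f \<longrightarrow> M \<ge> 0 \<longrightarrow> (\<forall>z. norm (f z) \<le> M) \<longrightarrow>
    Lp_norm p f \<le> K * M"
  using assms
proof (cases rule: p_cases)
  case 1
  then show ?thesis using Linf_le by (intro exI[of _ 1]) (auto simp: infinity_ennreal_def)
next
  case (2 q)
  define V where "V = measure lborel (cball (0::real\<times>real) r)"
  show ?thesis
  proof (intro exI[of _ "V powr (1/q)"] conjI allI impI)
    fix f :: "real \<times> real \<Rightarrow> complex" and M :: real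
    assume f: "Cc f" "supp_in r f" "M \<ge> 0" "\<forall>z. norm (f z) \<le> M"
    have "(\<integral>z. norm (f z) powr q \<partial>lborel) \<le> (\<integral>z. indicator (cball (0::real\<times>real) r) z * M powr q \<partial>lborel)"
    proof (rule integral_mono[OF Cc_powr_integrable[OF f(1) 2(1)]])
      show "integrable lborel (\<lambda>z::real\<times>real. indicator (cball 0 r) z * M powr q)"
        using emeasure_lborel_cball_finite by (intro integrable_mult_left integrable_real_indicator) auto
      show "norm (f z) powr q \<le> indicator (cball 0 r) z * M powr q" for z
        using f 2 by (cases "norm z \<le> r") (auto simp: supp_in_def intro: powr_mono2)
    qed
    also have "\<dots> = V * M powr q" by (simp add: V_def)
    also have "\<dots> = (V powr (1/q) * M) powr q"
      using 2 f(3) by (simp add: powr_mult powr_powr V_def)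
    finally show "Lp_norm p f \<le> V powr (1/q) * M"
      unfolding 2(2) using 2 f(3) by (intro Lq_leI) auto
  qed simp
qed

subsection \<open>Convolution with rescaled kernels\<close>

text \<open>The fundamental theorem on each line, followed by Fubini. Applied to a product this is
  integration by parts.\<close>

lemma integral_partial_zero:
  assumes "grad f f1 f2" "continuous_on UNIV f1" "continuous_on UNIV f2" "supp_in r f"
  shows "(\<integral>z. f1 z \<partial>lborel) = 0" "(\<integral>z. f2 z \<partial>lborel) = 0"
proof -
  have supp: "supp_in r f1" "supp_in r f2" using supp_in_grad assms by blast+
  have "integrable lborel f1" "integrable lborel f2"
    using assms supp by (auto intro!: Cc_integrable[of _ r] simp: supp_in_def)
  then have int: "integrable (lborel \<Otimes>\<^sub>M lborel) (\<lambda>(x, y). f1 (x, y))"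
      "integrable (lborel \<Otimes>\<^sub>M lborel) (\<lambda>(x, y). f2 (x, y))" by (simp_all add: lborel_prod)
  define a where "a = \<bar>r\<bar> + 1"
  have big: "norm (x, y) > r" if "\<bar>x\<bar> \<ge> a \<or> \<bar>y\<bar> \<ge> a" for x y :: real
    using that norm_fst_le[of x y] norm_snd_le[of y x] unfolding a_def real_norm_def by linarith
  have c: "continuous_on S (\<lambda>t. h (t, y))" "continuous_on S (\<lambda>t. h (y, t))"
    if "continuous_on UNIV h" for h :: "real \<times> real \<Rightarrow> complex" and y S
    by (rule continuous_on_compose2[OF that]; auto intro!: continuous_intros)+
  have z: "f1 (x, y) = 0" "f2 (y, x) = 0" if "x < - a \<or> x > a" for x y
    using that big[of x y] big[of y x] supp unfolding supp_in_def by (auto simp: abs_if split: if_splits)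
  have "(\<integral>x. f1 (x, y) \<partial>lborel) = 0" for y
  proof -
    have "(\<integral>x. indicator {-a .. a} x *\<^sub>R f1 (x, y) \<partial>lborel) = f (a, y) - f (- a, y)"
      by (rule integral_FTC_Icc) (auto simp: a_def intro!: grad_slice1[OF assms(1)] c assms)
    moreover have "(\<lambda>x. indicator {-a .. a} x *\<^sub>R f1 (x, y)) = (\<lambda>x. f1 (x, y))"
      using z by (auto simp: fun_eq_iff indicator_def not_le)
    ultimately show ?thesis using big[of a y] big[of "- a" y] assms(4) by (simp add: supp_in_def a_def)
  qed
  then show "(\<integral>z. f1 z \<partial>lborel) = 0"
    using lborel_pair.integral_snd[OF int(1)] by (simp add: lborel_prod)
  have "(\<integral>y. f2 (x, y) \<partial>lborel) = 0" for x
  proof -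
    have "(\<integral>y. indicator {-a .. a} y *\<^sub>R f2 (x, y) \<partial>lborel) = f (x, a) - f (x, - a)"
      by (rule integral_FTC_Icc) (auto simp: a_def intro!: grad_slice2[OF assms(1)] c assms)
    moreover have "(\<lambda>y. indicator {-a .. a} y *\<^sub>R f2 (x, y)) = (\<lambda>y. f2 (x, y))"
      using z by (auto simp: fun_eq_iff indicator_def not_le)
    ultimately show ?thesis using big[of x a] big[of x "- a"] assms(4) by (simp add: supp_in_def a_def)
  qed
  then show "(\<integral>z. f2 z \<partial>lborel) = 0"
    using lborel_pair.integral_fst[OF int(2)] by (simp add: lborel_prod)
qed

text \<open>For s > 0 this is convolution with the dilated kernel
  \<open>k (y / s) / s\<^sup>2\<close>. The substitution puts the scale into the argument of g, so
  the kernel integral that enters Young's inequality is the same at all scales.\<close>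

definition conv :: "real \<Rightarrow> (real \<times> real \<Rightarrow> complex) \<Rightarrow> (real \<times> real \<Rightarrow> complex) \<Rightarrow> real \<times> real \<Rightarrow> complex" where
  "conv s k g = (\<lambda>x. \<integral>y. k y * g (x - s *\<^sub>R y) \<partial>lborel)"

lemma continuous_reflect:
  "continuous_on UNIV g \<Longrightarrow> continuous_on S (\<lambda>y. g (x - s *\<^sub>R y))" for g :: "real \<times> real \<Rightarrow> complex"
  by (rule continuous_on_compose2[of UNIV g]) (auto intro!: continuous_intros)

lemma conv_integrand:
  assumes "Cc k" "continuous_on UNIV g"
  shows "Cc (\<lambda>y. k y * g (x - s *\<^sub>R y))"
  using Cc_mult[OF continuous_reflect[OF assms(2)] assms(1)] by (simp add: mult.commute)

lemma Cc_integrable': "Cc f \<Longrightarrow> integrable lborel f"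
  unfolding Cc_def supp_in_def using Cc_integrable by blast

lemma Cc_norm_integrable: "Cc f \<Longrightarrow> integrable lborel (\<lambda>y. norm (f y))"
  using Cc_integrable' by blast

lemma conv_integrable: "Cc k \<Longrightarrow> Cc g \<Longrightarrow> integrable lborel (\<lambda>y. k y * g (x - s *\<^sub>R y))"
  by (intro Cc_integrable' conv_integrand Cc_cont)

lemma conv_sup_bound:
  assumes "Cc k" "Cc g" "\<And>y. norm (g y) \<le> M"
  shows "norm (conv s k g x) \<le> (\<integral>y. norm (k y) \<partial>lborel) * M"
proof -
  have "norm (conv s k g x) \<le> (\<integral>y. norm (k y * g (x - s *\<^sub>R y)) \<partial>lborel)"
    unfolding conv_def by (rule integral_norm_bound)
  also have "\<dots> \<le> (\<integral>y. norm (k y) * M \<partial>lborel)"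
    by (intro integral_mono integrable_norm conv_integrable assms integrable_mult_left Cc_integrable')
       (auto simp: norm_mult intro: mult_left_mono assms)
  finally show ?thesis by simp
qed

lemma conv_diff:
  assumes "Cc k" "Cc l" "Cc g"
  shows "conv s (\<lambda>y. k y - l y) g = (\<lambda>x. conv s k g x - conv s l g x)"
  unfolding conv_def using conv_integrable assms by (simp add: left_diff_distrib)

lemma conv_add:
  assumes "Cc k" "Cc l" "Cc g"
  shows "conv s (\<lambda>y. k y + l y) g = (\<lambda>x. conv s k g x + conv s l g x)"
  unfolding conv_def using conv_integrable assms by (simp add: ring_distribs)

lemma conv_cmult: "conv s (\<lambda>y. c * k y) g = (\<lambda>x. c * conv s k g x)"
  unfolding conv_def by (simp add: mult.assoc)

lemma conv_fun_add:
  assumes "Cc k" "Cc g" "Cc h"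
  shows "conv s k (\<lambda>x. g x + h x) = (\<lambda>x. conv s k g x + conv s k h x)"
  unfolding conv_def using conv_integrable assms by (simp add: ring_distribs)

lemma conv_fun_cmult: "conv s k (\<lambda>x. c * g x) = (\<lambda>x. c * conv s k g x)"
  unfolding conv_def by (simp add: mult.left_commute)

lemma conv_supp:
  assumes "supp_in a k" "supp_in b g"
  shows "supp_in (b + \<bar>s\<bar> * a) (conv s k g)"
  unfolding supp_in_def
proof (intro allI impI)
  fix x :: "real \<times> real" assume x: "norm x > b + \<bar>s\<bar> * a"
  have "k y * g (x - s *\<^sub>R y) = 0" for y
  proof (cases "norm y > a")
    case False
    then have "norm (s *\<^sub>R y) \<le> \<bar>s\<bar> * a" by (auto intro: mult_left_mono)
    then have "norm (x - s *\<^sub>R y) > b" using x norm_triangle_ineq2[of x "s *\<^sub>R y"] by linarith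
    then show ?thesis using assms(2) unfolding supp_in_def by simp
  qed (use assms(1) in \<open>auto simp: supp_in_def\<close>)
  then have "(\<lambda>y. k y * g (x - s *\<^sub>R y)) = (\<lambda>_. 0)" by blast
  then show "conv s k g x = 0" unfolding conv_def by simp
qed

lemma conv_Cc:
  assumes "Cc k" "Cc g"
  shows "Cc (conv s k g)"
proof -
  let ?K = "\<integral>y. norm (k y) \<partial>lborel"
  have "continuous_on UNIV (conv s k g)"
    unfolding continuous_on_iff
  proof (intro ballI allI impI)
    fix x and e :: real assume "e > 0"
    have K: "?K \<ge> 0" by simp
    then have pos: "?K + 1 > 0" by (simp add: add_nonneg_pos)
    then have "e / (?K + 1) > 0" using \<open>e > 0\<close> by simp
    obtain d where d: "d > 0" "\<And>x y. norm (x - y) < d \<Longrightarrow> norm (g x - g y) < e / (?K + 1)"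
      using \<open>e / (?K + 1) > 0\<close> Cc_uniformly_continuous[OF assms(2)] by blast
    show "\<exists>d>0. \<forall>x'\<in>UNIV. dist x' x < d \<longrightarrow> dist (conv s k g x') (conv s k g x) < e"
    proof (intro exI conjI ballI impI)
      fix x' assume x': "dist x' x < d"
      have "conv s k g x' - conv s k g x = (\<integral>y. k y * (g (x' - s *\<^sub>R y) - g (x - s *\<^sub>R y)) \<partial>lborel)"
        unfolding conv_def using conv_integrable[OF assms] by (simp add: right_diff_distrib)
      also have "norm \<dots> \<le> (\<integral>y. norm (k y * (g (x' - s *\<^sub>R y) - g (x - s *\<^sub>R y))) \<partial>lborel)"
        by (rule integral_norm_bound)
      also have "\<dots> \<le> (\<integral>y. norm (k y) * (e / (?K + 1)) \<partial>lborel)"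
      proof (rule integral_mono)
        show "integrable lborel (\<lambda>y. norm (k y) * (e / (?K + 1)))"
          by (intro integrable_mult_left Cc_norm_integrable assms)
        show "integrable lborel (\<lambda>y. norm (k y * (g (x' - s *\<^sub>R y) - g (x - s *\<^sub>R y))))"
          using conv_integrable[OF assms] unfolding right_diff_distrib
          by (intro integrable_norm Bochner_Integration.integrable_diff) auto
        fix y
        have "norm (g (x' - s *\<^sub>R y) - g (x - s *\<^sub>R y)) < e / (?K + 1)"
          by (rule d) (use x' in \<open>simp add: dist_norm\<close>)
        then show "norm (k y * (g (x' - s *\<^sub>R y) - g (x - s *\<^sub>R y))) \<le> norm (k y) * (e / (?K + 1))"
          unfolding norm_mult by (intro mult_left_mono) auto
      qed
      also have "\<dots> = ?K * (e / (?K + 1))" by simp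
      also have "\<dots> < (?K + 1) * (e / (?K + 1))"
        using \<open>e / (?K + 1) > 0\<close> by (intro mult_strict_right_mono) auto
      also have "\<dots> = e" using pos by simp
      finally show "dist (conv s k g x') (conv s k g x) < e" by (simp add: dist_norm)
    qed (use d in auto)
  qed
  then show ?thesis using conv_supp assms unfolding Cc_def by blast
qed

text \<open>The factor 1/4 is the Jacobian of doubling in the plane; halving the argument of the
  kernel thus means passing to the next coarser scale.\<close>

lemma conv_scale:
  assumes "Cc k"  "Cc g"
  shows "conv s (\<lambda>y. k ((1/2) *\<^sub>R y) / 4) g = conv (2 * s) k g"
proof
  fix x
  have m: "(\<lambda>y. k ((1/2) *\<^sub>R y) / 4 * g (x - s *\<^sub>R y)) \<in> borel_measurable borel"
    by (intro borel_measurable_continuous_onI continuous_intros continuous_reflect Cc_cont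
        continuous_on_compose2[OF Cc_cont[OF assms(1), of UNIV]] assms) auto
  show "conv s (\<lambda>y. k ((1/2) *\<^sub>R y) / 4) g x = conv (2 * s) k g x"
    unfolding conv_def by (subst integral_lborel_scale[OF m, of 2]) (auto simp: mult.commute)
qed

text \<open>The integral of a y-derivative of \<open>k y * g (x - s y)\<close> is zero; the inner
  derivative of the reflected argument contributes \<open>- s\<close>.\<close>

lemma conv_D:
  assumes "test_function k" "test_function g"
  shows "conv s (D1 k) g = (\<lambda>x. of_real s * conv s k (D1 g) x)"
    "conv s (D2 k) g = (\<lambda>x. of_real s * conv s k (D2 g) x)"
proof -
  note sk = smooth_grad[OF test_smooth[OF assms(1)]] and sg = smooth_grad[OF test_smooth[OF assms(2)]]
  note Cc = assms[THEN test_Cc] test_D[OF assms(1), THEN test_Cc] test_D[OF assms(2), THEN test_Cc]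
  have p: "partial1 f = (\<lambda>z. \<i> * D1 f z)" "partial2 f = (\<lambda>z. \<i> * D2 f z)" for f
    by (simp_all add: D1_def D2_def fun_eq_iff)
  { fix x
    have g: "grad (\<lambda>y. k y * g (x - s *\<^sub>R y))
        (\<lambda>y. \<i> * (D1 k y * g (x - s *\<^sub>R y)) - \<i> * of_real s * (k y * D1 g (x - s *\<^sub>R y)))
        (\<lambda>y. \<i> * (D2 k y * g (x - s *\<^sub>R y)) - \<i> * of_real s * (k y * D2 g (x - s *\<^sub>R y)))"
      using grad_mult[OF sk grad_affine_arg[OF sg, of x "- s"]] by (simp add: p algebra_simps)
    have c: "continuous_on UNIV (\<lambda>y. \<i> * (k1 y * g (x - s *\<^sub>R y)) - \<i> * of_real s * (k y * g1 (x - s *\<^sub>R y)))"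
      if "Cc k1" "Cc g1" for k1 g1
      by (intro continuous_intros continuous_reflect Cc_cont Cc that)
    obtain r where "supp_in r (\<lambda>y. k y * g (x - s *\<^sub>R y))"
      using conv_integrand[OF Cc(1) Cc_cont[OF Cc(2)], of x s] by (auto simp: Cc_def)
    from integral_partial_zero[OF g c c this] Cc
    have "(\<integral>y. \<i> * (D1 k y * g (x - s *\<^sub>R y)) - \<i> * of_real s * (k y * D1 g (x - s *\<^sub>R y)) \<partial>lborel) = 0"
      "(\<integral>y. \<i> * (D2 k y * g (x - s *\<^sub>R y)) - \<i> * of_real s * (k y * D2 g (x - s *\<^sub>R y)) \<partial>lborel) = 0"
      by blast+
    then have "\<i> * conv s (D1 k) g x = \<i> * of_real s * conv s k (D1 g) x"
      "\<i> * conv s (D2 k) g x = \<i> * of_real s * conv s k (D2 g) x"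
      unfolding conv_def using conv_integrable Cc by simp_all
    then have "conv s (D1 k) g x = of_real s * conv s k (D1 g) x"
      "conv s (D2 k) g x = of_real s * conv s k (D2 g) x"
      by simp_all }
  then show "conv s (D1 k) g = (\<lambda>x. of_real s * conv s k (D1 g) x)"
    "conv s (D2 k) g = (\<lambda>x. of_real s * conv s k (D2 g) x)" by auto
qed

lemma Lp_zero: "p \<ge> 1 \<Longrightarrow> Lp_norm p (\<lambda>z. 0) = 0"
  using Lp_cmult[of p "\<lambda>z. 0" 0] Lp_nonneg[of p "\<lambda>z. 0"] test_Cc[OF test_zero] by simp

text \<open>Young's inequality, by Jensen's inequality for the weight \<open>|k|\<close> and Fubini's theorem.\<close>

lemma conv_Lp:
  assumes "p \<ge> 1" "Cc k" "Cc g"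
  shows "Lp_norm p (conv s k g) \<le> (\<integral>y. norm (k y) \<partial>lborel) * Lp_norm p g"
  using assms(1)
proof (cases rule: p_cases)
  case 1
  then show ?thesis unfolding 1
    by (intro Linf_le conv_Cc conv_sup_bound Linf_ge assms mult_nonneg_nonneg Lp_nonneg integral_nonneg) auto
next
  case (2 q)
  define K where "K = (\<integral>y. norm (k y) \<partial>lborel)"
  have K: "K \<ge> 0" by (simp add: K_def)
  obtain a b where ab: "supp_in a k" "supp_in b g" using assms by (auto simp: Cc_def)
  show ?thesis
  proof (cases "K = 0")
    case True
    obtain M where "\<And>z. norm (g z) \<le> M" using Cc_bounded[OF assms(3)] by blast
    then have "norm (conv s k g x) \<le> 0" for x
      using conv_sup_bound[OF assms(2,3), of M s x] True by (simp add: K_def)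
    then have "conv s k g = (\<lambda>x. 0)" by auto
    then show ?thesis using assms(1) by (simp add: Lp_zero Lp_nonneg)
  next
    case False
    then have K: "K > 0" using K by simp
    define h where "h x y = norm (k y) * norm (g (x - s *\<^sub>R y)) powr q" for x y
    have contg: "continuous_on UNIV (\<lambda>z. norm (g z) powr q)"
      using 2 by (intro continuous_on_powr' continuous_intros Cc_cont assms(3)) auto
    have hc: "continuous_on UNIV (\<lambda>(x, y). h x y)"
      unfolding h_def case_prod_unfold
      by (intro continuous_intros continuous_on_compose2[OF contg] continuous_on_compose2[OF Cc_cont[OF assms(2), of UNIV]]) auto
    have hs: "h x y = 0" if "norm (x, y) > \<bar>a\<bar> + (\<bar>b\<bar> + \<bar>s\<bar> * \<bar>a\<bar>)" for x y
    proof (cases "norm y > a")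
      case False
      then have "norm (s *\<^sub>R y) \<le> \<bar>s\<bar> * \<bar>a\<bar>" by (auto intro: mult_left_mono)
      moreover have "norm (x, y) \<le> norm x + norm y" by (rule norm_Pair_le)
      ultimately have "norm (x - s *\<^sub>R y) > b" using that False norm_triangle_ineq2[of x "s *\<^sub>R y"] by linarith
      then show ?thesis using ab(2) unfolding supp_in_def h_def by simp
    qed (use ab in \<open>auto simp: supp_in_def h_def\<close>)
    have hint: "integrable (lborel \<Otimes>\<^sub>M lborel) (\<lambda>(x, y). h x y)"
      unfolding lborel_prod by (rule Cc_integrable[OF hc]) (use hs in auto)
    have hx: "integrable lborel (h x)" for x
    proof (rule Cc_integrable[of _ a])
      show "continuous_on UNIV (h x)"
        unfolding h_def by (intro continuous_intros continuous_on_compose2[OF contg] Cc_cont assms) auto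
    qed (use ab in \<open>auto simp: h_def supp_in_def\<close>)
    have pw: "norm (conv s k g x) powr q \<le> K powr (q - 1) * (\<integral>y. h x y \<partial>lborel)" for x
    proof -
      define t where "t y = norm (g (x - s *\<^sub>R y))" for y
      define m where "m = (\<integral>y. norm (k y) * t y \<partial>lborel)"
      have int: "integrable lborel (\<lambda>y. norm (k y) * t y)"
        using integrable_norm[OF conv_integrable[OF assms(2,3), of x s]] by (simp add: norm_mult t_def)
      have nm: "norm (conv s k g x) \<le> m"
        using integral_norm_bound[of lborel "\<lambda>y. k y * g (x - s *\<^sub>R y)"]
        by (simp add: conv_def m_def t_def norm_mult)
      have hnn: "(\<integral>y. h x y \<partial>lborel) \<ge> 0" by (auto simp: h_def)
      show ?thesis
      proof (cases "m \<le> 0")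
        case True
        then have "norm (conv s k g x) = 0" using nm norm_ge_zero[of "conv s k g x"] by linarith
        then show ?thesis using hnn by simp
      next
        case False
        \<comment> \<open>c is the mean of t for the probability weight
          \<open>norm (k y) / K\<close>. When the tangent inequality at c is integrated, its linear
          terms cancel.\<close>
        define c where "c = m / K"
        have c: "c > 0" "m = K * c" using False K by (auto simp: c_def)
        have "(\<integral>y. norm (k y) * (c powr q - q * c powr (q - 1) * c) + q * c powr (q - 1) * (norm (k y) * t y) \<partial>lborel) \<le> (\<integral>y. h x y \<partial>lborel)"
        proof (rule integral_mono)
          show "integrable lborel (\<lambda>y. norm (k y) * (c powr q - q * c powr (q - 1) * c) + q * c powr (q - 1) * (norm (k y) * t y))"
            using int Cc_norm_integrable[OF assms(2)] by auto
          fix y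
          have "norm (k y) * (c powr q + q * c powr (q - 1) * (t y - c)) \<le> norm (k y) * t y powr q"
            using c 2 by (intro mult_left_mono powr_tangent) (auto simp: t_def)
          then show "norm (k y) * (c powr q - q * c powr (q - 1) * c) + q * c powr (q - 1) * (norm (k y) * t y) \<le> h x y"
            by (simp add: h_def t_def algebra_simps)
        qed (rule hx)
        also have "(\<integral>y. norm (k y) * (c powr q - q * c powr (q - 1) * c) + q * c powr (q - 1) * (norm (k y) * t y) \<partial>lborel)
          = K * (c powr q - q * c powr (q - 1) * c) + q * c powr (q - 1) * m"
          using int Cc_norm_integrable[OF assms(2)] by (simp add: K_def m_def)
        also have "\<dots> = K * c powr q" by (simp add: c(2) algebra_simps)
        finally have "K powr (q - 1) * (K * c powr q) \<le> K powr (q - 1) * (\<integral>y. h x y \<partial>lborel)"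
          by (intro mult_left_mono) auto
        moreover have "K powr (q - 1) * (K * c powr q) = m powr q"
          using K c by (simp add: c(2) powr_mult powr_diff)
        moreover have "norm (conv s k g x) powr q \<le> m powr q"
          using nm 2 by (intro powr_mono2) auto
        ultimately show ?thesis by linarith
      qed
    qed
    have trans: "(\<integral>x. norm (g (x - s *\<^sub>R y)) powr q \<partial>lborel) = Lp_norm p g powr q" for y
    proof -
      have "(\<integral>x. norm (g ((- s *\<^sub>R y) + x)) powr q \<partial>lborel) = (\<integral>x. norm (g x) powr q \<partial>lborel)"
        using Cc_measurable[OF assms(3)] by (intro integral_lborel_translate[of "\<lambda>z. norm (g z) powr q"]) simp
      then show ?thesis unfolding 2(2) Lq_powr[OF 2(1)] by simp
    qed
    have "(\<integral>x. norm (conv s k g x) powr q \<partial>lborel) \<le> (\<integral>x. K powr (q - 1) * (\<integral>y. h x y \<partial>lborel) \<partial>lborel)"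
    proof (rule integral_mono[OF _ _ pw])
      show "integrable lborel (\<lambda>x. K powr (q - 1) * (\<integral>y. h x y \<partial>lborel))"
        using lborel_pair.integrable_fst'[OF hint] by simp
    qed (intro Cc_powr_integrable conv_Cc assms 2)
    also have "\<dots> = K powr (q - 1) * (\<integral>y. (\<integral>x. h x y \<partial>lborel) \<partial>lborel)"
      by (simp add: Cc_Fubini[OF hc hs])
    also have "\<dots> = K powr (q - 1) * (K * Lp_norm p g powr q)"
      unfolding h_def by (simp add: trans K_def)
    also have "\<dots> = (K * Lp_norm p g) powr q"
      using K by (simp add: powr_mult Lp_nonneg powr_diff)
    finally show ?thesis
      unfolding 2(2) K_def[symmetric] using 2 K by (intro Lq_leI mult_nonneg_nonneg Lp_nonneg) auto
  qed
qed

text \<open>Uniform continuity of g makes the error uniformly small, and for s < 1 its support stays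
  in one ball, so \<open>Lp_uniform_bound\<close> covers every p.\<close>

lemma conv_limit:
  assumes "p \<ge> 1" "Cc k" "Cc g" "e > 0"
  shows "\<exists>d>0. \<forall>s. 0 < s \<longrightarrow> s < d \<longrightarrow>
    Lp_norm p (\<lambda>x. conv s k g x - (\<integral>y. k y \<partial>lborel) * g x) \<le> e"
proof -
  let ?K = "\<integral>y. norm (k y) \<partial>lborel"
  obtain a b where ab: "supp_in a k" "supp_in b g" using assms by (auto simp: Cc_def)
  obtain B where B: "B \<ge> 0" "\<And>f M. Cc f \<Longrightarrow> supp_in (\<bar>b\<bar> + \<bar>a\<bar>) f \<Longrightarrow> M \<ge> 0 \<Longrightarrow> (\<forall>z. norm (f z) \<le> M) \<Longrightarrow>
    Lp_norm p f \<le> B * M"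
    using Lp_uniform_bound[OF assms(1), of "\<bar>b\<bar> + \<bar>a\<bar>"] by blast
  define e' where "e' = e / ((B + 1) * (?K + 1))"
  have K: "?K \<ge> 0" by simp
  then have pos: "(B + 1) * (?K + 1) > 0" using B(1) by (simp add: add_nonneg_pos)
  then have e': "e' > 0" using assms(4) by (simp add: e'_def)
  obtain d where d: "d > 0" "\<And>x y. norm (x - y) < d \<Longrightarrow> norm (g x - g y) < e'"
    using Cc_uniformly_continuous[OF assms(3) e'] by blast
  show ?thesis
  proof (intro exI[of _ "min 1 (d / (\<bar>a\<bar> + 1))"] conjI allI impI)
    fix s assume s: "0 < s" "s < min 1 (d / (\<bar>a\<bar> + 1))"
    let ?f = "\<lambda>x. conv s k g x - (\<integral>y. k y \<partial>lborel) * g x"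
    have "norm (?f x) \<le> ?K * e'" for x
    proof -
      have "?f x = (\<integral>y. k y * (g (x - s *\<^sub>R y) - g x) \<partial>lborel)"
        unfolding conv_def using conv_integrable[OF assms(2,3)] Cc_integrable'[OF assms(2)]
        by (simp add: right_diff_distrib)
      also have "norm \<dots> \<le> (\<integral>y. norm (k y * (g (x - s *\<^sub>R y) - g x)) \<partial>lborel)"
        by (rule integral_norm_bound)
      also have "\<dots> \<le> (\<integral>y. norm (k y) * e' \<partial>lborel)"
      proof (rule integral_mono)
        show "integrable lborel (\<lambda>y. norm (k y) * e')"
          by (intro integrable_mult_left Cc_norm_integrable assms)
        show "integrable lborel (\<lambda>y. norm (k y * (g (x - s *\<^sub>R y) - g x)))"
          using conv_integrable[OF assms(2,3)] Cc_integrable'[OF assms(2)] unfolding right_diff_distrib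
          by (intro integrable_norm Bochner_Integration.integrable_diff) auto
        fix y
        show "norm (k y * (g (x - s *\<^sub>R y) - g x)) \<le> norm (k y) * e'"
        proof (cases "norm y > a")
          case True
          then show ?thesis using ab(1) by (simp add: supp_in_def)
        next
          case False
          then have "norm (s *\<^sub>R y) \<le> s * (\<bar>a\<bar> + 1)" using s by (auto intro: mult_left_mono)
          also have "\<dots> < d" using s by (simp add: pos_less_divide_eq)
          finally have "norm (g (x - s *\<^sub>R y) - g x) < e'" by (intro d) simp
          then show ?thesis unfolding norm_mult by (intro mult_left_mono) auto
        qed
      qed
      finally show ?thesis by simp
    qed
    moreover have "supp_in (\<bar>b\<bar> + \<bar>a\<bar>) ?f"
    proof (intro supp_in_diff supp_in_mult)
      have "\<bar>s\<bar> * a \<le> \<bar>s\<bar> * \<bar>a\<bar>" by (intro mult_left_mono) auto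
      also have "\<dots> \<le> 1 * \<bar>a\<bar>" using s by (intro mult_right_mono) auto
      finally have "\<bar>s\<bar> * a \<le> \<bar>a\<bar>" by simp
      then show "supp_in (\<bar>b\<bar> + \<bar>a\<bar>) (conv s k g)"
        by (intro supp_in_mono[OF conv_supp[OF ab, of s]]) auto
      show "supp_in (\<bar>b\<bar> + \<bar>a\<bar>) g" by (rule supp_in_mono[OF ab(2)]) simp
    qed
    moreover have "Cc ?f"
      using Cc_add[OF conv_Cc[OF assms(2,3), of s] Cc_cmult[OF assms(3), of "- (\<integral>y. k y \<partial>lborel)"]] by simp
    ultimately have "Lp_norm p ?f \<le> B * (?K * e')" using B(2)[of ?f "?K * e'"] e' K by simp
    also have "\<dots> \<le> ((B + 1) * (?K + 1)) * e'"
      unfolding mult.assoc[symmetric] using B(1) K e' by (intro mult_right_mono mult_mono) auto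
    also have "\<dots> = e" unfolding e'_def using nonzero_mult_div_cancel_left less_imp_neq[OF pos]
      by (metis times_divide_eq_right)
    finally show "Lp_norm p ?f \<le> e" .
  qed (use d in auto)
qed

subsection \<open>Smooth functions of one variable\<close>

text \<open>Smoothness is relative to a set, because \<open>ring_kernel\<close> contains a division
  by r and is glued from its restrictions to two overlapping half-lines.\<close>

fun C1k :: "nat \<Rightarrow> real set \<Rightarrow> (real \<Rightarrow> real) \<Rightarrow> bool" where
  "C1k 0 S f \<longleftrightarrow> continuous_on S f"
| "C1k (Suc n) S f \<longleftrightarrow> (\<exists>f'. (\<forall>x\<in>S. (f has_real_derivative f' x) (at x)) \<and> C1k n S f')"

lemma C1k_lower: "C1k (Suc n) S f \<Longrightarrow> C1k n S f"
proof (induction n arbitrary: f)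
  case 0
  then obtain f' where "\<forall>x\<in>S. (f has_real_derivative f' x) (at x)" by auto
  then show ?case unfolding C1k.simps by (meson DERIV_isCont continuous_at_imp_continuous_on)
next
  case (Suc n)
  then obtain f' where "\<forall>x\<in>S. (f has_real_derivative f' x) (at x)" "C1k (Suc n) S f'"
    by (metis C1k.simps(2))
  then show ?case using Suc.IH by (metis C1k.simps(2))
qed

lemma C1k_cong:
  assumes "open S" "\<And>x. x \<in> S \<Longrightarrow> f x = g x" "C1k n S f"
  shows "C1k n S g"
proof (cases n)
  case 0 then show ?thesis using assms by (simp cong: continuous_on_cong)
next
  case (Suc m)
  then obtain f' where f': "\<forall>x\<in>S. (f has_real_derivative f' x) (at x)" "C1k m S f'"
    using assms by auto
  have "(g has_real_derivative f' x) (at x)" if "x \<in> S" for x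
    using has_field_derivative_transform_within_open[OF f'(1)[rule_format, OF that] assms(1) that] assms(2) by blast
  then show ?thesis using f' Suc by auto
qed

text \<open>On the overlap the two candidate derivatives agree by uniqueness of derivatives, so they
  glue to one derivative and the induction continues.\<close>

lemma C1k_Un:
  assumes "open S" "open T" "C1k n S f" "C1k n T f"
  shows "C1k n (S \<union> T) f"
  using assms(3,4)
proof (induction n arbitrary: f)
  case 0 then show ?case using assms by (simp add: continuous_on_open_Un)
next
  case (Suc n)
  then obtain f1 f2 where *: "\<forall>x\<in>S. (f has_real_derivative f1 x) (at x)" "C1k n S f1"
      "\<forall>x\<in>T. (f has_real_derivative f2 x) (at x)" "C1k n T f2" by auto
  define f' where "f' x = (if x \<in> S then f1 x else f2 x)" for x
  have "f' x = f2 x" if "x \<in> T" for x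
    using * that DERIV_unique by (metis f'_def)
  then have "C1k n T f'" using C1k_cong[OF assms(2) _ *(4)] by simp
  moreover have "C1k n S f'" using C1k_cong[OF assms(1) _ *(2)] by (simp add: f'_def)
  ultimately have "C1k n (S \<union> T) f'" by (rule Suc.IH[rotated])
  moreover have "\<forall>x\<in>S\<union>T. (f has_real_derivative f' x) (at x)"
    using * by (auto simp: f'_def)
  ultimately show ?case by auto
qed

lemma C1k_const: "C1k n S (\<lambda>x. c)"
  by (induction n arbitrary: c) (auto intro!: derivative_eq_intros exI[of _ "\<lambda>x. 0"])

lemma C1k_add: "C1k n S f \<Longrightarrow> C1k n S g \<Longrightarrow> C1k n S (\<lambda>x. f x + g x)"
proof (induction n arbitrary: f g)
  case 0 then show ?case by (auto intro!: continuous_intros)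
next
  case (Suc n)
  then obtain f' g' where "\<forall>x\<in>S. (f has_real_derivative f' x) (at x)" "C1k n S f'"
    "\<forall>x\<in>S. (g has_real_derivative g' x) (at x)" "C1k n S g'" by auto
  then show ?case using Suc.IH by (auto intro!: exI[of _ "\<lambda>x. f' x + g' x"] DERIV_add)
qed

lemma C1k_mult: "C1k n S f \<Longrightarrow> C1k n S g \<Longrightarrow> C1k n S (\<lambda>x. f x * g x)"
proof (induction n arbitrary: f g)
  case 0 then show ?case by (auto intro!: continuous_intros)
next
  case (Suc n)
  note low = Suc.prems[THEN C1k_lower]
  from Suc obtain f' g' where "\<forall>x\<in>S. (f has_real_derivative f' x) (at x)" "C1k n S f'"
    "\<forall>x\<in>S. (g has_real_derivative g' x) (at x)" "C1k n S g'" by auto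
  then show ?case using Suc.IH low
    by (auto intro!: exI[of _ "\<lambda>x. f' x * g x + g' x * f x"] DERIV_mult C1k_add)
qed

lemma C1k_inverse: "C1k n {0<..} (\<lambda>x. inverse x)"
proof (induction n)
  case 0 then show ?case by (auto intro!: continuous_intros)
next
  case (Suc n)
  have "C1k n {0<..} (\<lambda>x. - 1 * (inverse x * inverse x))"
    by (intro C1k_mult C1k_const Suc)
  moreover have "((\<lambda>x. inverse x) has_real_derivative - 1 * (inverse x * inverse x)) (at x)" if "x > 0" for x :: real
    using that DERIV_inverse[of x] by (simp add: power2_eq_square)
  ultimately show ?case unfolding C1k.simps by (intro exI[of _ "\<lambda>x. - 1 * (inverse x * inverse x)"]) auto
qed

lemma C1k_affine: "C1k n UNIV f \<Longrightarrow> C1k n UNIV (\<lambda>x. f (a * x + b))"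
proof (induction n arbitrary: f)
  case 0 then show ?case by (auto intro!: continuous_on_compose2[of UNIV f] continuous_intros)
next
  case (Suc n)
  then obtain f' where f': "\<forall>x. (f has_real_derivative f' x) (at x)" "C1k n UNIV f'" by auto
  have "\<forall>x\<in>UNIV. ((\<lambda>x. f (a * x + b)) has_real_derivative f' (a * x + b) * a) (at x)"
    by (intro ballI DERIV_chain2[OF f'(1)[rule_format]]) (auto intro!: derivative_eq_intros)
  moreover have "C1k n UNIV (\<lambda>x. f' (a * x + b) * a)"
    by (intro C1k_mult C1k_const Suc.IH f')
  ultimately show ?case unfolding C1k.simps
    by (intro exI[of _ "\<lambda>x. f' (a * x + b) * a"] conjI)
qed

text \<open>The functions \<open>x\<^sup>-\<^sup>n exp (- 1 / x)\<close>, extended by zero. With the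
  powers included, the derivative stays in the linear span of the family, and smoothness of all
  members is a single induction.\<close>

definition flat :: "nat \<Rightarrow> real \<Rightarrow> real" where
  "flat n x = (if x \<le> 0 then 0 else inverse x ^ n * exp (- inverse x))"

lemma flat_deriv: "(flat n has_real_derivative flat (n + 2) x - of_nat n * flat (n + 1) x) (at x)"
proof -
  consider "x < 0" | "x > 0" | "x = 0" by linarith
  then show ?thesis
  proof cases
    case 1
    have "((\<lambda>_. 0) has_real_derivative 0) (at x)" by simp
    then have "(flat n has_real_derivative 0) (at x)"
      by (rule has_field_derivative_transform_within_open[of _ _ _ "{..<0}"]) (use 1 in \<open>auto simp: flat_def\<close>)
    then show ?thesis using 1 by (simp add: flat_def)
  next
    case 2
    have d1: "(inverse has_real_derivative - (inverse x ^ 2)) (at x)"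
      using 2 DERIV_inverse[of x] by (simp add: numeral_2_eq_2)
    have "((\<lambda>x. inverse x ^ n) has_real_derivative - of_nat n * inverse x ^ (n + 1)) (at x)"
      by (rule DERIV_cong[OF DERIV_power[OF d1, of n]], cases n) (simp_all add: power2_eq_square algebra_simps)
    from DERIV_mult[OF this DERIV_chain2[OF DERIV_exp DERIV_minus[OF d1]]]
    have "((\<lambda>x. inverse x ^ n * exp (- inverse x)) has_real_derivative
        flat (n + 2) x - of_nat n * flat (n + 1) x) (at x)"
      by (rule DERIV_cong) (use 2 in \<open>simp add: flat_def algebra_simps power_add power2_eq_square\<close>)
    then show ?thesis
      by (rule has_field_derivative_transform_within_open[of _ _ _ "{0<..}"]) (use 2 in \<open>auto simp: flat_def\<close>)
  next
    case 3
    have "((\<lambda>h. inverse h ^ Suc n / exp (inverse h)) \<longlongrightarrow> 0) (at_right (0::real))"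
      by (rule filterlim_compose[OF tendsto_power_div_exp_0 filterlim_inverse_at_top_right])
    then have "((\<lambda>h. flat n h / h) \<longlongrightarrow> 0) (at_right 0)"
    proof (rule Lim_transform_eventually)
      show "\<forall>\<^sub>F h in at_right 0. inverse h ^ Suc n / exp (inverse h) = flat n h / h"
        using eventually_at_right_less[of "0::real"]
        by eventually_elim (simp add: flat_def exp_minus field_simps)
    qed
    moreover have "((\<lambda>h. flat n h / h) \<longlongrightarrow> 0) (at_left 0)"
    proof (rule Lim_transform_eventually[OF tendsto_const])
      show "\<forall>\<^sub>F h in at_left 0. 0 = flat n h / h"
        by (rule eventually_at_leftI[of "-1"]) (auto simp: flat_def)
    qed
    ultimately have "((\<lambda>h. flat n h / h) \<longlongrightarrow> 0) (at 0)"
      by (simp add: filterlim_split_at)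
    then show ?thesis unfolding 3 DERIV_def by (simp add: flat_def)
  qed
qed

lemma C1k_flat: "C1k m UNIV (flat n)"
proof (induction m arbitrary: n)
  case 0
  show ?case unfolding C1k.simps
    by (intro continuous_at_imp_continuous_on ballI DERIV_isCont[OF flat_deriv])
next
  case (Suc m)
  have "C1k m UNIV (\<lambda>x. flat (n + 2) x + (- of_nat n) * flat (n + 1) x)"
    by (intro C1k_add C1k_mult C1k_const Suc)
  then show ?case using flat_deriv[of n] by (auto intro!: exI[of _ "\<lambda>x. flat (n + 2) x - of_nat n * flat (n + 1) x"])
qed

lemma flat_nonneg: "flat 0 x \<ge> 0" and flat_pos: "x > 0 \<Longrightarrow> flat 0 x > 0"
  and flat_zero: "x \<le> 0 \<Longrightarrow> flat 0 x = 0"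
  by (auto simp: flat_def)

lemma flat_mono: "x \<le> y \<Longrightarrow> flat 0 x \<le> flat 0 y"
  by (auto simp: flat_def)

section \<open>Radial profile of the dyadic kernel\<close>

definition ring_bump :: "real \<Rightarrow> real" where
  "ring_bump r = flat 0 (r - 1) * flat 0 (2 - r)"

lemma C1k_ring_bump: "C1k n UNIV ring_bump"
  unfolding ring_bump_def[abs_def]
  using C1k_mult[OF C1k_affine[OF C1k_flat, of n 0 1 "-1"] C1k_affine[OF C1k_flat, of n 0 "-1" 2]]
  by (simp add: algebra_simps)

lemma ring_bump_nonneg: "ring_bump r \<ge> 0"
  and ring_bump_zero: "r \<le> 1 \<or> r \<ge> 2 \<Longrightarrow> ring_bump r = 0"
  by (auto simp: ring_bump_def flat_nonneg flat_zero)

text \<open>A smooth step that is constant outside the interval from 1 to 2. It is not normalized: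
  its height only enters through the integral of u in \<open>dyadic_kernel\<close>, which is divided
  out in the end.\<close>

definition ring_step :: "real \<Rightarrow> real" where
  "ring_step x = integral {0..x} ring_bump"

lemma ring_step_low: "x \<le> 1 \<Longrightarrow> ring_step x = 0"
  unfolding ring_step_def by (rule integral_unique, rule has_integral_is_0) (auto simp: ring_bump_zero)

lemma ring_step_deriv: "(ring_step has_real_derivative ring_bump x) (at x)"
proof (cases "x < 1")
  case True
  have "((\<lambda>_. 0) has_real_derivative 0) (at x)" by simp
  then have "(ring_step has_real_derivative 0) (at x)"
    by (rule has_field_derivative_transform_within_open[of _ _ _ "{..<1}"]) (use True ring_step_low in auto)
  then show ?thesis using True by (simp add: ring_bump_zero)
next
  case False
  have "continuous_on {0..x+1} ring_bump"
    using C1k_ring_bump[of 0] continuous_on_subset by auto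
  from integral_has_real_derivative[OF this, of x]
  have "(ring_step has_real_derivative ring_bump x) (at x within {0..x + 1})"
    using False by (simp add: ring_step_def[abs_def])
  then show ?thesis using False by (simp add: at_within_Icc_at)
qed

lemma ring_step_high: "x \<ge> 2 \<Longrightarrow> ring_step x = ring_step 2"
proof (cases "x = 2")
  case False
  assume "x \<ge> 2"
  with False have "2 < x" by simp
  then show ?thesis
  proof (rule DERIV_isconst_end)
    show "continuous_on {2..x} ring_step"
      by (intro continuous_at_imp_continuous_on ballI DERIV_isCont[OF ring_step_deriv])
    show "DERIV ring_step t :> 0" if "2 < t" for t
      using ring_step_deriv[of t] that by (simp add: ring_bump_zero)
  qed
qed simp

lemma C1k_ring_step: "C1k n UNIV ring_step"
  by (rule C1k_lower) (use ring_step_deriv C1k_ring_bump in auto)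

text \<open>Here r stands for \<open>|\<zeta>|\<^sup>2\<close>, so r / 4 belongs to the halved
  point. As \<open>1 / \<zeta> = cnj \<zeta> / |\<zeta>|\<^sup>2\<close>, multiplication by the
  conjugate of \<zeta> gives the part of 1 / \<zeta> cut out by two consecutive steps, an annulus
  that avoids the pole.\<close>

definition ring_kernel :: "real \<Rightarrow> real" where
  "ring_kernel r = (ring_step r - ring_step (r / 4)) / r"

lemma ring_kernel_zero: "r \<le> 1 \<or> r \<ge> 8 \<Longrightarrow> ring_kernel r = 0"
  using ring_step_high[of r] ring_step_high[of "r / 4"]
  by (auto simp: ring_kernel_def ring_step_low)

lemma C1k_subset: "C1k n S f \<Longrightarrow> T \<subseteq> S \<Longrightarrow> C1k n T f"
proof (induction n arbitrary: f)
  case 0 then show ?case by (auto intro: continuous_on_subset)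
next
  case (Suc n) then show ?case by (metis C1k.simps(2) subsetD)
qed

lemma C1k_ring_kernel: "C1k n UNIV ring_kernel"
proof -
  have "C1k n UNIV (\<lambda>r. ring_step r + (-1) * ring_step ((1/4) * r + 0))"
    by (rule C1k_add[OF C1k_ring_step C1k_mult[OF C1k_const C1k_affine[OF C1k_ring_step]]])
  then have "C1k n {0<..} (\<lambda>r. (ring_step r + (-1) * ring_step ((1/4) * r + 0)) * inverse r)"
    by (intro C1k_mult C1k_inverse) (rule C1k_subset, auto)
  then have 1: "C1k n {0<..} ring_kernel"
    by (rule C1k_cong[rotated 2]) (auto simp: ring_kernel_def field_simps)
  have 2: "C1k n {..<1} ring_kernel"
    by (rule C1k_cong[OF _ _ C1k_const[of n _ 0]]) (auto simp: ring_kernel_zero)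
  have "{0<..} \<union> {..<1} = (UNIV :: real set)" by auto
  then show ?thesis using C1k_Un[OF _ _ 1 2] by simp
qed

text \<open>This is the derivative of \<open>r * ring_kernel r\<close>, in which the quotient
  disappears and only the two steps remain. The left-hand side is what
  \<open>D\<^sub>1 + z D\<^sub>2\<close> makes of the conjugate of \<zeta> times the radial
  kernel.\<close>

lemma ring_kernel_deriv:
  assumes "(ring_kernel has_real_derivative d) (at r)"
  shows "ring_kernel r + r * d = ring_bump r - ring_bump (r / 4) / 4"
proof -
  have "((\<lambda>r. r * ring_kernel r) has_real_derivative 1 * ring_kernel r + d * r) (at r)"
    by (intro DERIV_mult DERIV_ident assms)
  moreover have "(\<lambda>r. r * ring_kernel r) = (\<lambda>r. ring_step r - ring_step (r / 4))"
    by (auto simp: ring_kernel_def ring_step_low)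
  moreover have "((\<lambda>r. ring_step r - ring_step (r / 4)) has_real_derivative ring_bump r - ring_bump (r / 4) * (1 / 4)) (at r)"
    by (intro DERIV_diff ring_step_deriv DERIV_chain2[OF ring_step_deriv]) (auto intro!: derivative_eq_intros)
  ultimately have "1 * ring_kernel r + d * r = ring_bump r - ring_bump (r / 4) * (1 / 4)"
    using DERIV_unique by metis
  then show ?thesis by (simp add: mult.commute)
qed

subsection \<open>Radial functions and the dyadic kernel\<close>

text \<open>With \<open>\<zeta> = y - z x\<close> the operator \<open>D\<^sub>1 + z D\<^sub>2\<close> annihilates \<open>\<zeta>\<close>; for non-real \<open>z\<close> the form \<open>|\<zeta>|\<^sup>2\<close>
  is positive definite.\<close>

definition zeta :: "complex \<Rightarrow> real \<times> real \<Rightarrow> complex" where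
  "zeta z = (\<lambda>y. of_real (snd y) - z * of_real (fst y))"

definition zsq :: "complex \<Rightarrow> real \<times> real \<Rightarrow> real" where
  "zsq z = (\<lambda>y. (snd y - Re z * fst y)\<^sup>2 + (Im z * fst y)\<^sup>2)"

lemma zsq_zeta: "complex_of_real (zsq z y) = zeta z y * cnj (zeta z y)"
  by (simp add: complex_eq_iff zsq_def zeta_def power2_eq_square algebra_simps)

lemma zsq_scale: "zsq z (c *\<^sub>R y) = c\<^sup>2 * zsq z y"
  unfolding zsq_def fst_scaleR snd_scaleR real_scaleR_def by algebra

lemma continuous_radial:
  assumes "C1k 0 UNIV f" shows "continuous_on UNIV (\<lambda>y. f (zsq z y))"
proof -
  have "continuous_on UNIV (zsq z)" unfolding zsq_def by (intro continuous_intros)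
  then show ?thesis by (rule continuous_on_compose2[rotated]) (use assms in auto)
qed

lemma zsq_deriv:
  "(zsq z has_derivative (\<lambda>h. fst h * (- 2 * Re z * (snd y - Re z * fst y) + 2 * (Im z)\<^sup>2 * fst y) +
    snd h * (2 * (snd y - Re z * fst y)))) (at y)"
  unfolding zsq_def
  by (rule has_derivative_eq_rhs, (rule derivative_intros)+)
     (auto simp: fun_eq_iff algebra_simps power2_eq_square)

lemma grad_radial:
  assumes "\<forall>x. (f has_real_derivative f' x) (at x)"
  shows "grad (\<lambda>y. of_real (f (zsq z y)))
    (\<lambda>y. of_real (f' (zsq z y)) * of_real (- 2 * Re z * (snd y - Re z * fst y) + 2 * (Im z)\<^sup>2 * fst y))
    (\<lambda>y. of_real (f' (zsq z y)) * of_real (2 * (snd y - Re z * fst y)))"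
  unfolding grad_def
proof
  fix y
  have "((\<lambda>y. f (zsq z y)) has_derivative (\<lambda>h. f' (zsq z y) * (fst h * (- 2 * Re z * (snd y - Re z * fst y) + 2 * (Im z)\<^sup>2 * fst y) +
    snd h * (2 * (snd y - Re z * fst y))))) (at y)"
    using has_derivative_compose[OF zsq_deriv assms[rule_format, THEN has_field_derivative_imp_has_derivative]] .
  from has_derivative_of_real[OF this]
  show "((\<lambda>y. complex_of_real (f (zsq z y))) has_derivative (\<lambda>h. fst h *\<^sub>R (of_real (f' (zsq z y)) * of_real (- 2 * Re z * (snd y - Re z * fst y) + 2 * (Im z)\<^sup>2 * fst y))
      + snd h *\<^sub>R (of_real (f' (zsq z y)) * of_real (2 * (snd y - Re z * fst y))))) (at y)"
    by (rule has_derivative_eq_rhs) (simp add: fun_eq_iff scaleR_conv_of_real algebra_simps)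
qed

lemma Ck_radial: "C1k k UNIV f \<Longrightarrow> Ck k (\<lambda>y. of_real (f (zsq z y)))"
proof (induction k arbitrary: f)
  case 0
  then show ?case unfolding Ck.simps by (intro continuous_on_of_real continuous_radial)
next
  case (Suc k)
  then obtain f' where f': "\<forall>x. (f has_real_derivative f' x) (at x)" "C1k k UNIV f'" by auto
  have lin: "Ck k (\<lambda>y. of_real (a * fst y + b * snd y))" for a b
    using Ck_add[OF Ck_cmult[OF Ck_fst, of k "of_real a"] Ck_cmult[OF Ck_snd, of k "of_real b"]] by simp
  have "- 2 * Re z * (snd y - Re z * fst y) + 2 * (Im z)\<^sup>2 * fst y
      = (2 * (Re z)\<^sup>2 + 2 * (Im z)\<^sup>2) * fst y + (- 2 * Re z) * snd y" for y :: "real \<times> real"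
    by algebra
  moreover have "2 * (snd y - Re z * fst y) = (- 2 * Re z) * fst y + 2 * snd y" for y :: "real \<times> real"
    by algebra
  ultimately have "Ck k (\<lambda>y. of_real (- 2 * Re z * (snd y - Re z * fst y) + 2 * (Im z)\<^sup>2 * fst y))"
    "Ck k (\<lambda>y. of_real (2 * (snd y - Re z * fst y)))"
    by (simp_all only: lin)
  then have "Ck k (\<lambda>y. of_real (f' (zsq z y)) * of_real (- 2 * Re z * (snd y - Re z * fst y) + 2 * (Im z)\<^sup>2 * fst y))"
    "Ck k (\<lambda>y. of_real (f' (zsq z y)) * of_real (2 * (snd y - Re z * fst y)))"
    using Suc.IH[OF f'(2)] by (simp_all only: Ck_mult)
  then show ?case unfolding Ck_Suc_iff using grad_radial[OF f'(1), of z] by blast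
qed

lemma smooth_radial: "(\<And>k. C1k k UNIV f) \<Longrightarrow> smooth (\<lambda>y. of_real (f (zsq z y)))"
  by (simp add: smooth_def Ck_radial)

lemma supp_radial:
  assumes "Im z \<noteq> 0" "\<And>r. r \<ge> R \<Longrightarrow> f r = 0"
  shows "\<exists>M. supp_in M (\<lambda>y. complex_of_real (f (zsq z y)))"
proof -
  define S where "S = sqrt \<bar>R\<bar>"
  define M where "M = S / \<bar>Im z\<bar> + (S + \<bar>Re z\<bar> * (S / \<bar>Im z\<bar>))"
  have "norm y \<le> M" if "zsq z y < R" for y
  proof -
    have "(Im z * fst y)\<^sup>2 \<le> zsq z y" "(snd y - Re z * fst y)\<^sup>2 \<le> zsq z y"
      by (simp_all add: zsq_def)
    then have "(Im z * fst y)\<^sup>2 \<le> \<bar>R\<bar>" "(snd y - Re z * fst y)\<^sup>2 \<le> \<bar>R\<bar>"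
      using that by linarith+
    then have 1: "\<bar>Im z * fst y\<bar> \<le> S" "\<bar>snd y - Re z * fst y\<bar> \<le> S"
      unfolding S_def by (auto intro: real_le_rsqrt)
    then have 2: "\<bar>fst y\<bar> \<le> S / \<bar>Im z\<bar>" using assms(1)
      by (subst pos_le_divide_eq) (simp_all add: abs_mult mult.commute)
    then have "\<bar>Re z * fst y\<bar> \<le> \<bar>Re z\<bar> * (S / \<bar>Im z\<bar>)" unfolding abs_mult by (intro mult_left_mono) auto
    then have "\<bar>snd y\<bar> \<le> S + \<bar>Re z\<bar> * (S / \<bar>Im z\<bar>)" using 1 by linarith
    then show ?thesis using 2 norm_Pair_le[of "fst y" "snd y"] by (simp add: M_def)
  qed
  then have "f (zsq z y) = 0" if "norm y > M" for y
    using assms(2)[of "zsq z y"] that by (meson not_less)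
  then have "supp_in M (\<lambda>y. complex_of_real (f (zsq z y)))"
    unfolding supp_in_def by simp
  then show ?thesis ..
qed

lemma bump_exists: "\<exists>\<phi>. test_function \<phi> \<and> \<phi> 0 = 1 \<and> (\<forall>x. norm (\<phi> x) \<le> 1) \<and> supp_in 1 \<phi>"
proof -
  define f where "f r = flat 0 (1 - r) / flat 0 1" for r
  have zsq: "zsq \<i> y = (norm y)\<^sup>2" for y
    by (simp add: zsq_def norm_prod_def)
  have "C1k k UNIV f" for k
    using C1k_mult[OF C1k_affine[OF C1k_flat, of k 0 "-1" 1] C1k_const[of k UNIV "inverse (flat 0 1)"]]
    unfolding f_def[abs_def] divide_inverse by simp
  then have s: "smooth (\<lambda>y. of_real (f (zsq \<i> y)))" by (rule smooth_radial)
  have supp: "supp_in 1 (\<lambda>y. complex_of_real (f (zsq \<i> y)))"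
    by (auto simp: supp_in_def zsq f_def flat_zero)
  have "0 \<le> f r" "f r \<le> 1" if "r \<ge> 0" for r
    using that flat_mono[of "1 - r" 1] flat_pos[of 1] by (auto simp: f_def flat_nonneg)
  then have "norm (complex_of_real (f (zsq \<i> y))) \<le> 1" for y
    by (simp add: zsq)
  moreover have "f (zsq \<i> 0) = 1" using flat_pos[of 1] by (simp add: f_def zsq_def)
  ultimately show ?thesis using s supp
    by (intro exI[of _ "\<lambda>y. of_real (f (zsq \<i> y))"]) (auto simp: test_function_iff)
qed

text \<open>k is an annular piece of 1 / \<zeta>, a multiple of the fundamental solution of
  \<open>D\<^sub>1 + z D\<^sub>2\<close>. Since the operator annihilates 1 / \<zeta> off the origin,
  only the derivatives of the two cutoffs survive: a bump u and its dilation by 2 with the same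
  integral.\<close>

lemma dyadic_kernel:
  assumes "z \<notin> \<real>"
  shows "\<exists>k u. test_function k \<and> test_function u \<and> (\<integral>y. u y \<partial>lborel) \<noteq> 0 \<and>
    (\<forall>y. D1 k y + z * D2 k y = u y - u ((1/2) *\<^sub>R y) / 4)"
proof -
  have b: "Im z \<noteq> 0" using assms complex_is_Real_iff by blast
  define k where "k = (\<lambda>y. cnj (zeta z y) * of_real (ring_kernel (zsq z y)))"
  define u where "u = (\<lambda>y. of_real (2 * Im z) * complex_of_real (ring_bump (zsq z y)))"
  obtain f' where f': "\<forall>x. (ring_kernel has_real_derivative f' x) (at x)"
    using C1k_ring_kernel[of 1] by auto
  have gz: "grad (\<lambda>y. cnj (zeta z y)) (\<lambda>y. - cnj z) (\<lambda>y. 1)"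
    using grad_add[OF grad_snd grad_cmult[OF grad_fst, of "- cnj z"]] by (simp add: zeta_def)
  have "smooth (\<lambda>y. of_real (snd y) + (- cnj z) * of_real (fst y))"
    by (intro smooth_add smooth_mult smooth_const smooth_fst smooth_snd)
  moreover have "(\<lambda>y. of_real (snd y) + (- cnj z) * of_real (fst y)) = (\<lambda>y. cnj (zeta z y))"
    by (simp add: zeta_def)
  ultimately have sz: "smooth (\<lambda>y. cnj (zeta z y))" by simp
  have tr: "test_function (\<lambda>y. of_real (f (zsq z y)))"
    if "\<And>k. C1k k UNIV f" "\<And>r. r \<ge> R \<Longrightarrow> f r = 0" for f R
    unfolding test_function_iff using supp_radial[where f=f and R=R, OF b that(2)] smooth_radial[OF that(1)] by blast
  have tk: "test_function k" unfolding k_def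
    by (intro test_mult sz tr[OF C1k_ring_kernel, of 8]) (simp add: ring_kernel_zero)
  have tu: "test_function u" unfolding u_def
    by (intro test_mult smooth_const tr[OF C1k_ring_bump, of 2]) (simp add: ring_bump_zero)
  have eq: "D1 k y + z * D2 k y = u y - u ((1/2) *\<^sub>R y) / 4" for y
  proof -
    note g = grad_mult[OF gz grad_radial[OF f', of z]]
    let ?r = "zsq z y"
    define q1 q2 where "q1 = complex_of_real (- 2 * Re z * (snd y - Re z * fst y) + 2 * (Im z)\<^sup>2 * fst y)"
      and "q2 = complex_of_real (2 * (snd y - Re z * fst y))"
    \<comment> \<open>\<open>D\<^sub>1 + z D\<^sub>2\<close> maps the conjugate of \<zeta> to
      \<open>2 Im z\<close>, hence \<open>|\<zeta>|\<^sup>2\<close> to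
      \<open>2 (Im z) \<zeta>\<close>.\<close>
    have q: "- \<i> * (q1 + z * q2) = 2 * of_real (Im z) * zeta z y"
      by (simp add: complex_eq_iff q1_def q2_def zeta_def power2_eq_square)
    have z: "- \<i> * (z - cnj z) = 2 * of_real (Im z)" by (simp add: complex_eq_iff)
    have "D1 k y + z * D2 k y
      = - \<i> * (z - cnj z) * of_real (ring_kernel ?r) + cnj (zeta z y) * of_real (f' ?r) * (- \<i> * (q1 + z * q2))"
      unfolding k_def grad_D1[OF g] grad_D2[OF g] q1_def[symmetric] q2_def[symmetric]
      by (simp add: algebra_simps)
    also have "\<dots> = 2 * of_real (Im z) * (of_real (ring_kernel ?r) + (zeta z y * cnj (zeta z y)) * of_real (f' ?r))"
      unfolding z q by (simp add: algebra_simps)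
    also have "\<dots> = 2 * of_real (Im z) * of_real (ring_kernel ?r + ?r * f' ?r)"
      unfolding zsq_zeta[symmetric] by simp
    also have "ring_kernel ?r + ?r * f' ?r = ring_bump ?r - ring_bump (?r / 4) / 4"
      by (rule ring_kernel_deriv) (use f' in blast)
    also have "?r / 4 = zsq z ((1/2) *\<^sub>R y)" unfolding zsq_scale by (simp add: power2_eq_square)
    finally show ?thesis by (simp add: u_def algebra_simps)
  qed
  have "(\<integral>y. ring_bump (zsq z y) \<partial>lborel) \<noteq> 0"
  proof
    assume "(\<integral>y. ring_bump (zsq z y) \<partial>lborel) = 0"
    moreover have c: "continuous_on UNIV (\<lambda>y. ring_bump (zsq z y))"
      by (intro continuous_radial C1k_ring_bump)
    moreover obtain M where "supp_in M (\<lambda>y. complex_of_real (ring_bump (zsq z y)))"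
      using supp_radial[OF b, of 2 ring_bump] ring_bump_zero by blast
    then have "integrable lborel (\<lambda>y. ring_bump (zsq z y))"
      by (intro Cc_integrable[OF c, of M]) (auto simp: supp_in_def)
    ultimately have "AE y in lborel. ring_bump (zsq z y) = 0"
      using integral_nonneg_eq_0_iff_AE[of lborel "\<lambda>y. ring_bump (zsq z y)"] ring_bump_nonneg by simp
    moreover have "{y \<in> space lborel. \<not> ring_bump (zsq z y) = 0} \<in> sets lborel"
      using borel_measurable_continuous_onI[OF c] by simp
    ultimately have n: "{y. ring_bump (zsq z y) \<noteq> 0} \<in> null_sets lborel"
      using AE_iff_null[of lborel "\<lambda>y. ring_bump (zsq z y) = 0"] by simp
    have "open {y. ring_bump (zsq z y) \<noteq> 0}"
      by (intro open_Collect_neq c continuous_on_const)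
    with n have "{y. ring_bump (zsq z y) \<noteq> 0} = {}" using open_positive_measure by blast
    \<comment> \<open>3/2 is the midpoint of the interval from 1 to 2, inside which
      \<open>ring_bump\<close> is positive.\<close>
    moreover have "zsq z (0, sqrt (3/2)) = 3/2" by (simp add: zsq_def)
    then have "ring_bump (zsq z (0, sqrt (3/2))) \<noteq> 0"
      using flat_pos[of "1/2"] by (simp only: ring_bump_def) simp
    ultimately show False by blast
  qed
  then have "(\<integral>y. u y \<partial>lborel) \<noteq> 0" using b by (simp add: u_def)
  then show ?thesis using tk tu eq by blast
qed

subsection \<open>First-order factors with a real direction\<close>

lemma apply_linear_op:
  "apply_op (linear_op v a) g = (\<lambda>z. of_real (fst v) * D1 g z + of_real (snd v) * D2 g z + a * g z)"
proof -
  have "linear_op v a = Poly_Mapping.single (1, 0) (of_real (fst v)) + Poly_Mapping.single (0, 1) (of_real (snd v)) + cst a"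
    by (simp add: linear_op_def cst_def zero_prod_def)
  then show ?thesis by (simp add: apply_op_add apply_op_single D_pow_def)
qed

lemma grad_line:
  assumes "grad f f1 f2"
  shows "((\<lambda>s. f (x + (c * s) *\<^sub>R v)) has_vector_derivative
    of_real c * (of_real (fst v) * f1 (x + (c * s) *\<^sub>R v) + of_real (snd v) * f2 (x + (c * s) *\<^sub>R v))) (at s within S)"
proof -
  have "((\<lambda>s. x + (c * s) *\<^sub>R v) has_derivative (\<lambda>h. (c * h) *\<^sub>R v)) (at s within S)"
    by (auto intro!: derivative_eq_intros)
  moreover have "(f has_derivative (\<lambda>h. fst h *\<^sub>R f1 (x + (c * s) *\<^sub>R v) + snd h *\<^sub>R f2 (x + (c * s) *\<^sub>R v))) (at (x + (c * s) *\<^sub>R v))"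
    using assms unfolding grad_def by blast
  ultimately have "((\<lambda>s. f (x + (c * s) *\<^sub>R v)) has_derivative
     (\<lambda>h. fst ((c * h) *\<^sub>R v) *\<^sub>R f1 (x + (c * s) *\<^sub>R v) + snd ((c * h) *\<^sub>R v) *\<^sub>R f2 (x + (c * s) *\<^sub>R v))) (at s within S)"
    by (rule has_derivative_compose)
  then show ?thesis unfolding has_vector_derivative_def
    by (rule has_derivative_eq_rhs) (auto simp: fun_eq_iff scaleR_conv_of_real algebra_simps)
qed

lemma exp_bound: "0 \<le> y \<Longrightarrow> y \<le> 1 \<Longrightarrow> exp (- y) \<le> 1 - y / 2" for y :: real
proof -
  assume y: "0 \<le> y" "y \<le> 1"
  have "1 \<le> (1 + y) * (1 - y / 2)" using y mult_left_mono[of y 1 y] by (simp add: algebra_simps)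
  also have "\<dots> \<le> exp y * (1 - y / 2)" using y by (intro mult_right_mono) auto
  finally show ?thesis by (simp add: exp_minus field_simps)
qed

text \<open>Up to a uniformly small error, \<open>g\<close> is a contraction of a translate of \<open>g\<close> plus a small
  multiple of \<open>(L + a) g\<close>: integrate the ordinary differential equation along \<open>v\<close> over a short time
  in the direction in which \<open>exp (\<i> a s)\<close> decays.\<close>

lemma transport_estimate:
  assumes p: "p \<ge> 1" and a: "a \<notin> \<real>" and g: "test_function g"
  shows "Lp_norm p g \<le> 2 / \<bar>Im a\<bar> * Lp_norm p (apply_op (linear_op v a) g)"
proof -
  define b where "b = \<bar>Im a\<bar>"
  have b: "b > 0" using a complex_is_Real_iff by (auto simp: b_def)
  define \<sigma> where "\<sigma> = sgn (Im a)"
  have \<sigma>: "\<bar>\<sigma>\<bar> = 1" "\<sigma> * Im a = b" using b by (auto simp: \<sigma>_def b_def sgn_if)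
  define F where "F = apply_op (linear_op v a) g"
  have F: "Cc F" "Cc g" using g test_apply_op test_Cc by (auto simp: F_def)
  obtain r where r: "supp_in r F" "supp_in r g"
    using g supp_in_apply_op unfolding test_function_iff F_def by blast
  define r' where "r' = r + norm v"
  obtain K where K: "K \<ge> 0" "\<And>f M. Cc f \<Longrightarrow> supp_in r' f \<Longrightarrow> M \<ge> 0 \<Longrightarrow> (\<forall>z. norm (f z) \<le> M) \<Longrightarrow> Lp_norm p f \<le> K * M"
    using Lp_uniform_bound[OF p, of r'] by blast
  obtain M where M: "M \<ge> 0" "\<And>z. norm (F z) \<le> M" using Cc_bounded[OF F(1)] by blast
  have pd: "partial1 g = (\<lambda>z. \<i> * D1 g z)" "partial2 g = (\<lambda>z. \<i> * D2 g z)"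
    by (simp_all add: D1_def D2_def fun_eq_iff)
  have key: "Lp_norm p g * (b / 2) \<le> Lp_norm p F + K * e" if e: "e > 0" for e
  proof -
    have "((\<lambda>s. exp (\<i> * a * of_real (\<sigma> * s))) \<longlongrightarrow> exp (\<i> * a * of_real (\<sigma> * 0))) (at (0::real))"
      by (intro tendsto_intros)
    moreover have "e / (2 * (M + 1)) > 0" using e M by simp
    ultimately have "\<exists>d>0. \<forall>s. s \<noteq> 0 \<and> norm (s - 0) < d \<longrightarrow> norm (exp (\<i> * a * of_real (\<sigma> * s)) - exp (\<i> * a * of_real (\<sigma> * 0))) < e / (2 * (M + 1))"
      unfolding LIM_def dist_norm by blast
    then obtain d1 where d1: "d1 > 0" "\<And>s. s \<noteq> 0 \<Longrightarrow> \<bar>s\<bar> < d1 \<Longrightarrow> norm (exp (\<i> * a * of_real (\<sigma> * s)) - 1) < e / (2 * (M + 1))"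
      by auto
    obtain d2 where d2: "d2 > 0" "\<And>x y. norm (x - y) < d2 \<Longrightarrow> norm (F x - F y) < e / 2"
      using Cc_uniformly_continuous[OF F(1), of "e / 2"] e by auto
    \<comment> \<open>d1 and d2 bound the variation of the exponential factor and of F by e / 2
      each; h \<le> 1 keeps the translated support within radius r'; h \<le> 1 / b is the range of
      \<open>exp_bound\<close>.\<close>
    define h where "h = Min {d1 / 2, d2 / (2 * (norm v + 1)), 1, 1 / b}"
    have nv: "norm v + 1 > 0" by (simp add: add_nonneg_pos)
    have "h > 0" unfolding h_def using d1(1) d2(1) b nv by (subst Min_gr_iff) auto
    moreover have "h \<le> d1 / 2" "h \<le> d2 / (2 * (norm v + 1))" "h \<le> 1" "h \<le> 1 / b"
      unfolding h_def by (rule Min_le; simp)+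
    ultimately have h: "h > 0" "h \<le> d1 / 2" "h \<le> d2 / (2 * (norm v + 1))" "h \<le> 1" "h \<le> 1 / b"
      by auto
    have hb: "b * h \<le> 1" using h(5) b by (simp add: field_simps)
    have hv: "h * norm v < d2"
    proof -
      have "h * (norm v + 1) \<le> d2 / 2" using h(3) nv by (simp add: field_simps)
      moreover have "h * norm v \<le> h * (norm v + 1)" using h(1) by simp
      ultimately show ?thesis using d2(1) by linarith
    qed
    define E where "E x = exp (\<i> * a * of_real (\<sigma> * h)) * g (x + (\<sigma> * h) *\<^sub>R v) - g x - \<i> * of_real (\<sigma> * h) * F x" for x
    have E: "norm (E x) \<le> h * e" for x
    proof -
      define \<phi>' where "\<phi>' s = \<i> * of_real \<sigma> * (exp (\<i> * a * of_real (\<sigma> * s)) * F (x + (\<sigma> * s) *\<^sub>R v))" for s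
      have "((\<lambda>s. exp (\<i> * a * of_real (\<sigma> * s)) * g (x + (\<sigma> * s) *\<^sub>R v)) has_vector_derivative \<phi>' s) (at s within {0..h})" for s
      proof -
        have "((\<lambda>s. exp (\<i> * a * of_real (\<sigma> * s))) has_vector_derivative \<i> * a * of_real \<sigma> * exp (\<i> * a * of_real (\<sigma> * s))) (at s within {0..h})"
          unfolding of_real_mult
          by (rule has_vector_derivative_real_field[where f = "\<lambda>w. exp (\<i> * a * (of_real \<sigma> * w))"])
             (auto intro!: derivative_eq_intros)
        from has_vector_derivative_mult[OF this grad_line[OF smooth_grad[OF test_smooth[OF g]], of x \<sigma> v s "{0..h}"]]
        show ?thesis
          by (rule has_vector_derivative_eq_rhs)
             (simp add: \<phi>'_def F_def apply_linear_op pd algebra_simps)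
      qed
      then have "norm (exp (\<i> * a * of_real (\<sigma> * h)) * g (x + (\<sigma> * h) *\<^sub>R v) - exp (\<i> * a * of_real (\<sigma> * 0)) * g (x + (\<sigma> * 0) *\<^sub>R v) - (h - 0) *\<^sub>R \<phi>' 0)
        \<le> norm (h - 0) * e"
      proof (rule vector_differentiable_bound_linearization)
        show "closed_segment 0 h \<subseteq> {0..h}" "0 \<in> {0..h}" using h(1) by (auto simp: closed_segment_eq_real_ivl)
        fix s assume s: "s \<in> {0..h}"
        have "norm (\<phi>' s - \<phi>' 0) = norm (exp (\<i> * a * of_real (\<sigma> * s)) * F (x + (\<sigma> * s) *\<^sub>R v) - F x)"
        proof -
          have "\<phi>' s - \<phi>' 0 = \<i> * of_real \<sigma> * (exp (\<i> * a * of_real (\<sigma> * s)) * F (x + (\<sigma> * s) *\<^sub>R v) - F x)"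
            by (simp add: \<phi>'_def algebra_simps)
          then show ?thesis using \<sigma>(1) by (simp add: norm_mult)
        qed
        also have "exp (\<i> * a * of_real (\<sigma> * s)) * F (x + (\<sigma> * s) *\<^sub>R v) - F x
          = (exp (\<i> * a * of_real (\<sigma> * s)) - 1) * F (x + (\<sigma> * s) *\<^sub>R v) + (F (x + (\<sigma> * s) *\<^sub>R v) - F x)"
          by (simp add: algebra_simps)
        also have "norm \<dots> \<le> norm (exp (\<i> * a * of_real (\<sigma> * s)) - 1) * norm (F (x + (\<sigma> * s) *\<^sub>R v)) + norm (F (x + (\<sigma> * s) *\<^sub>R v) - F x)"
          by (metis norm_mult norm_triangle_ineq)
        also have "\<dots> \<le> e / (2 * (M + 1)) * (M + 1) + e / 2"
        proof (intro add_mono mult_mono)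
          show "norm (exp (\<i> * a * of_real (\<sigma> * s)) - 1) \<le> e / (2 * (M + 1))"
          proof (cases "s = 0")
            case False
            have "\<bar>s\<bar> < d1" using s h d1(1) by auto
            then show ?thesis using d1(2)[OF False] by simp
          qed (use e M in simp)
          have "norm ((x + (\<sigma> * s) *\<^sub>R v) - x) \<le> h * norm v"
            using s \<sigma>(1) by (auto simp: abs_mult intro: mult_right_mono)
          then have "norm ((x + (\<sigma> * s) *\<^sub>R v) - x) < d2" using hv by linarith
          from d2(2)[OF this] show "norm (F (x + (\<sigma> * s) *\<^sub>R v) - F x) \<le> e / 2" by simp
          show "norm (F (x + (\<sigma> * s) *\<^sub>R v)) \<le> M + 1" using M(2)[of "x + (\<sigma> * s) *\<^sub>R v"] by simp
        qed (use e M in auto)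
        also have "e / (2 * (M + 1)) * (M + 1) + e / 2 = e" using M(1) by (simp add: field_simps)
        finally show "norm (\<phi>' s - \<phi>' 0) \<le> e" .
      qed
      moreover have "(h - 0) *\<^sub>R \<phi>' 0 = \<i> * of_real (\<sigma> * h) * F x"
        by (simp add: \<phi>'_def scaleR_conv_of_real)
      ultimately show ?thesis using h(1) by (simp add: E_def)
    qed
    let ?T = "\<lambda>x. exp (\<i> * a * of_real (\<sigma> * h)) * g ((\<sigma> * h) *\<^sub>R v + x)"
    have T: "Cc ?T" by (intro Cc_cmult Cc_translate F)
    have F': "Cc (\<lambda>x. (- \<i> * of_real (\<sigma> * h)) * F x)" by (intro Cc_cmult F)
    have Eeq: "E = (\<lambda>x. ?T x + ((-1) * g x + (- \<i> * of_real (\<sigma> * h)) * F x))"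
      by (simp add: E_def fun_eq_iff add.commute)
    have CE: "Cc E" unfolding Eeq by (intro Cc_add T F' Cc_cmult F)
    have supp: "supp_in r' E"
      unfolding supp_in_def
    proof (intro allI impI)
      fix x :: "real \<times> real" assume x: "norm x > r'"
      have "norm ((\<sigma> * h) *\<^sub>R v) \<le> 1 * norm v"
        unfolding norm_scaleR using \<sigma>(1) h by (intro mult_right_mono) (auto simp: abs_mult)
      then have "norm (x + (\<sigma> * h) *\<^sub>R v) > r" using x norm_triangle_ineq2[of x "- ((\<sigma> * h) *\<^sub>R v)"] by (simp add: r'_def)
      moreover have "norm x > r" using x norm_ge_zero[of v] unfolding r'_def by linarith
      ultimately show "E x = 0" using r by (simp add: E_def supp_in_def)
    qed
    have NE: "Lp_norm p E \<le> K * (h * e)" using K(2)[OF CE supp, of "h * e"] E h(1) e by simp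
    have geq: "g = (\<lambda>x. ?T x + ((- \<i> * of_real (\<sigma> * h)) * F x + (-1) * E x))"
      by (simp add: E_def fun_eq_iff algebra_simps)
    have "Lp_norm p g \<le> Lp_norm p ?T + (Lp_norm p (\<lambda>x. (- \<i> * of_real (\<sigma> * h)) * F x) + Lp_norm p (\<lambda>x. (-1) * E x))"
      by (subst geq) (intro order_trans[OF Lp_triangle] add_left_mono Lp_triangle p T F' CE Cc_cmult Cc_add)
    also have "\<dots> \<le> exp (- (b * h)) * Lp_norm p g + (h * Lp_norm p F + K * (h * e))"
    proof (intro add_mono)
      have nexp: "norm (exp (\<i> * a * of_real (\<sigma> * h))) = exp (- (b * h))"
        unfolding norm_exp_eq_Re \<sigma>(2)[symmetric] by simp
      have "Lp_norm p ?T \<le> norm (exp (\<i> * a * of_real (\<sigma> * h))) * Lp_norm p (\<lambda>x. g ((\<sigma> * h) *\<^sub>R v + x))"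
        by (rule Lp_cmult[OF p Cc_translate[OF F(2)]])
      then have "Lp_norm p ?T \<le> exp (- (b * h)) * Lp_norm p (\<lambda>x. g ((\<sigma> * h) *\<^sub>R v + x))"
        by (simp only: nexp)
      also have "\<dots> \<le> exp (- (b * h)) * Lp_norm p g"
        by (intro mult_left_mono Lp_translate p F) auto
      finally show "Lp_norm p ?T \<le> exp (- (b * h)) * Lp_norm p g" .
      show "Lp_norm p (\<lambda>x. (- \<i> * of_real (\<sigma> * h)) * F x) \<le> h * Lp_norm p F"
        using Lp_cmult[OF p F(1), of "- \<i> * of_real (\<sigma> * h)"] \<sigma>(1) h(1) by (simp add: norm_mult abs_mult)
      show "Lp_norm p (\<lambda>x. (-1) * E x) \<le> K * (h * e)"
        using Lp_cmult[OF p CE, of "-1"] NE by simp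
    qed
    also have "\<dots> \<le> (1 - b * h / 2) * Lp_norm p g + (h * Lp_norm p F + K * (h * e))"
      using exp_bound[of "b * h"] b h hb by (intro add_right_mono mult_right_mono Lp_nonneg) auto
    \<comment> \<open>The decay \<open>exp (- (b * h)) \<le> 1 - b * h / 2\<close> leaves a multiple
      of h on the left. Every other term carries the factor h too, the expansion error being at most
      \<open>h * e\<close>, so h cancels and the estimate no longer depends on the step
      length.\<close>
    finally have "h * (Lp_norm p g * (b / 2)) \<le> h * (Lp_norm p F + K * e)"
      by (simp add: algebra_simps)
    then show ?thesis using h(1) by simp
  qed
  have "Lp_norm p g * (b / 2) \<le> Lp_norm p F + e" if e: "e > 0" for e
  proof -
    have "Lp_norm p g * (b / 2) \<le> Lp_norm p F + K * (e / (K + 1))"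
      using key[of "e / (K + 1)"] e K(1) by (simp add: add_nonneg_pos)
    also have "K * (e / (K + 1)) \<le> e" using K(1) e by (simp add: divide_le_eq algebra_simps)
    finally show ?thesis by simp
  qed
  then have "Lp_norm p g * (b / 2) \<le> Lp_norm p F" by (rule field_le_epsilon)
  then show ?thesis using b by (simp add: F_def b_def[symmetric] field_simps)
qed

subsection \<open>Powers of an elliptic first-order factor\<close>

definition ell :: "complex \<Rightarrow> diff_op" where
  "ell z = X1 + cst z * X2"

lemma apply_ell: "smooth f \<Longrightarrow> apply_op (ell z) f = (\<lambda>y. D1 f y + z * D2 f y)"
  by (simp add: ell_def apply_op_add apply_op_mult apply_op_X)

lemma conv_ell:
  assumes "test_function k" "test_function g"
  shows "conv s (apply_op (ell z) k) g = (\<lambda>x. of_real s * conv s k (apply_op (ell z) g) x)"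
proof -
  note t = test_D[OF assms(1), THEN test_Cc] test_D[OF assms(2), THEN test_Cc] assms[THEN test_Cc]
  show ?thesis using assms t
    by (simp add: apply_ell test_smooth conv_add conv_fun_add Cc_cmult conv_cmult conv_fun_cmult conv_D algebra_simps)
qed

lemma conv_X2_power:
  assumes "test_function k" "test_function g"
  shows "conv s (apply_op (X2 ^ n) k) g = (\<lambda>x. of_real s ^ n * conv s k (apply_op (X2 ^ n) g) x)"
  using assms
proof (induction n arbitrary: k)
  case (Suc n)
  have "apply_op (X2 ^ Suc n) k = apply_op (X2 ^ n) (D2 k)"
    using apply_op_mult[OF test_smooth[OF Suc.prems(1)], of "X2 ^ n" X2] by (simp add: apply_op_X mult.commute)
  moreover have "apply_op (X2 ^ Suc n) g = D2 (apply_op (X2 ^ n) g)"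
    using apply_op_mult[OF test_smooth[OF Suc.prems(2)], of X2 "X2 ^ n"] by (simp add: apply_op_X)
  ultimately show ?case
    using Suc by (simp add: test_D conv_D test_apply_op mult_ac)
qed simp

text \<open>At a fixed scale the convolution is smoothing: each derivative in P is moved onto the
  kernel at the price of a factor 1 / s. No order of P is too large, but C depends on s.\<close>

lemma conv_apply_bound:
  assumes "p \<ge> 1" "s > 0" "test_function k"
  shows "\<exists>C\<ge>0. \<forall>f. test_function f \<longrightarrow> Lp_norm p (conv s k (apply_op P f)) \<le> C * Lp_norm p f"
proof -
  have step: "\<exists>C\<ge>0. \<forall>f. test_function f \<longrightarrow> Lp_norm p (conv s k (apply_op (X * P) f)) \<le> C * Lp_norm p f"
    if k': "test_function k'" and IH: "\<exists>C\<ge>0. \<forall>f. test_function f \<longrightarrow> Lp_norm p (conv s k' (apply_op P f)) \<le> C * Lp_norm p f"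
      and eq: "\<And>f. test_function f \<Longrightarrow> conv s k (apply_op (X * P) f) = (\<lambda>x. of_real (1 / s) * conv s k' (apply_op P f) x)"
    for k k' X P
  proof -
    obtain C where C: "C \<ge> 0" "\<And>f. test_function f \<Longrightarrow> Lp_norm p (conv s k' (apply_op P f)) \<le> C * Lp_norm p f"
      using IH by blast
    have "Lp_norm p (conv s k (apply_op (X * P) f)) \<le> 1 / s * C * Lp_norm p f" if f: "test_function f" for f
    proof -
      have "Lp_norm p (conv s k (apply_op (X * P) f)) \<le> norm (complex_of_real (1 / s)) * Lp_norm p (conv s k' (apply_op P f))"
        unfolding eq[OF f] by (rule Lp_cmult[OF assms(1) conv_Cc[OF test_Cc[OF k'] test_Cc[OF test_apply_op[OF f]]]])
      also have "\<dots> \<le> norm (complex_of_real (1 / s)) * (C * Lp_norm p f)"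
        by (intro mult_left_mono C f norm_ge_zero)
      finally show ?thesis using assms(2) by (simp add: norm_divide)
    qed
    moreover have "1 / s * C \<ge> 0" using assms(2) C(1) by simp
    ultimately show ?thesis by blast
  qed
  from assms(3) show ?thesis
proof (induction P arbitrary: k rule: diff_op_induct)
  case (cst c)
  have "Lp_norm p (conv s k (apply_op (cst c) f)) \<le> norm c * (\<integral>y. norm (k y) \<partial>lborel) * Lp_norm p f"
    if "test_function f" for f
  proof -
    have "Lp_norm p (conv s k (apply_op (cst c) f)) \<le> norm c * Lp_norm p (conv s k f)"
      using Lp_cmult[OF assms(1) conv_Cc[OF cst[THEN test_Cc] that[THEN test_Cc]]] by (simp add: conv_fun_cmult)
    also have "\<dots> \<le> norm c * ((\<integral>y. norm (k y) \<partial>lborel) * Lp_norm p f)"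
      using conv_Lp[OF assms(1) cst[THEN test_Cc] that[THEN test_Cc]] by (intro mult_left_mono) auto
    finally show ?thesis by (simp add: mult.assoc)
  qed
  then show ?case by (intro exI[of _ "norm c * (\<integral>y. norm (k y) \<partial>lborel)"]) auto
next
  case (X1 P)
  show ?case
    by (rule step[OF test_D(1)[OF X1.prems] X1.IH[OF test_D(1)[OF X1.prems]]])
       (use assms(2) in \<open>simp add: conv_D[OF X1.prems test_apply_op] apply_op_mult test_smooth apply_op_X\<close>)
next
  case (X2 P)
  show ?case
    by (rule step[OF test_D(2)[OF X2.prems] X2.IH[OF test_D(2)[OF X2.prems]]])
       (use assms(2) in \<open>simp add: conv_D[OF X2.prems test_apply_op] apply_op_mult test_smooth apply_op_X\<close>)
next
  case (add P Q)
  obtain C where C: "C \<ge> 0" "\<And>f. test_function f \<Longrightarrow> Lp_norm p (conv s k (apply_op P f)) \<le> C * Lp_norm p f"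
    using add.IH(1)[OF add.prems] by blast
  obtain C' where C': "C' \<ge> 0" "\<And>f. test_function f \<Longrightarrow> Lp_norm p (conv s k (apply_op Q f)) \<le> C' * Lp_norm p f"
    using add.IH(2)[OF add.prems] by blast
  have "Lp_norm p (conv s k (apply_op (P + Q) f)) \<le> (C + C') * Lp_norm p f" if f: "test_function f" for f
  proof -
    note t = test_Cc[OF add.prems] test_apply_op[OF f, THEN test_Cc]
    have "Lp_norm p (conv s k (apply_op (P + Q) f)) \<le> Lp_norm p (conv s k (apply_op P f)) + Lp_norm p (conv s k (apply_op Q f))"
      using Lp_triangle[OF assms(1) conv_Cc conv_Cc] t by (simp add: apply_op_add conv_fun_add)
    then show ?thesis using C(2)[OF f] C'(2)[OF f] by (simp add: distrib_right)
  qed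
  then show ?case using C(1) C'(1) by (intro exI[of _ "C + C'"]) auto
qed
qed

text \<open>The \<i> compensates the factor in \<open>D1\<close> and the factorial the power rule,
  so that \<open>ell z\<close> lowers the index without a constant.\<close>

definition monom1 :: "nat \<Rightarrow> real \<times> real \<Rightarrow> complex" where
  "monom1 n = (\<lambda>y. (\<i> * of_real (fst y)) ^ n / fact n)"

lemma smooth_monom1: "smooth (monom1 n)"
proof -
  have "smooth (\<lambda>y. (\<i> * of_real (fst y)) ^ n)"
    by (induction n) (auto intro!: smooth_mult)
  then show ?thesis
    using smooth_mult[OF smooth_const[of "1 / fact n"], of "\<lambda>y. (\<i> * of_real (fst y)) ^ n"] by (simp add: monom1_def)
qed

lemma ell_monom1: "apply_op (ell z) (monom1 (Suc n)) = monom1 n" "apply_op (ell z) (monom1 0) = (\<lambda>y. 0)"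
proof -
  have "grad (\<lambda>y. (\<i> * of_real (fst y)) ^ m) (\<lambda>y. of_nat m * \<i> * (\<i> * of_real (fst y)) ^ (m - 1)) (\<lambda>y. 0)" for m
  proof (induction m)
    case (Suc m)
    have "\<i> * of_real (fst y) * (of_nat m * \<i> * (\<i> * of_real (fst y)) ^ (m - 1)) + \<i> * 1 * (\<i> * of_real (fst y)) ^ m
        = of_nat (Suc m) * \<i> * (\<i> * of_real (fst y)) ^ (Suc m - 1)" for y :: "real \<times> real"
      by (cases m) (simp_all add: algebra_simps)
    with grad_mult[OF grad_cmult[OF grad_fst, of \<i>] Suc] show ?case by simp
  qed (simp add: grad_const)
  from grad_cmult[OF this, of "1 / fact m" m for m]
  have g: "grad (monom1 m) (\<lambda>y. 1 / fact m * (of_nat m * \<i> * (\<i> * of_real (fst y)) ^ (m - 1))) (\<lambda>y. 0)" for m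
    by (simp add: monom1_def)
  have "D1 (monom1 (Suc n)) = monom1 n"
    unfolding grad_D1[OF g] by (simp add: monom1_def fun_eq_iff field_simps del: of_nat_Suc)
  then show "apply_op (ell z) (monom1 (Suc n)) = monom1 n"
    by (simp add: apply_ell smooth_monom1 grad_D2[OF g])
  show "apply_op (ell z) (monom1 0) = (\<lambda>y. 0)"
    using grad_D1[OF g, of 0] grad_D2[OF g, of 0] by (simp add: apply_ell smooth_monom1)
qed

lemma ell_mult:
  assumes "smooth f" "smooth g"
  shows "apply_op (ell z) (\<lambda>y. f y * g y) = (\<lambda>y. apply_op (ell z) f y * g y + f y * apply_op (ell z) g y)"
  using assms by (simp add: apply_ell smooth_mult D_mult algebra_simps)

lemma Lp_sum_bound:
  assumes "p \<ge> 1" "\<And>i. i \<in> I \<Longrightarrow> Cc (f i)"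
  shows "Cc (\<lambda>x. \<Sum>i\<in>I. f i x) \<and> Lp_norm p (\<lambda>x. \<Sum>i\<in>I. f i x) \<le> (\<Sum>i\<in>I. Lp_norm p (f i))"
  using assms(2)
proof (induction I rule: infinite_finite_induct)
  case (insert i I)
  then have "Cc (f i)" "Cc (\<lambda>x. \<Sum>i\<in>I. f i x)" "Lp_norm p (\<lambda>x. \<Sum>i\<in>I. f i x) \<le> (\<Sum>i\<in>I. Lp_norm p (f i))" by auto
  then show ?case using insert.hyps Lp_triangle[OF assms(1), of "f i" "\<lambda>x. \<Sum>i\<in>I. f i x"] Cc_add by auto
qed (use assms(1) test_Cc[OF test_zero] in \<open>auto simp: Lp_zero\<close>)

text \<open>Write \<open>w = D\<^sub>1 + z D\<^sub>2\<close>, \<open>e\<^sub>j = (\<i> x\<^sub>1)\<^sup>j / j!\<close>, so that \<open>w e\<^sub>j = e\<^sub>j\<^sub>-\<^sub>1\<close>, and let \<open>k, u\<close> be the dyadic kernel. The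
  averages \<open>A\<^sub>s G = (\<Sum>j\<le>n. s\<^sup>j (e\<^sub>j u)\<^sub>s * w\<^sup>j G)\<close> tend to \<open>(\<integral>u) G\<close> as \<open>s \<rightarrow> 0\<close>, and passing from \<open>2 s\<close> to \<open>s\<close>
  costs \<open>s\<^sup>n\<^sup>+\<^sup>1 (e\<^sub>n k)\<^sub>s * w\<^sup>n\<^sup>+\<^sup>1 G\<close>, which is \<open>O(s)\<close> for \<open>G = D\<^sub>2\<^sup>n B f\<close>. Summing over dyadic scales replaces
  the singular integral with kernel \<open>D\<^sub>2\<^sup>n (x\<^sub>1\<^sup>n / \<zeta>)\<close>.\<close>

lemma elliptic_power_estimate:
  assumes p: "p \<ge> 1" and z: "z \<notin> \<real>" and e: "e > 0"
  shows "\<exists>C\<ge>0. \<forall>f. test_function f \<longrightarrow>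
    Lp_norm p (apply_op (X2 ^ n * B) f) \<le> e * Lp_norm p (apply_op (ell z ^ Suc n * B) f) + C * Lp_norm p f"
proof -
  obtain k u where k: "test_function k" and u: "test_function u" and cu: "(\<integral>y. u y \<partial>lborel) \<noteq> 0"
    and ku: "\<And>y. D1 k y + z * D2 k y = u y - u ((1/2) *\<^sub>R y) / 4"
    using dyadic_kernel[OF z] by blast
  define c where "c = (\<integral>y. u y \<partial>lborel)"
  define w where "w = ell z"
  define K where "K j = (\<lambda>y. monom1 j y * k y)" for j
  define U where "U j = (\<lambda>y. monom1 j y * u y)" for j
  have tK: "test_function (K j)" and tU: "test_function (U j)" for j
    unfolding K_def U_def by (intro test_mult smooth_monom1 k u)+
  \<comment> \<open>\<open>V j\<close> is \<open>e\<^sub>j\<close> times the right-hand side of the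
    dyadic equation for k. The power of 2 appears because \<open>e\<^sub>j\<close> is homogeneous of
    degree j.\<close>
  define V where "V j = (\<lambda>y. U j y - 2 ^ j * (U j ((1/2) *\<^sub>R y) / 4))" for j
  have CU2: "Cc (\<lambda>y. U j ((1/2) *\<^sub>R y) / 4)" for j
  proof -
    obtain r where "supp_in r (U j)" using test_Cc[OF tU] by (auto simp: Cc_def)
    then have "supp_in (2 * r) (\<lambda>y. U j ((1/2) *\<^sub>R y) / 4)" by (auto simp: supp_in_def)
    moreover have "continuous_on UNIV (\<lambda>y. U j ((1/2) *\<^sub>R y) / 4)"
      by (intro continuous_intros continuous_on_compose2[OF Cc_cont[OF test_Cc[OF tU], of UNIV]]) auto
    ultimately show ?thesis by (auto simp: Cc_def)
  qed
  have CV: "Cc (V j)" for j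
    unfolding V_def using Cc_add[OF test_Cc[OF tU] Cc_cmult[OF CU2, of "- (2 ^ j)" j]] by simp
  have wk: "apply_op w k = (\<lambda>y. u y - u ((1/2) *\<^sub>R y) / 4)"
    using ku by (simp add: w_def apply_ell test_smooth[OF k] fun_eq_iff)
  have eV: "monom1 j y * (u y - u ((1/2) *\<^sub>R y) / 4) = V j y" for j y
  proof -
    have "monom1 j y = 2 ^ j * monom1 j ((1/2) *\<^sub>R y)"
      by (simp add: monom1_def power_mult_distrib power_divide)
    then show ?thesis unfolding V_def U_def by (simp add: algebra_simps)
  qed
  have wK0: "apply_op w (K 0) = V 0"
    using ell_mult[OF smooth_monom1[of 0] test_smooth[OF k], of z] wk eV
    by (simp add: K_def w_def ell_monom1 fun_eq_iff)
  have wKS: "apply_op w (K (Suc j)) = (\<lambda>y. K j y + V (Suc j) y)" for j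
    using ell_mult[OF smooth_monom1[of "Suc j"] test_smooth[OF k], of z] wk eV
    by (simp add: K_def w_def ell_monom1 fun_eq_iff)
  have cV: "conv s (V j) g = (\<lambda>x. conv s (U j) g x - 2 ^ j * conv (2 * s) (U j) g x)" if "test_function g" for s j g
  proof -
    note Cg = test_Cc[OF that] and CUj = test_Cc[OF tU, of j]
    have "conv s (V j) g = (\<lambda>x. conv s (U j) g x - conv s (\<lambda>y. 2 ^ j * (U j ((1/2) *\<^sub>R y) / 4)) g x)"
      unfolding V_def by (rule conv_diff[OF CUj Cc_cmult[OF CU2] Cg])
    then show ?thesis by (simp only: conv_cmult conv_scale[OF CUj Cg])
  qed
  have tw: "test_function (apply_op (w ^ j) g)" if "test_function g" for g j using test_apply_op[OF that] .
  have wS: "apply_op (w ^ Suc j) g = apply_op w (apply_op (w ^ j) g)" if "test_function g" for j g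
    using apply_op_mult[OF test_smooth[OF that], of w "w ^ j"] by simp
  \<comment> \<open>Each integration by parts with w uses one factor s and, by
    \<open>w (e\<^sub>m k) = e\<^sub>m\<^sub>-\<^sub>1 k + V\<^sub>m\<close>, leaves the same
    expression with m - 1 and one term with \<open>V m\<close>.\<close>
  have tele: "of_real s ^ Suc m * conv s (K m) (apply_op (w ^ Suc m) g) x
      = (\<Sum>j\<le>m. of_real s ^ j * conv s (V j) (apply_op (w ^ j) g) x)"
    if g: "test_function g" for g s m x
  proof (induction m)
    case 0
    show ?case using fun_cong[OF conv_ell[OF tK g, of s z 0], of x] wK0 by (simp add: w_def)
  next
    case (Suc m)
    have "of_real s ^ Suc (Suc m) * conv s (K (Suc m)) (apply_op (w ^ Suc (Suc m)) g) x
       = of_real s ^ Suc m * conv s (apply_op w (K (Suc m))) (apply_op (w ^ Suc m) g) x"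
      unfolding wS[OF g, of "Suc m"] using fun_cong[OF conv_ell[OF tK tw[OF g], of s z "Suc m" "Suc m"], of x]
      by (simp add: w_def)
    also have "\<dots> = of_real s ^ Suc m * conv s (K m) (apply_op (w ^ Suc m) g) x + of_real s ^ Suc m * conv s (V (Suc m)) (apply_op (w ^ Suc m) g) x"
      unfolding wKS by (simp only: conv_add[OF test_Cc[OF tK] CV test_Cc[OF tw[OF g]]] distrib_left)
    finally show ?case using Suc.IH by simp
  qed
  define A where "A s g = (\<lambda>x. \<Sum>j\<le>n. of_real s ^ j * conv s (U j) (apply_op (w ^ j) g) x)" for s :: real and g
  \<comment> \<open>By \<open>cV\<close>, convolution with \<open>V j\<close> is the difference of
    those with \<open>U j\<close> at the scales s and 2 s; the factor \<open>2 ^ j\<close> turns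
    \<open>s ^ j\<close> into \<open>(2 * s) ^ j\<close>.\<close>
  have step: "A s g x - A (2 * s) g x = of_real s ^ Suc n * conv s (K n) (apply_op (w ^ Suc n) g) x"
    if g: "test_function g" for s g x
    unfolding tele[OF g] A_def
    by (simp add: cV[OF tw[OF g]] sum_subtractf[symmetric] algebra_simps power_mult_distrib)
  have CA: "Cc (A s g)" if "test_function g" for s g
    unfolding A_def using Lp_sum_bound[OF p, of "{..n}" "\<lambda>j x. of_real s ^ j * conv s (U j) (apply_op (w ^ j) g) x"]
      Cc_cmult[OF conv_Cc[OF test_Cc[OF tU] test_Cc[OF tw[OF that]]]] by blast
  define \<kappa> where "\<kappa> = (\<integral>y. norm (apply_op (X2 ^ n) (K n) y) \<partial>lborel)"
  have \<kappa>: "\<kappa> \<ge> 0" by (simp add: \<kappa>_def)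
  \<comment> \<open>The scales \<open>\<tau> / 2 ^ i\<close> with i \<ge> 1 add up to \<tau>, so the
    total weight of the elliptic term is at most \<open>\<tau> * \<kappa>\<close>. This is at most
    \<open>e * norm c\<close>, and division by \<open>norm c\<close> leaves e.\<close>
  define \<tau> where "\<tau> = e * norm c / (\<kappa> + 1)"
  have \<tau>: "\<tau> > 0" using e cu \<kappa> by (simp add: \<tau>_def c_def)
  \<comment> \<open>The coarsest scale \<tau> is fixed; its contribution is smoothing and is paid
    for by the norm of f alone.\<close>
  have "\<exists>C\<ge>0. \<forall>f. test_function f \<longrightarrow> Lp_norm p (conv \<tau> (U j) (apply_op (w ^ j * (X2 ^ n * B)) f)) \<le> C * Lp_norm p f" for j
    by (rule conv_apply_bound[OF p \<tau> tU])
  then obtain C where C: "\<And>j. C j \<ge> 0"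
    "\<And>j f. test_function f \<Longrightarrow> Lp_norm p (conv \<tau> (U j) (apply_op (w ^ j * (X2 ^ n * B)) f)) \<le> C j * Lp_norm p f"
    by metis
  define C0 where "C0 = (\<Sum>j\<le>n. \<tau> ^ j * C j)"
  have C0: "C0 \<ge> 0" unfolding C0_def using \<tau> C by (intro sum_nonneg) auto
  have main: "norm c * Lp_norm p (apply_op (X2 ^ n * B) f) \<le> \<tau> * \<kappa> * Lp_norm p (apply_op (ell z ^ Suc n * B) f) + C0 * Lp_norm p f"
    if f: "test_function f" for f
  proof -
    define G where "G = apply_op (X2 ^ n * B) f"
    define H where "H = apply_op (w ^ Suc n * B) f"
    have tG: "test_function G" and tH: "test_function H" using test_apply_op[OF f] by (auto simp: G_def H_def)
    \<comment> \<open>The operators commute, so \<open>X2 ^ n\<close> becomes the outermost factor.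
      Moving it onto the kernel absorbs \<open>s ^ n\<close>, and of \<open>s ^ Suc n\<close> one
      power of s survives, which makes the sum over scales converge.\<close>
    have wG: "apply_op (w ^ Suc n) G = apply_op (X2 ^ n) H"
      unfolding G_def H_def apply_op_mult[OF test_smooth[OF f], symmetric] by (simp only: mult_ac)
    have step': "A s G = (\<lambda>x. A (2 * s) G x + of_real s * conv s (apply_op (X2 ^ n) (K n)) H x)" for s
    proof
      fix x
      have "A s G x - A (2 * s) G x = of_real s * (of_real s ^ n * conv s (K n) (apply_op (X2 ^ n) H) x)"
        unfolding step[OF tG] wG by simp
      also have "of_real s ^ n * conv s (K n) (apply_op (X2 ^ n) H) x = conv s (apply_op (X2 ^ n) (K n)) H x"
        by (simp only: conv_X2_power[OF tK tH])
      finally show "A s G x = A (2 * s) G x + of_real s * conv s (apply_op (X2 ^ n) (K n)) H x"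
        by (simp add: algebra_simps)
    qed
    have NA: "Lp_norm p (A \<tau> G) \<le> C0 * Lp_norm p f"
    proof -
      have "Lp_norm p (A \<tau> G) \<le> (\<Sum>j\<le>n. Lp_norm p (\<lambda>x. of_real \<tau> ^ j * conv \<tau> (U j) (apply_op (w ^ j) G) x))"
        unfolding A_def using Lp_sum_bound[OF p, of "{..n}" "\<lambda>j x. of_real \<tau> ^ j * conv \<tau> (U j) (apply_op (w ^ j) G) x"]
          Cc_cmult[OF conv_Cc[OF test_Cc[OF tU] test_Cc[OF tw[OF tG]]]] by blast
      also have "\<dots> \<le> (\<Sum>j\<le>n. \<tau> ^ j * C j * Lp_norm p f)"
      proof (rule sum_mono)
        fix j
        have "Lp_norm p (\<lambda>x. of_real \<tau> ^ j * conv \<tau> (U j) (apply_op (w ^ j) G) x)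
          \<le> norm (complex_of_real \<tau> ^ j) * Lp_norm p (conv \<tau> (U j) (apply_op (w ^ j) G))"
          by (rule Lp_cmult[OF p conv_Cc[OF test_Cc[OF tU] test_Cc[OF tw[OF tG]]]])
        also have "\<dots> \<le> \<tau> ^ j * (C j * Lp_norm p f)"
          using C(2)[OF f, of j] \<tau> unfolding G_def apply_op_mult[OF test_smooth[OF f], of "w ^ j"]
          by (simp add: norm_power mult_left_mono)
        finally show "Lp_norm p (\<lambda>x. of_real \<tau> ^ j * conv \<tau> (U j) (apply_op (w ^ j) G) x) \<le> \<tau> ^ j * C j * Lp_norm p f"
          by (simp add: mult.assoc)
      qed
      finally show ?thesis by (simp add: C0_def sum_distrib_right)
    qed
    have dy: "Lp_norm p (A (\<tau> / 2 ^ i) G) \<le> C0 * Lp_norm p f + \<tau> * \<kappa> * (1 - 1 / 2 ^ i) * Lp_norm p H" for i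
    proof (induction i)
      case 0 then show ?case using NA by simp
    next
      case (Suc i)
      let ?s = "\<tau> / 2 ^ Suc i"
      have CX: "Cc (conv ?s (apply_op (X2 ^ n) (K n)) H)"
        by (intro conv_Cc test_Cc tH test_apply_op tK)
      have ns: "norm (complex_of_real ?s) = ?s"
        unfolding norm_of_real using \<tau> by simp
      have "Lp_norm p (A ?s G) \<le> Lp_norm p (A (2 * ?s) G) + Lp_norm p (\<lambda>x. of_real ?s * conv ?s (apply_op (X2 ^ n) (K n)) H x)"
        by (subst step') (intro Lp_triangle p CA tG Cc_cmult CX)
      also have "Lp_norm p (\<lambda>x. of_real ?s * conv ?s (apply_op (X2 ^ n) (K n)) H x) \<le> ?s * Lp_norm p (conv ?s (apply_op (X2 ^ n) (K n)) H)"
        using Lp_cmult[OF p CX, of "of_real ?s"] by (simp only: ns)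
      also have "\<dots> \<le> ?s * (\<kappa> * Lp_norm p H)"
        unfolding \<kappa>_def using \<tau> by (intro mult_left_mono conv_Lp p test_Cc tH test_apply_op tK) auto
      also have "Lp_norm p (A (2 * ?s) G) \<le> C0 * Lp_norm p f + \<tau> * \<kappa> * (1 - 1 / 2 ^ i) * Lp_norm p H"
        using Suc.IH by simp
      also have "C0 * Lp_norm p f + \<tau> * \<kappa> * (1 - 1 / 2 ^ i) * Lp_norm p H + ?s * (\<kappa> * Lp_norm p H)
        = C0 * Lp_norm p f + \<tau> * \<kappa> * (1 - 1 / 2 ^ Suc i) * Lp_norm p H"
        by (simp add: field_simps)
      finally show ?case by simp
    qed
    have "norm c * Lp_norm p G \<le> (C0 * Lp_norm p f + \<tau> * \<kappa> * Lp_norm p H) + \<epsilon>" if \<epsilon>: "\<epsilon> > 0" for \<epsilon>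
    proof -
      \<comment> \<open>S collects the terms with j \<ge> 1, which carry at least one factor s. It
        depends on f, which is harmless: it only decides how far s must go down for the given
        \<epsilon>.\<close>
      define S where "S = (\<Sum>j\<in>{1..n}. (\<integral>y. norm (U j y) \<partial>lborel) * Lp_norm p (apply_op (w ^ j) G))"
      have S: "S \<ge> 0" unfolding S_def by (intro sum_nonneg mult_nonneg_nonneg Lp_nonneg) auto
      obtain d where d: "d > 0" "\<And>s. 0 < s \<Longrightarrow> s < d \<Longrightarrow> Lp_norm p (\<lambda>x. conv s (U 0) G x - (\<integral>y. U 0 y \<partial>lborel) * G x) \<le> \<epsilon> / 2"
        using conv_limit[OF p test_Cc[OF tU] test_Cc[OF tG], of "\<epsilon> / 2" 0] \<epsilon> by auto
      define d' where "d' = Min {1, d, \<epsilon> / (2 * (S + 1))}"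
      have d': "d' > 0" unfolding d'_def using d(1) \<epsilon> S by (subst Min_gr_iff) auto
      have d'': "d' \<le> 1" "d' \<le> d" "d' \<le> \<epsilon> / (2 * (S + 1))" unfolding d'_def by (rule Min_le; simp)+
      obtain i where i: "(1 / 2) ^ i < d' / \<tau>"
        using real_arch_pow_inv[of "d' / \<tau>" "1/2"] d' \<tau> by auto
      define s where "s = \<tau> / 2 ^ i"
      have s: "0 < s" "s < d'" using i \<tau> by (auto simp: s_def power_one_over field_simps)
      have s1: "s < 1" "s < d" using s d'' by auto
      have ssmall: "s * S \<le> \<epsilon> / 2"
      proof -
        have "s \<le> \<epsilon> / (2 * (S + 1))" using s d'' by linarith
        then have "s * (2 * (S + 1)) \<le> \<epsilon>" using S by (subst (asm) pos_le_divide_eq) auto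
        then show ?thesis using s(1) by (simp add: algebra_simps)
      qed
      let ?R = "\<lambda>j x. of_real s ^ j * conv s (U j) (apply_op (w ^ j) G) x"
      have CR: "Cc (?R j)" for j by (intro Cc_cmult conv_Cc test_Cc tU tw tG)
      have U0: "c = (\<integral>y. U 0 y \<partial>lborel)" by (simp add: c_def U_def monom1_def)
      let ?E = "\<lambda>x. conv s (U 0) G x - (\<integral>y. U 0 y \<partial>lborel) * G x"
      have CE: "Cc ?E"
        using Cc_add[OF conv_Cc[OF test_Cc[OF tU] test_Cc[OF tG]] Cc_cmult[OF test_Cc[OF tG]], of s 0 "- (\<integral>y. U 0 y \<partial>lborel)"] by simp
      have NR: "Lp_norm p (\<lambda>x. \<Sum>j\<in>{1..n}. ?R j x) \<le> s * S" and CRs: "Cc (\<lambda>x. \<Sum>j\<in>{1..n}. ?R j x)"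
      proof -
        show "Cc (\<lambda>x. \<Sum>j\<in>{1..n}. ?R j x)" using Lp_sum_bound[OF p, of "{1..n}" ?R] CR by blast
        have "Lp_norm p (\<lambda>x. \<Sum>j\<in>{1..n}. ?R j x) \<le> (\<Sum>j\<in>{1..n}. Lp_norm p (?R j))"
          using Lp_sum_bound[OF p, of "{1..n}" ?R] CR by blast
        also have "\<dots> \<le> (\<Sum>j\<in>{1..n}. s * ((\<integral>y. norm (U j y) \<partial>lborel) * Lp_norm p (apply_op (w ^ j) G)))"
        proof (rule sum_mono)
          fix j assume j: "j \<in> {1..n}"
          have "Lp_norm p (?R j) \<le> norm (complex_of_real s ^ j) * Lp_norm p (conv s (U j) (apply_op (w ^ j) G))"
            by (rule Lp_cmult[OF p conv_Cc[OF test_Cc[OF tU] test_Cc[OF tw[OF tG]]]])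
          also have "norm (complex_of_real s ^ j) = s ^ j" using s by (simp add: norm_power)
          also have "s ^ j * Lp_norm p (conv s (U j) (apply_op (w ^ j) G)) \<le> s * ((\<integral>y. norm (U j y) \<partial>lborel) * Lp_norm p (apply_op (w ^ j) G))"
          proof (intro mult_mono conv_Lp p test_Cc tU tw tG Lp_nonneg)
            show "s ^ j \<le> s" using power_decreasing[of 1 j s] j s s1 by simp
          qed (use s in auto)
          finally show "Lp_norm p (?R j) \<le> s * ((\<integral>y. norm (U j y) \<partial>lborel) * Lp_norm p (apply_op (w ^ j) G))" .
        qed
        finally show "Lp_norm p (\<lambda>x. \<Sum>j\<in>{1..n}. ?R j x) \<le> s * S" by (simp add: S_def sum_distrib_left)
      qed
      have As: "A s G x = conv s (U 0) G x + (\<Sum>j\<in>{1..n}. ?R j x)" for x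
        unfolding A_def by (subst sum.atLeast1_atMost_eq[symmetric] atMost_atLeast0 sum.atLeast_Suc_atMost)+ auto
      have cG: "(\<lambda>x. c * G x) = (\<lambda>x. A s G x + ((-1) * ?E x + (-1) * (\<Sum>j\<in>{1..n}. ?R j x)))"
        by (simp add: As U0 fun_eq_iff)
      have "Lp_norm p (\<lambda>x. c * G x) \<le> Lp_norm p (A s G) + (Lp_norm p (\<lambda>x. (-1) * ?E x) + Lp_norm p (\<lambda>x. (-1) * (\<Sum>j\<in>{1..n}. ?R j x)))"
        by (subst cG) (intro order_trans[OF Lp_triangle] add_left_mono Lp_triangle p CA tG Cc_cmult CE CRs Cc_add)
      also have "\<dots> \<le> (C0 * Lp_norm p f + \<tau> * \<kappa> * Lp_norm p H) + (\<epsilon> / 2 + \<epsilon> / 2)"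
      proof (intro add_mono)
        have "\<tau> * \<kappa> * (1 - 1 / 2 ^ i) * Lp_norm p H \<le> \<tau> * \<kappa> * 1 * Lp_norm p H"
          using \<tau> \<kappa> by (intro mult_right_mono mult_left_mono Lp_nonneg) auto
        then show "Lp_norm p (A s G) \<le> C0 * Lp_norm p f + \<tau> * \<kappa> * Lp_norm p H"
          using dy[of i] by (simp add: s_def)
        show "Lp_norm p (\<lambda>x. (-1) * ?E x) \<le> \<epsilon> / 2"
          using Lp_cmult[OF p CE, of "-1"] d(2)[OF s(1) s1(2)] by simp
        show "Lp_norm p (\<lambda>x. (-1) * (\<Sum>j\<in>{1..n}. ?R j x)) \<le> \<epsilon> / 2"
          using Lp_cmult[OF p CRs, of "-1"] NR ssmall by simp
      qed
      finally have 1: "Lp_norm p (\<lambda>x. c * G x) \<le> (C0 * Lp_norm p f + \<tau> * \<kappa> * Lp_norm p H) + \<epsilon>" by simp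
      have "G = (\<lambda>x. inverse c * (c * G x))" using cu by (simp add: c_def fun_eq_iff)
      then have "Lp_norm p G \<le> norm (inverse c) * Lp_norm p (\<lambda>x. c * G x)"
        using Lp_cmult[OF p Cc_cmult[OF test_Cc[OF tG], of c], of "inverse c"] by simp
      then have "norm c * Lp_norm p G \<le> norm c * (norm (inverse c) * Lp_norm p (\<lambda>x. c * G x))"
        by (rule mult_left_mono) simp
      also have "\<dots> = Lp_norm p (\<lambda>x. c * G x)"
        using cu unfolding c_def[symmetric] by (simp add: norm_inverse)
      finally have "norm c * Lp_norm p G \<le> Lp_norm p (\<lambda>x. c * G x)" .
      then show ?thesis using 1 by linarith
    qed
    then have "norm c * Lp_norm p G \<le> C0 * Lp_norm p f + \<tau> * \<kappa> * Lp_norm p H" by (rule field_le_epsilon)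
    then show ?thesis by (simp add: G_def H_def w_def)
  qed
  have "Lp_norm p (apply_op (X2 ^ n * B) f) \<le> e * Lp_norm p (apply_op (ell z ^ Suc n * B) f) + C0 / norm c * Lp_norm p f"
    if f: "test_function f" for f
  proof -
    let ?H = "Lp_norm p (apply_op (ell z ^ Suc n * B) f)"
    have cp: "norm c > 0" using cu by (simp add: c_def)
    have "\<tau> * \<kappa> \<le> \<tau> * (\<kappa> + 1)" using \<tau> by simp
    also have "\<dots> = e * norm c" using \<kappa> by (simp add: \<tau>_def)
    finally have "norm c * Lp_norm p (apply_op (X2 ^ n * B) f) \<le> e * norm c * ?H + C0 * Lp_norm p f"
      using main[OF f] mult_right_mono[of "\<tau> * \<kappa>" "e * norm c" ?H] Lp_nonneg by fastforce
    also have "\<dots> = norm c * (e * ?H + C0 / norm c * Lp_norm p f)" using cp by (simp add: field_simps)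
    finally show ?thesis using cp by simp
  qed
  moreover have "C0 / norm c \<ge> 0" using C0 by simp
  ultimately show ?thesis by blast
qed

subsection \<open>Estimates stable under composition\<close>

text \<open>Quantifying over \<open>B\<close> makes the estimates stable under composition: the error of a parametrix is a
  smoothing operator, so \<open>\<parallel>f\<parallel>\<close> dominates it no matter how large the order of \<open>B\<close> is.\<close>

definition bound :: "ennreal \<Rightarrow> real \<Rightarrow> diff_op \<Rightarrow> diff_op \<Rightarrow> bool" where
  "bound p e A P \<longleftrightarrow> (\<forall>B. \<exists>C\<ge>0. \<forall>f. test_function f \<longrightarrow>
    Lp_norm p (apply_op (A * B) f) \<le> e * Lp_norm p (apply_op (P * B) f) + C * Lp_norm p f)"

definition est :: "ennreal \<Rightarrow> diff_op \<Rightarrow> diff_op \<Rightarrow> bool" where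
  "est p A P \<longleftrightarrow> (\<exists>e\<ge>0. bound p e A P)"

definition este :: "ennreal \<Rightarrow> diff_op \<Rightarrow> diff_op \<Rightarrow> bool" where
  "este p A P \<longleftrightarrow> (\<forall>e>0. bound p e A P)"

lemma boundI:
  assumes "\<And>B. C B \<ge> 0" "\<And>B f. test_function f \<Longrightarrow>
    Lp_norm p (apply_op (A * B) f) \<le> e * Lp_norm p (apply_op (P * B) f) + C B * Lp_norm p f"
  shows "bound p e A P"
  unfolding bound_def using assms by blast

lemma boundD:
  assumes "bound p e A P"
  obtains C where "\<And>B. C B \<ge> 0" "\<And>B f. test_function f \<Longrightarrow>
    Lp_norm p (apply_op (A * B) f) \<le> e * Lp_norm p (apply_op (P * B) f) + C B * Lp_norm p f"
  using assms unfolding bound_def by metis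

lemma bound_mono: "bound p e A P \<Longrightarrow> e \<le> e' \<Longrightarrow> bound p e' A P"
  unfolding bound_def by (meson Lp_nonneg add_right_mono mult_right_mono order_trans)

lemma bound_mult: "bound p e A P \<Longrightarrow> bound p e (A * B) (P * B)"
  unfolding bound_def by (simp only: mult.assoc) blast

lemma Lp_apply_add:
  assumes "p \<ge> 1" "test_function f"
  shows "Lp_norm p (apply_op (P + Q) f) \<le> Lp_norm p (apply_op P f) + Lp_norm p (apply_op Q f)"
  unfolding apply_op_add by (intro Lp_triangle assms test_Cc test_apply_op)

lemma Lp_apply_cst:
  assumes "p \<ge> 1" "test_function f"
  shows "Lp_norm p (apply_op (cst c * P) f) \<le> norm c * Lp_norm p (apply_op P f)"
  using Lp_cmult[OF assms(1) test_Cc[OF test_apply_op[OF assms(2), of P]], of c] assms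
  by (simp add: apply_op_mult test_smooth)

lemma bound_add:
  assumes "p \<ge> 1" "bound p e A P" "bound p e' A' P"
  shows "bound p (e + e') (A + A') P"
proof -
  obtain C where C: "\<And>B. C B \<ge> 0" "\<And>B f. test_function f \<Longrightarrow>
    Lp_norm p (apply_op (A * B) f) \<le> e * Lp_norm p (apply_op (P * B) f) + C B * Lp_norm p f"
    by (rule boundD[OF assms(2)]) blast
  obtain C' where C': "\<And>B. C' B \<ge> 0" "\<And>B f. test_function f \<Longrightarrow>
    Lp_norm p (apply_op (A' * B) f) \<le> e' * Lp_norm p (apply_op (P * B) f) + C' B * Lp_norm p f"
    by (rule boundD[OF assms(3)]) blast
  show ?thesis
  proof (rule boundI)
    show "C B + C' B \<ge> 0" for B using C(1) C'(1) by (rule add_nonneg_nonneg)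
    show "Lp_norm p (apply_op ((A + A') * B) f) \<le> (e + e') * Lp_norm p (apply_op (P * B) f) + (C B + C' B) * Lp_norm p f"
      if "test_function f" for B f
      using C(2)[OF that, of B] C'(2)[OF that, of B] Lp_apply_add[OF assms(1) that, of "A * B" "A' * B"]
      unfolding distrib_right by linarith
  qed
qed

lemma bound_cst:
  assumes "p \<ge> 1" "bound p e A P"
  shows "bound p (norm c * e) (cst c * A) P"
proof -
  obtain C where C: "\<And>B. C B \<ge> 0" "\<And>B f. test_function f \<Longrightarrow>
    Lp_norm p (apply_op (A * B) f) \<le> e * Lp_norm p (apply_op (P * B) f) + C B * Lp_norm p f"
    by (rule boundD[OF assms(2)]) blast
  show ?thesis
  proof (rule boundI)
    show "norm c * C B \<ge> 0" for B using C(1) by simp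
    show "Lp_norm p (apply_op (cst c * A * B) f) \<le> norm c * e * Lp_norm p (apply_op (P * B) f) + norm c * C B * Lp_norm p f"
      if f: "test_function f" for B f
      using order_trans[OF Lp_apply_cst[OF assms(1) f, of c "A * B"] mult_left_mono[OF C(2)[OF f, of B] norm_ge_zero]]
      by (simp only: mult.assoc distrib_left)
  qed
qed

lemma bound_trans:
  assumes "bound p e A P" "bound p e' P Q" "e \<ge> 0"
  shows "bound p (e * e') A Q"
proof -
  obtain C where C: "\<And>B. C B \<ge> 0" "\<And>B f. test_function f \<Longrightarrow>
    Lp_norm p (apply_op (A * B) f) \<le> e * Lp_norm p (apply_op (P * B) f) + C B * Lp_norm p f"
    by (rule boundD[OF assms(1)]) blast
  obtain C' where C': "\<And>B. C' B \<ge> 0" "\<And>B f. test_function f \<Longrightarrow>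
    Lp_norm p (apply_op (P * B) f) \<le> e' * Lp_norm p (apply_op (Q * B) f) + C' B * Lp_norm p f"
    by (rule boundD[OF assms(2)]) blast
  show ?thesis
  proof (rule boundI)
    show "e * C' B + C B \<ge> 0" for B using C(1) C'(1) assms(3) by simp
    show "Lp_norm p (apply_op (A * B) f) \<le> e * e' * Lp_norm p (apply_op (Q * B) f) + (e * C' B + C B) * Lp_norm p f"
      if f: "test_function f" for B f
      using C(2)[OF f, of B] mult_left_mono[OF C'(2)[OF f, of B] assms(3)]
      unfolding distrib_left distrib_right mult.assoc by linarith
  qed
qed

lemma estD:
  assumes "est p A P"
  obtains C where "C \<ge> 0" "\<And>f. test_function f \<Longrightarrow>
    Lp_norm p (apply_op (A * B) f) \<le> C * Lp_norm p (apply_op (P * B) f) + C * Lp_norm p f"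
proof -
  obtain e where "e \<ge> 0" "bound p e A P" using assms by (auto simp: est_def)
  then obtain D where D: "D \<ge> 0" "\<And>f. test_function f \<Longrightarrow>
    Lp_norm p (apply_op (A * B) f) \<le> e * Lp_norm p (apply_op (P * B) f) + D * Lp_norm p f"
    unfolding bound_def by meson
  have "Lp_norm p (apply_op (A * B) f) \<le> max e D * Lp_norm p (apply_op (P * B) f) + max e D * Lp_norm p f"
    if "test_function f" for f
    using D(2)[OF that] mult_right_mono[OF max.cobounded1[of e D] Lp_nonneg[of p "apply_op (P * B) f"]]
      mult_right_mono[OF max.cobounded2[of D e] Lp_nonneg[of p f]] by linarith
  then show ?thesis using that[of "max e D"] \<open>e \<ge> 0\<close> by simp
qed

lemma esteD:
  assumes "este p A P" "e > 0"
  obtains C where "C \<ge> 0" "\<And>f. test_function f \<Longrightarrow>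
    Lp_norm p (apply_op (A * B) f) \<le> e * Lp_norm p (apply_op (P * B) f) + C * Lp_norm p f"
  using assms unfolding este_def bound_def by meson

lemma este_imp_est: "este p A P \<Longrightarrow> est p A P"
  unfolding est_def este_def by (intro exI[of _ 1]) simp

lemma est_mult: "est p A P \<Longrightarrow> est p (A * B) (P * B)"
  and este_mult: "este p A P \<Longrightarrow> este p (A * B) (P * B)"
  unfolding est_def este_def using bound_mult by blast+

lemma est_add: "p \<ge> 1 \<Longrightarrow> est p A P \<Longrightarrow> est p A' P \<Longrightarrow> est p (A + A') P"
  unfolding est_def using bound_add add_nonneg_nonneg by blast

lemma est_cst: "p \<ge> 1 \<Longrightarrow> est p A P \<Longrightarrow> est p (cst c * A) P"
  unfolding est_def using bound_cst mult_nonneg_nonneg norm_ge_zero by blast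

lemma est_trans: "est p A P \<Longrightarrow> est p P Q \<Longrightarrow> est p A Q"
  unfolding est_def using bound_trans mult_nonneg_nonneg by blast

lemma este_add:
  assumes "p \<ge> 1" "este p A P" "este p A' P"
  shows "este p (A + A') P"
  unfolding este_def
proof (intro allI impI)
  fix e :: real assume "e > 0"
  then have "bound p (e / 2) A P" "bound p (e / 2) A' P" using assms by (simp_all add: este_def)
  from bound_add[OF assms(1) this] show "bound p e (A + A') P" by simp
qed

lemma este_cst:
  assumes "p \<ge> 1" "este p A P"
  shows "este p (cst c * A) P"
  unfolding este_def
proof (intro allI impI)
  fix e :: real assume e: "e > 0"
  have nc: "norm c + 1 > 0" by (simp add: add_nonneg_pos)
  then have "bound p (e / (norm c + 1)) A P" using e assms by (simp add: este_def)
  from bound_cst[OF assms(1) this, of c] show "bound p e (cst c * A) P"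
    by (rule bound_mono) (use e nc in \<open>simp add: divide_le_eq algebra_simps\<close>)
qed

text \<open>The fixed constant e' of the second estimate is absorbed by using the first one with
  \<open>e / (e' + 1)\<close>.\<close>

lemma est_este_trans:
  assumes "este p A P" "est p P Q"
  shows "este p A Q"
  unfolding este_def
proof (intro allI impI)
  fix e :: real assume e: "e > 0"
  obtain e' where e': "e' \<ge> 0" "bound p e' P Q" using assms by (auto simp: est_def)
  then have "bound p (e / (e' + 1)) A P" using e assms by (simp add: este_def)
  from bound_trans[OF this e'(2)] show "bound p e A Q"
    by (rule bound_mono) (use e e'(1) in \<open>simp_all add: divide_le_eq algebra_simps\<close>)
qed

text \<open>\<open>transport_estimate\<close> applied to \<open>apply_op B f\<close>, without any
  error term. The constant is fixed by the imaginary part of a, so real directions are treated with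
  \<open>est\<close> rather than \<open>este\<close>.\<close>

lemma est_real_factor:
  assumes "p \<ge> 1" "a \<notin> \<real>"
  shows "est p 1 (linear_op v a)"
  unfolding est_def
proof (intro exI conjI)
  show "bound p (2 / \<bar>Im a\<bar>) 1 (linear_op v a)"
    by (rule boundI[of "\<lambda>_. 0"])
       (use transport_estimate[OF assms test_apply_op] in \<open>simp_all add: apply_op_mult test_smooth\<close>)
qed simp

lemma este_ell_power:
  assumes "p \<ge> 1" "z \<notin> \<real>" shows "este p (X2 ^ n) (ell z ^ Suc n)"
  unfolding este_def bound_def using elliptic_power_estimate[OF assms] by blast

lemma este_ell: "p \<ge> 1 \<Longrightarrow> z \<notin> \<real> \<Longrightarrow> este p 1 (ell z)"
  using este_ell_power[of p z 0] by simp

text \<open>With \<open>X1 = w - z X2\<close> for \<open>w = ell z\<close>, each \<open>X1\<close>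
  either uses up one factor w or is traded for \<open>X2\<close>, down to the pure powers of
  \<open>X2\<close>.\<close>

lemma este_same_ell:
  assumes "p \<ge> 1" "z \<notin> \<real>" shows "este p (X1 ^ a * X2 ^ b) (ell z ^ Suc (a + b))"
proof (induction a arbitrary: b)
  case 0 then show ?case using este_ell_power[OF assms] by simp
next
  case (Suc a)
  have eq: "X1 ^ Suc a * X2 ^ b = X1 ^ a * X2 ^ b * ell z + cst (- z) * (X1 ^ a * X2 ^ Suc b)"
    by (simp add: ell_def algebra_simps cst_uminus)
  show ?case unfolding eq using este_mult[OF Suc[of b], of "ell z"] este_cst[OF assms(1) Suc[of "Suc b"]]
    by (intro este_add assms) (simp_all add: mult.commute)
qed

lemma ell_comb: "cst c * ell z + cst d * ell z' = cst (c + d) * X1 + cst (c * z + d * z') * X2"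
  by (simp add: ell_def cst_add cst_mult algebra_simps)

text \<open>Two different factors \<open>w, w'\<close> span the linear forms, so \<open>X\<^sub>j A = (c w + c' w') A\<close>, and the estimate for
  \<open>w A\<close> follows from the one for \<open>A\<close> and the product without \<open>w\<close>.\<close>

lemma este_ell_prod_top:
  assumes p: "p \<ge> 1"
  shows "\<lbrakk>\<forall>z\<in>#M. z \<notin> \<real>; size M = Suc (a + b)\<rbrakk> \<Longrightarrow> este p (X1 ^ a * X2 ^ b) (\<Prod>z\<in>#M. ell z)"
proof (induction "a + b" arbitrary: M a b)
  case 0
  then have "size M = 1" by simp
  then obtain z where "M = {#z#}" using size_1_singleton_mset by blast
  then show ?case using 0 este_ell[OF p] by simp
next
  case (Suc n)
  obtain z where z: "z \<in># M" using Suc.prems by (cases M) auto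
  show ?case
  proof (cases "\<exists>z'\<in>#M. z' \<noteq> z")
    case False
    then have "set_mset M \<subseteq> {z}" by auto
    from set_mset_subset_singletonD[OF this] have "M = replicate_mset (Suc (a + b)) z"
      unfolding Suc.prems(2) .
    then show ?thesis using este_same_ell[OF p, of z a b] Suc.prems(1) z by (simp add: image_replicate_mset)
  next
    case True
    then obtain z' where z': "z' \<in># M" "z' \<noteq> z" by blast
    obtain A where A: "M = add_mset z A" using multi_member_split[OF z] by blast
    then have "z' \<in># A" using z' by simp
    from multi_member_split[OF this] obtain N where "A = add_mset z' N" by blast
    then have M: "M = {#z, z'#} + N" using A by simp
    have real: "z \<notin> \<real>" "z' \<notin> \<real>" "\<forall>z\<in>#N. z \<notin> \<real>" using Suc.prems(1) unfolding M by simp_all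
    have "size M = Suc (Suc n)" using Suc.prems(2) Suc.hyps(2) by simp
    then have sz: "size (add_mset z N) = Suc n" "size (add_mset z' N) = Suc n"
      unfolding M by simp_all
    define P where "P = (\<Prod>z\<in>#M. ell z)"
    have P: "P = (\<Prod>z\<in>#add_mset z' N. ell z) * ell z" "P = (\<Prod>z\<in>#add_mset z N. ell z) * ell z'"
      unfolding P_def M by (simp_all add: mult_ac)
    have IH: "este p (X1 ^ i * X2 ^ j) (\<Prod>z\<in>#K. ell z)" if "i + j = n" "\<forall>z\<in>#K. z \<notin> \<real>" "size K = Suc n" for i j K
      using Suc.hyps(1)[OF that(1)[symmetric] that(2)] that(1,3) by simp
    have low: "este p (X1 ^ i * X2 ^ j * ell z) P" "este p (X1 ^ i * X2 ^ j * ell z') P" if "i + j = n" for i j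
    proof -
      have *: "\<forall>w\<in>#add_mset z' N. w \<notin> \<real>" "\<forall>w\<in>#add_mset z N. w \<notin> \<real>" using real by simp_all
      show "este p (X1 ^ i * X2 ^ j * ell z) P"
        unfolding P(1) by (rule este_mult[OF IH[OF that *(1) sz(2)]])
      show "este p (X1 ^ i * X2 ^ j * ell z') P"
        unfolding P(2) by (rule este_mult[OF IH[OF that *(2) sz(1)]])
    qed
    have comb: "este p (X1 ^ i * X2 ^ j * (cst c * ell z + cst d * ell z')) P" if "i + j = n" for i j c d
    proof -
      have eq: "X1 ^ i * X2 ^ j * (cst c * ell z + cst d * ell z')
        = cst c * (X1 ^ i * X2 ^ j * ell z) + cst d * (X1 ^ i * X2 ^ j * ell z')"
        by (simp add: algebra_simps)
      show ?thesis unfolding eq by (intro este_add este_cst low p that)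
    qed
    have zz: "z - z' \<noteq> 0" using z' by simp
    have "1 / (z - z') + - 1 / (z - z') = 0" "1 / (z - z') * z + - 1 / (z - z') * z' = 1"
      "- z' / (z - z') + z / (z - z') = 1" "- z' / (z - z') * z + z / (z - z') * z' = 0"
      using zz by (simp_all add: divide_simps)
    then have X2: "cst (1 / (z - z')) * ell z + cst (- 1 / (z - z')) * ell z' = X2"
      and X1: "cst (- z' / (z - z')) * ell z + cst (z / (z - z')) * ell z' = X1"
      unfolding ell_comb by (simp_all only: cst_0 cst_1 mult_1 mult_zero_left add_0 add_0_right)
    show ?thesis
    proof (cases a)
      case 0
      then obtain b' where "b = Suc b'" using Suc.hyps(2) by (cases b) auto
      then show ?thesis using comb[of 0 b' "1 / (z - z')" "- 1 / (z - z')"] Suc.hyps(2) 0 X2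
        by (simp add: P_def mult_ac)
    next
      case (Suc a')
      then show ?thesis using comb[of a' b "- z' / (z - z')" "z / (z - z')"] Suc.hyps(2) X1
        by (simp add: P_def mult_ac)
    qed
  qed
qed

text \<open>Surplus factors are dropped one by one with \<open>este_ell\<close> until the number of
  factors is one more than the number of derivatives.\<close>

lemma este_ell_prod_low:
  assumes p: "p \<ge> 1" and "\<forall>z\<in>#M. z \<notin> \<real>" "a + b < size M"
  shows "este p (X1 ^ a * X2 ^ b) (\<Prod>z\<in>#M. ell z)"
  using assms(2,3)
proof (induction M)
  case (add z M)
  show ?case
  proof (cases "a + b < size M")
    case True
    have "este p (X1 ^ a * X2 ^ b) (\<Prod>z\<in>#M. ell z)" using add True by simp
    moreover have "est p (1 * (\<Prod>z\<in>#M. ell z)) (ell z * (\<Prod>z\<in>#M. ell z))"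
      by (intro est_mult este_imp_est este_ell p) (use add.prems in simp)
    ultimately show ?thesis using est_este_trans by simp
  next
    case False
    then show ?thesis using este_ell_prod_top[OF p add.prems(1), of a b] add.prems(2) by simp
  qed
qed simp

lemma linear_op_eq: "linear_op v a = cst (of_real (fst v)) * X1 + cst (of_real (snd v)) * X2 + cst a"
  by (simp add: linear_op_def cst_def X1_def X2_def mult_single zero_prod_def)

text \<open>Cramer's rule for the linear parts; the constants \<gamma> and \<gamma>' are collected
  in e.\<close>

lemma solve_linear_forms:
  assumes "\<alpha> * \<beta>' - \<alpha>' * \<beta> \<noteq> (0::complex)"
    and u_def: "u = cst \<alpha> * X1 + cst \<beta> * X2 + cst \<gamma>" and u'_def: "u' = cst \<alpha>' * X1 + cst \<beta>' * X2 + cst \<gamma>'"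
  shows "\<exists>c d e. X1 = cst c * u + cst d * u' + cst e" "\<exists>c d e. X2 = cst c * u + cst d * u' + cst e"
proof -
  define \<Delta> where "\<Delta> = \<alpha> * \<beta>' - \<alpha>' * \<beta>"
  have comb: "cst c * u + cst d * u' + cst (- (c * \<gamma> + d * \<gamma>')) = cst (c * \<alpha> + d * \<alpha>') * X1 + cst (c * \<beta> + d * \<beta>') * X2" for c d
    by (simp add: u_def u'_def cst_add cst_mult cst_uminus cst_diff algebra_simps)
  have "\<beta>' / \<Delta> * \<alpha> + (- \<beta> / \<Delta>) * \<alpha>' = 1" "\<beta>' / \<Delta> * \<beta> + (- \<beta> / \<Delta>) * \<beta>' = 0"
    "(- \<alpha>' / \<Delta>) * \<alpha> + \<alpha> / \<Delta> * \<alpha>' = 0" "(- \<alpha>' / \<Delta>) * \<beta> + \<alpha> / \<Delta> * \<beta>' = 1"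
    using assms(1) unfolding \<Delta>_def[symmetric] by (simp_all add: divide_simps) (simp_all add: \<Delta>_def algebra_simps)
  then have "cst (\<beta>' / \<Delta>) * u + cst (- \<beta> / \<Delta>) * u' + cst (- (\<beta>' / \<Delta> * \<gamma> + (- \<beta> / \<Delta>) * \<gamma>')) = X1"
    "cst (- \<alpha>' / \<Delta>) * u + cst (\<alpha> / \<Delta>) * u' + cst (- ((- \<alpha>' / \<Delta>) * \<gamma> + \<alpha> / \<Delta> * \<gamma>')) = X2"
    unfolding comb by (simp_all only: cst_0 cst_1 mult_1 mult_zero_left add_0 add_0_right)
  then show "\<exists>c d e. X1 = cst c * u + cst d * u' + cst e" "\<exists>c d e. X2 = cst c * u + cst d * u' + cst e"
    by metis+
qed

lemma not_collinear_det:
  fixes v w :: "real \<times> real"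
  assumes "v \<noteq> 0" "\<not> collinear {0, v, w}"
  shows "fst v * snd w - fst w * snd v \<noteq> 0"
proof
  assume det: "fst v * snd w - fst w * snd v = 0"
  have "\<exists>c. w = c *\<^sub>R v"
  proof (cases "fst v = 0")
    case True
    then have "snd v \<noteq> 0" using assms(1) by (simp add: prod_eq_iff)
    then show ?thesis using det True by (intro exI[of _ "snd w / snd v"]) (simp add: prod_eq_iff)
  next
    case False
    then show ?thesis using det by (intro exI[of _ "fst w / fst v"]) (simp add: prod_eq_iff field_simps)
  qed
  then show False using assms(2) collinear_lemma by blast
qed

definition prod_op :: "complex multiset \<Rightarrow> nat set \<Rightarrow> (nat \<Rightarrow> real \<times> real) \<Rightarrow> (nat \<Rightarrow> complex) \<Rightarrow> diff_op" where
  "prod_op M S v a = (\<Prod>z\<in>#M. ell z) * (\<Prod>k\<in>S. linear_op (v k) (a k))"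

text \<open>The step is the same as for elliptic factors. The constants that now occur in
  \<open>X\<^sub>j = c u + d u' + e\<close> are harmless: \<open>u\<close> is bounded below.\<close>

lemma est_prod_op:
  assumes p: "p \<ge> 1"
  shows "\<lbrakk>finite S; \<forall>z\<in>#M. z \<notin> \<real>; \<forall>k\<in>S. a k \<notin> \<real>; \<forall>k\<in>S. v k \<noteq> 0;
      \<forall>j\<in>S. \<forall>k\<in>S. j \<noteq> k \<longrightarrow> \<not> collinear {0, v j, v k}; size M + card S = Suc (i + j)\<rbrakk>
    \<Longrightarrow> est p (X1 ^ i * X2 ^ j) (prod_op M S v a)"
proof (induction "i + j" arbitrary: M S i j)
  case 0
  show ?case
  proof (cases "S = {}")
    case True
    then show ?thesis using este_imp_est[OF este_ell_prod_top[OF p 0(3), of i j]] 0(7) by (simp add: prod_op_def)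
  next
    case False
    then have "card S > 0" using 0(2) by (simp add: card_gt_0_iff)
    then have "size M = 0" and S1: "card S = 1" using 0(1,7) by linarith+
    then have M: "M = {#}" by simp
    obtain k where "S = {k}" using card_1_singletonE[OF S1] by blast
    then show ?thesis using est_real_factor[OF p, of "a k" "v k"] 0(1,4) M by (simp add: prod_op_def)
  qed
next
  case (Suc n)
  show ?case
  proof (cases "S = {}")
    case True
    then show ?thesis using este_imp_est[OF este_ell_prod_top[OF p Suc.prems(2), of i j]] Suc.prems(6)
      by (simp add: prod_op_def)
  next
    case False
    then obtain k where k: "k \<in> S" by blast
    define u where "u = linear_op (v k) (a k)"
    define P where "P = prod_op M S v a"
    have sizes: "size M + card (S - {k}) = Suc n" using Suc.prems(6) Suc.hyps(2) card_Suc_Diff1[OF Suc.prems(1) k] by linarith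
    have IH1: "est p (X1 ^ i' * X2 ^ j') (prod_op M (S - {k}) v a)" if "i' + j' = n" for i' j'
      using Suc.hyps(1)[OF that[symmetric], of "S - {k}" M] Suc.prems(1-5) sizes that by simp
    have Pu: "P = prod_op M (S - {k}) v a * u"
      unfolding P_def prod_op_def u_def using k Suc.prems(1) by (simp add: prod.remove mult_ac)
    have "est p (1 * prod_op M (S - {k}) v a) (u * prod_op M (S - {k}) v a)"
      unfolding u_def by (intro est_mult est_real_factor p) (use Suc.prems(3) k in blast)
    then have low: "est p (X1 ^ i' * X2 ^ j') P" if "i' + j' = n" for i' j'
      using est_trans[OF IH1[OF that]] by (simp add: Pu mult.commute)
    \<comment> \<open>A second form u' independent of u comes either from an elliptic factor or from
      another real direction. Both cases are brought to the same shape so that the elimination is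
      carried out once.\<close>
    have "\<exists>u'. (\<exists>P'. P = P' * u' \<and> (\<forall>i' j'. i' + j' = n \<longrightarrow> est p (X1 ^ i' * X2 ^ j') P')) \<and>
       (\<exists>\<alpha>' \<beta>' \<gamma>'. u' = cst \<alpha>' * X1 + cst \<beta>' * X2 + cst \<gamma>' \<and> of_real (fst (v k)) * \<beta>' - \<alpha>' * of_real (snd (v k)) \<noteq> 0)"
    proof (cases "S = {k}")
      case True
      then obtain z N where M: "M = add_mset z N" using sizes by (cases M) auto
      have "est p (X1 ^ i' * X2 ^ j') (prod_op N S v a)" if "i' + j' = n" for i' j'
        using Suc.hyps(1)[OF that[symmetric], of S N] Suc.prems sizes that M k by (simp add: card_Diff_singleton True)
      moreover have "P = prod_op N S v a * ell z" by (simp add: P_def prod_op_def M mult_ac)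
      moreover have "ell z = cst 1 * X1 + cst z * X2 + cst 0" by (simp add: ell_def)
      moreover have "of_real (fst (v k)) * z - 1 * of_real (snd (v k)) \<noteq> 0"
      proof
        assume *: "of_real (fst (v k)) * z - 1 * of_real (snd (v k)) = 0"
        have z: "Im z \<noteq> 0" using Suc.prems(2) M complex_is_Real_iff by auto
        from * have "fst (v k) * Im z = 0" "fst (v k) * Re z = snd (v k)" by (simp_all add: complex_eq_iff)
        then have "v k = 0" using z by (simp add: prod_eq_iff)
        then show False using Suc.prems(4) k by blast
      qed
      ultimately show ?thesis by blast
    next
      case False
      then obtain k' where k': "k' \<in> S" "k' \<noteq> k" using k by blast
      have sizes': "size M + card (S - {k'}) = Suc n" using Suc.prems(6) Suc.hyps(2) card_Suc_Diff1[OF Suc.prems(1) k'(1)] by linarith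
      have "est p (X1 ^ i' * X2 ^ j') (prod_op M (S - {k'}) v a)" if "i' + j' = n" for i' j'
        using Suc.hyps(1)[OF that[symmetric], of "S - {k'}" M] Suc.prems(1-5) sizes' that by simp
      moreover have "P = prod_op M (S - {k'}) v a * linear_op (v k') (a k')"
        unfolding P_def prod_op_def using k' Suc.prems(1) by (simp add: prod.remove mult_ac)
      moreover have "fst (v k) * snd (v k') - fst (v k') * snd (v k) \<noteq> 0"
        by (rule not_collinear_det) (use Suc.prems(4,5) k k' in metis)+
      then have "complex_of_real (fst (v k)) * of_real (snd (v k')) - of_real (fst (v k')) * of_real (snd (v k)) \<noteq> 0"
        by (metis of_real_0 of_real_diff of_real_eq_iff of_real_mult)
      ultimately show ?thesis using linear_op_eq by blast
    qed
    then obtain u' P' \<alpha>' \<beta>' \<gamma>' where u': "P = P' * u'" "\<And>i' j'. i' + j' = n \<Longrightarrow> est p (X1 ^ i' * X2 ^ j') P'"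
      "u' = cst \<alpha>' * X1 + cst \<beta>' * X2 + cst \<gamma>'" "of_real (fst (v k)) * \<beta>' - \<alpha>' * of_real (snd (v k)) \<noteq> 0"
      by blast
    have comb: "est p (X1 ^ i' * X2 ^ j' * (cst c * u + cst d * u' + cst e)) P" if "i' + j' = n" for i' j' c d e
    proof -
      have "est p (X1 ^ i' * X2 ^ j' * u) P" unfolding Pu by (intro est_mult IH1 that)
      moreover have "est p (X1 ^ i' * X2 ^ j' * u') P" unfolding u'(1) by (intro est_mult u'(2) that)
      ultimately have "est p (cst c * (X1 ^ i' * X2 ^ j' * u) + cst d * (X1 ^ i' * X2 ^ j' * u') + cst e * (X1 ^ i' * X2 ^ j')) P"
        by (intro est_add est_cst p low that)
      moreover have "cst c * (X1 ^ i' * X2 ^ j' * u) + cst d * (X1 ^ i' * X2 ^ j' * u') + cst e * (X1 ^ i' * X2 ^ j')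
         = X1 ^ i' * X2 ^ j' * (cst c * u + cst d * u' + cst e)"
        by (simp add: algebra_simps)
      ultimately show ?thesis by simp
    qed
    note sol = solve_linear_forms[OF u'(4) u_def[unfolded linear_op_eq] u'(3)]
    show ?thesis
    proof (cases i)
      case 0
      then obtain j' where j': "j = Suc j'" using Suc.hyps(2) by (cases j) auto
      obtain c d e where X2: "X2 = cst c * u + cst d * u' + cst e" using sol(2) by blast
      have "est p (X1 ^ 0 * X2 ^ j' * X2) P"
        using comb[of 0 j' c d e] Suc.hyps(2) j' 0 unfolding X2[symmetric] by simp
      then show ?thesis by (simp add: P_def 0 j' mult.commute)
    next
      case (Suc i')
      obtain c d e where X1: "X1 = cst c * u + cst d * u' + cst e" using sol(1) by blast
      have "est p (X1 ^ i' * X2 ^ j * X1) P"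
        using comb[of i' j c d e] Suc.hyps(2) Suc unfolding X1[symmetric] by simp
      then show ?thesis by (simp add: P_def Suc mult_ac)
    qed
  qed
qed

subsection \<open>Interpolation and sufficiency\<close>

text \<open>With n = l - 1 these are the derivatives of highest order that weak coercivity asks for;
  all lower ones are measured against them.\<close>

definition top_sum :: "ennreal \<Rightarrow> nat \<Rightarrow> (real \<times> real \<Rightarrow> complex) \<Rightarrow> real" where
  "top_sum p n f = (\<Sum>i\<le>n. Lp_norm p (apply_op (X1 ^ i * X2 ^ (n - i)) f))"

lemma top_sum_nonneg: "top_sum p n f \<ge> 0"
  unfolding top_sum_def by (intro sum_nonneg Lp_nonneg)

definition negligible_op :: "ennreal \<Rightarrow> nat \<Rightarrow> diff_op \<Rightarrow> bool" where
  "negligible_op p n A \<longleftrightarrow> (\<forall>e>0. \<exists>C\<ge>0. \<forall>f. test_function f \<longrightarrow>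
    Lp_norm p (apply_op A f) \<le> e * top_sum p n f + C * Lp_norm p f)"

lemma Lp_le_top_sum: "i + j = n \<Longrightarrow> Lp_norm p (apply_op (X1 ^ i * X2 ^ j) f) \<le> top_sum p n f"
  unfolding top_sum_def
  using member_le_sum[of i "{..n}" "\<lambda>i. Lp_norm p (apply_op (X1 ^ i * X2 ^ (n - i)) f)"] Lp_nonneg by auto

text \<open>Interpolation by induction on the number of missing derivatives. The elliptic factor
  \<open>ell \<i>\<close> bounds a monomial, with a small constant, by the two monomials of next
  higher order. For these a crude bound with constant 1 is enough: they are of top order or covered
  by the induction hypothesis.\<close>

lemma negligible_monomial:
  assumes p: "p \<ge> 1"
  shows "i + j < n \<Longrightarrow> negligible_op p n (X1 ^ i * X2 ^ j)"
proof (induction "n - (i + j)" arbitrary: i j)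
  case (Suc d)
  have crude: "\<exists>C\<ge>0. \<forall>f. test_function f \<longrightarrow> Lp_norm p (apply_op (X1 ^ i' * X2 ^ j') f) \<le> 1 * top_sum p n f + C * Lp_norm p f"
    if ij: "i' + j' = Suc (i + j)" for i' j'
  proof (cases "i' + j' = n")
    case True
    show ?thesis by (intro exI[of _ 0]) (use Lp_le_top_sum[OF True] in simp)
  next
    case False
    then have "negligible_op p n (X1 ^ i' * X2 ^ j')" using Suc ij by (intro Suc.hyps(1)) auto
    then show ?thesis unfolding negligible_op_def using zero_less_one by blast
  qed
  obtain C1 where C1: "C1 \<ge> 0" "\<And>f. test_function f \<Longrightarrow> Lp_norm p (apply_op (X1 ^ Suc i * X2 ^ j) f) \<le> 1 * top_sum p n f + C1 * Lp_norm p f"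
    using crude[of "Suc i" j] by auto
  obtain C2 where C2: "C2 \<ge> 0" "\<And>f. test_function f \<Longrightarrow> Lp_norm p (apply_op (X1 ^ i * X2 ^ Suc j) f) \<le> 1 * top_sum p n f + C2 * Lp_norm p f"
    using crude[of i "Suc j"] by auto
  show ?case unfolding negligible_op_def
  proof (intro allI impI)
    fix e :: real assume e: "e > 0"
    have i: "\<i> \<notin> \<real>" by (simp add: complex_is_Real_iff)
    obtain C where C: "C \<ge> 0" "\<And>f. test_function f \<Longrightarrow> Lp_norm p (apply_op (1 * (X1 ^ i * X2 ^ j)) f)
        \<le> e / 2 * Lp_norm p (apply_op (ell \<i> * (X1 ^ i * X2 ^ j)) f) + C * Lp_norm p f"
      by (rule esteD[OF este_ell[OF p i], of "e / 2" "X1 ^ i * X2 ^ j"]) (use e in auto)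
    have "Lp_norm p (apply_op (X1 ^ i * X2 ^ j) f) \<le> e * top_sum p n f + (e / 2 * (C1 + C2) + C) * Lp_norm p f"
      if f: "test_function f" for f
    proof -
      have "ell \<i> * (X1 ^ i * X2 ^ j) = X1 ^ Suc i * X2 ^ j + cst \<i> * (X1 ^ i * X2 ^ Suc j)"
        by (simp add: ell_def algebra_simps)
      then have "Lp_norm p (apply_op (ell \<i> * (X1 ^ i * X2 ^ j)) f)
          \<le> Lp_norm p (apply_op (X1 ^ Suc i * X2 ^ j) f) + Lp_norm p (apply_op (X1 ^ i * X2 ^ Suc j) f)"
        using Lp_apply_add[OF p f, of "X1 ^ Suc i * X2 ^ j" "cst \<i> * (X1 ^ i * X2 ^ Suc j)"]
          Lp_apply_cst[OF p f, of \<i> "X1 ^ i * X2 ^ Suc j"] by simp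
      also have "\<dots> \<le> 2 * top_sum p n f + (C1 + C2) * Lp_norm p f"
        using C1(2)[OF f] C2(2)[OF f] by (simp add: distrib_right)
      finally have "e / 2 * Lp_norm p (apply_op (ell \<i> * (X1 ^ i * X2 ^ j)) f) \<le> e / 2 * (2 * top_sum p n f + (C1 + C2) * Lp_norm p f)"
        using e by (intro mult_left_mono) auto
      also have "\<dots> = e * top_sum p n f + e / 2 * (C1 + C2) * Lp_norm p f"
        by (simp add: distrib_left)
      finally show ?thesis using C(2)[OF f] unfolding distrib_right[of _ C] mult_1 by linarith
    qed
    moreover have "e / 2 * (C1 + C2) + C \<ge> 0" using e C1 C2 C by simp
    ultimately show "\<exists>C\<ge>0. \<forall>f. test_function f \<longrightarrow> Lp_norm p (apply_op (X1 ^ i * X2 ^ j) f) \<le> e * top_sum p n f + C * Lp_norm p f"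
      by blast
  qed
qed simp

lemma negligible_add:
  assumes "p \<ge> 1" "negligible_op p n A" "negligible_op p n B"
  shows "negligible_op p n (A + B)"
  unfolding negligible_op_def
proof (intro allI impI)
  fix e :: real assume "e > 0"
  then have e: "e / 2 > 0" by simp
  obtain C where C: "C \<ge> 0" "\<And>f. test_function f \<Longrightarrow> Lp_norm p (apply_op A f) \<le> e / 2 * top_sum p n f + C * Lp_norm p f"
    using assms(2) e unfolding negligible_op_def by meson
  obtain D where D: "D \<ge> 0" "\<And>f. test_function f \<Longrightarrow> Lp_norm p (apply_op B f) \<le> e / 2 * top_sum p n f + D * Lp_norm p f"
    using assms(3) e unfolding negligible_op_def by meson
  have "Lp_norm p (apply_op (A + B) f) \<le> e * top_sum p n f + (C + D) * Lp_norm p f" if "test_function f" for f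
    using C(2)[OF that] D(2)[OF that] Lp_apply_add[OF assms(1) that, of A B] by (simp add: distrib_right)
  then show "\<exists>C\<ge>0. \<forall>f. test_function f \<longrightarrow> Lp_norm p (apply_op (A + B) f) \<le> e * top_sum p n f + C * Lp_norm p f"
    using C(1) D(1) by (intro exI[of _ "C + D"]) auto
qed

lemma negligible_cst:
  assumes "p \<ge> 1" "negligible_op p n A"
  shows "negligible_op p n (cst c * A)"
  unfolding negligible_op_def
proof (intro allI impI)
  fix e :: real assume e: "e > 0"
  have nc: "norm c + 1 > 0" by (simp add: add_nonneg_pos)
  then have e': "e / (norm c + 1) > 0" using e by simp
  have le: "norm c * (e / (norm c + 1)) \<le> e" using e nc by (simp add: divide_le_eq algebra_simps)
  obtain C where C: "C \<ge> 0" "\<And>f. test_function f \<Longrightarrow> Lp_norm p (apply_op A f) \<le> e / (norm c + 1) * top_sum p n f + C * Lp_norm p f"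
    using assms(2) e' unfolding negligible_op_def by meson
  have "Lp_norm p (apply_op (cst c * A) f) \<le> e * top_sum p n f + (norm c * C) * Lp_norm p f" if f: "test_function f" for f
  proof -
    have "Lp_norm p (apply_op (cst c * A) f) \<le> norm c * (e / (norm c + 1) * top_sum p n f + C * Lp_norm p f)"
      by (rule order_trans[OF Lp_apply_cst[OF assms(1) f] mult_left_mono[OF C(2)[OF f] norm_ge_zero]])
    also have "\<dots> = (norm c * (e / (norm c + 1))) * top_sum p n f + (norm c * C) * Lp_norm p f"
      by (simp only: distrib_left mult.assoc)
    also have "\<dots> \<le> e * top_sum p n f + (norm c * C) * Lp_norm p f"
      by (intro add_right_mono mult_right_mono le top_sum_nonneg)
    finally show ?thesis .
  qed
  then show "\<exists>C\<ge>0. \<forall>f. test_function f \<longrightarrow> Lp_norm p (apply_op (cst c * A) f) \<le> e * top_sum p n f + C * Lp_norm p f"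
    using C(1) by (intro exI[of _ "norm c * C"]) auto
qed

lemma diff_op_sum': "(P :: diff_op) = (\<Sum>\<alpha>\<in>keys P. cst (look P \<alpha>) * (X1 ^ fst \<alpha> * X2 ^ snd \<alpha>))"
  using diff_op_sum[of P] by (simp add: single_eq)

lemma linear_closed_op:
  assumes "Pr 0" "\<And>A B. Pr A \<Longrightarrow> Pr B \<Longrightarrow> Pr (A + B)" "\<And>c A. Pr A \<Longrightarrow> Pr (cst c * A)"
    "\<And>\<alpha>. \<alpha> \<in> keys P \<Longrightarrow> Pr (X1 ^ fst \<alpha> * X2 ^ snd \<alpha>)"
  shows "Pr P"
proof -
  have "Pr (\<Sum>\<alpha>\<in>A. cst (look P \<alpha>) * (X1 ^ fst \<alpha> * X2 ^ snd \<alpha>))" if "A \<subseteq> keys P" for A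
    using finite_subset[OF that finite_keys] that by (induction A) (auto intro: assms)
  then show ?thesis by (subst diff_op_sum') auto
qed

lemma este_zero: "p \<ge> 1 \<Longrightarrow> este p 0 P"
  unfolding este_def bound_def by (auto simp: Lp_zero intro!: exI[of _ 0] mult_nonneg_nonneg Lp_nonneg)

text \<open>Two absorptions of different kind: the lower part R' of R against the elliptic product,
  before the real factors are attached, and Q against the derivatives of order n, after the product
  has been estimated.\<close>

lemma product_coercive:
  fixes S :: "nat set"
  assumes p: "p \<ge> 1" and S: "finite S" and M: "\<forall>z\<in>#M. z \<notin> \<real>" and a: "\<forall>k\<in>S. a k \<notin> \<real>" and v: "\<forall>k\<in>S. v k \<noteq> 0"
    and nc: "\<forall>j\<in>S. \<forall>k\<in>S. j \<noteq> k \<longrightarrow> \<not> collinear {0, v j, v k}" and sz: "size M + card S = Suc n"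
    and c: "c \<noteq> 0" and R: "R = cst c * (\<Prod>z\<in>#M. ell z) + R'" and R': "\<forall>\<alpha>\<in>keys R'. mi_size \<alpha> < size M"
    and Q: "\<forall>\<alpha>\<in>keys Q. mi_size \<alpha> < n"
  shows "weakly_coercive p (Suc n) (R * (\<Prod>k\<in>S. linear_op (v k) (a k)) + Q)"
proof -
  define W where "W = (\<Prod>z\<in>#M. ell z)"
  define \<Lambda> where "\<Lambda> = (\<Prod>k\<in>S. linear_op (v k) (a k))"
  define P where "P = R * \<Lambda> + Q"
  have "este p R' W"
    unfolding W_def
  proof (rule linear_closed_op[of "\<lambda>A. este p A (\<Prod>z\<in>#M. ell z)"])
    show "este p (X1 ^ fst \<alpha> * X2 ^ snd \<alpha>) (\<Prod>z\<in>#M. ell z)" if "\<alpha> \<in> keys R'" for \<alpha>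
      using that R' by (intro este_ell_prod_low p M) (auto simp: mi_size_def)
  qed (auto intro: este_zero este_add este_cst p)
  \<comment> \<open>With half of the leading coefficient, the contribution of R' can be subtracted
    from \<open>norm c\<close> times the norm for W, and half of that remains.\<close>
  have c2: "norm c / 2 > 0" using c by simp
  then have "bound p (norm c / 2) R' W" using \<open>este p R' W\<close> by (simp add: este_def)
  then obtain C where C: "\<And>B. C B \<ge> 0" "\<And>B f. test_function f \<Longrightarrow>
      Lp_norm p (apply_op (R' * B) f) \<le> norm c / 2 * Lp_norm p (apply_op (W * B) f) + C B * Lp_norm p f"
    by (rule boundD) blast
  have "bound p (2 / norm c) W R"
  proof (rule boundI[of "\<lambda>B. 2 / norm c * C B"])
    fix B
    show "2 / norm c * C B \<ge> 0" using C(1) by simp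
    show "Lp_norm p (apply_op (W * B) f) \<le> 2 / norm c * Lp_norm p (apply_op (R * B) f) + 2 / norm c * C B * Lp_norm p f"
      if f: "test_function f" for f
    proof -
      let ?W = "Lp_norm p (apply_op (W * B) f)"
      have "W * B = cst (inverse c) * (R * B + cst (-1) * (R' * B))"
      proof -
        have "R * B + cst (-1) * (R' * B) = cst c * (W * B)"
          unfolding R W_def[symmetric] by (simp add: cst_uminus distrib_right mult.assoc)
        then show ?thesis using c by (simp flip: mult.assoc cst_mult)
      qed
      then have "?W \<le> norm (inverse c) * Lp_norm p (apply_op (R * B + cst (-1) * (R' * B)) f)"
        using Lp_apply_cst[OF p f, of "inverse c"] by metis
      also have "\<dots> \<le> norm (inverse c) * (Lp_norm p (apply_op (R * B) f) + (norm c / 2 * ?W + C B * Lp_norm p f))"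
        using Lp_apply_add[OF p f, of "R * B" "cst (-1) * (R' * B)"] Lp_apply_cst[OF p f, of "-1" "R' * B"] C(2)[OF f, of B]
        by (intro mult_left_mono) auto
      finally have "norm c * ?W \<le> norm c * (norm (inverse c) * (Lp_norm p (apply_op (R * B) f) + (norm c / 2 * ?W + C B * Lp_norm p f)))"
        by (intro mult_left_mono) auto
      also have "\<dots> = Lp_norm p (apply_op (R * B) f) + (norm c / 2 * ?W + C B * Lp_norm p f)"
        using c by (simp add: norm_inverse)
      finally have "norm c / 2 * ?W \<le> Lp_norm p (apply_op (R * B) f) + C B * Lp_norm p f" by simp
      then have "?W \<le> (Lp_norm p (apply_op (R * B) f) + C B * Lp_norm p f) / (norm c / 2)"
        using c2 by (subst pos_le_divide_eq) (auto simp: mult.commute)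
      also have "\<dots> = 2 / norm c * Lp_norm p (apply_op (R * B) f) + 2 / norm c * C B * Lp_norm p f"
        by (simp add: add_divide_distrib mult_ac)
      finally show ?thesis .
    qed
  qed
  then have WR: "est p W R" unfolding est_def using zero_le_divide_iff by (intro exI[of _ "2 / norm c"]) simp
  have top: "est p (X1 ^ i * X2 ^ j) (R * \<Lambda>)" if "i + j = n" for i j
  proof -
    have "est p (X1 ^ i * X2 ^ j) (W * \<Lambda>)"
      using est_prod_op[OF p S M a v nc, of i j] sz that by (simp add: prod_op_def W_def \<Lambda>_def)
    then show ?thesis by (rule est_trans[OF _ est_mult[OF WR]])
  qed
  have "\<exists>C\<ge>0. \<forall>f. test_function f \<longrightarrow> Lp_norm p (apply_op (X1 ^ i * X2 ^ (n - i)) f)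
      \<le> C * Lp_norm p (apply_op (R * \<Lambda>) f) + C * Lp_norm p f" if i: "i \<le> n" for i
  proof -
    obtain C where "C \<ge> 0" "\<And>f. test_function f \<Longrightarrow> Lp_norm p (apply_op ((X1 ^ i * X2 ^ (n - i)) * 1) f)
      \<le> C * Lp_norm p (apply_op ((R * \<Lambda>) * 1) f) + C * Lp_norm p f"
      by (rule estD[OF top[of i "n - i"], of 1]) (use i in auto)
    then show ?thesis by (intro exI[of _ C]) simp
  qed
  then obtain C where C: "\<And>i. i \<le> n \<Longrightarrow> C i \<ge> 0" "\<And>i f. i \<le> n \<Longrightarrow> test_function f \<Longrightarrow>
    Lp_norm p (apply_op (X1 ^ i * X2 ^ (n - i)) f) \<le> C i * Lp_norm p (apply_op (R * \<Lambda>) f) + C i * Lp_norm p f"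
    by metis
  define T where "T = (\<Sum>i\<le>n. C i)"
  have T: "T \<ge> 0" unfolding T_def using C(1) by (intro sum_nonneg) auto
  have ts1: "top_sum p n f \<le> T * Lp_norm p (apply_op (R * \<Lambda>) f) + T * Lp_norm p f" if f: "test_function f" for f
    unfolding top_sum_def T_def sum_distrib_right sum.distrib[symmetric] by (intro sum_mono C(2) f) auto
  have "negligible_op p n Q"
  proof (rule linear_closed_op[of "negligible_op p n"])
    show "negligible_op p n 0"
      unfolding negligible_op_def using p by (auto simp: Lp_zero intro!: exI[of _ 0] mult_nonneg_nonneg top_sum_nonneg)
    show "negligible_op p n (X1 ^ fst \<alpha> * X2 ^ snd \<alpha>)" if "\<alpha> \<in> keys Q" for \<alpha>
      using that Q by (intro negligible_monomial p) (auto simp: mi_size_def)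
  qed (auto intro: negligible_add negligible_cst p)
  \<comment> \<open>With this constant the contribution of Q, once multiplied by T, is at most half
    of \<open>top_sum\<close> and moves to the left-hand side.\<close>
  moreover have "1 / (2 * (T + 1)) > 0" using T by simp
  ultimately obtain D where D: "D \<ge> 0" "\<And>f. test_function f \<Longrightarrow>
      Lp_norm p (apply_op Q f) \<le> 1 / (2 * (T + 1)) * top_sum p n f + D * Lp_norm p f"
    unfolding negligible_op_def by meson
  have ts: "top_sum p n f \<le> 2 * T * Lp_norm p (apply_op P f) + 2 * (T * D + T) * Lp_norm p f" if f: "test_function f" for f
  proof -
    have "R * \<Lambda> = P + cst (-1) * Q" by (simp add: P_def cst_uminus)
    then have "Lp_norm p (apply_op (R * \<Lambda>) f) \<le> Lp_norm p (apply_op P f) + Lp_norm p (apply_op Q f)"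
      using Lp_apply_add[OF p f, of P "cst (-1) * Q"] Lp_apply_cst[OF p f, of "-1" Q] by simp
    then have "T * Lp_norm p (apply_op (R * \<Lambda>) f) \<le> T * (Lp_norm p (apply_op P f) + (1 / (2 * (T + 1)) * top_sum p n f + D * Lp_norm p f))"
      using D(2)[OF f] T by (intro mult_left_mono) auto
    moreover have "T * (1 / (2 * (T + 1))) * top_sum p n f \<le> 1 / 2 * top_sum p n f"
      using T by (intro mult_right_mono top_sum_nonneg) (simp add: field_simps)
    moreover have d: "T * (x + (y * t + D * z)) = T * x + T * y * t + T * D * z"
      "2 * (T * D + T) * z = 2 * (T * D * z) + 2 * (T * z)" "2 * T * x = 2 * (T * x)" for x y t z
      by (simp_all add: distrib_left distrib_right)
    ultimately show ?thesis using ts1[OF f] unfolding d by linarith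
  qed
  have each: "\<exists>C\<ge>0. \<forall>f. test_function f \<longrightarrow> Lp_norm p (D_pow \<alpha> f) \<le> 1 * top_sum p n f + C * Lp_norm p f"
    if "mi_size \<alpha> < Suc n" for \<alpha>
  proof (cases "mi_size \<alpha> = n")
    case True
    then have "fst \<alpha> + snd \<alpha> = n" by (simp add: mi_size_def)
    from Lp_le_top_sum[OF this] show ?thesis by (intro exI[of _ 0]) (simp add: D_pow_eq_apply)
  next
    case False
    then have "negligible_op p n (X1 ^ fst \<alpha> * X2 ^ snd \<alpha>)"
      using that by (intro negligible_monomial p) (simp add: mi_size_def)
    then show ?thesis unfolding negligible_op_def D_pow_eq_apply using zero_less_one by blast
  qed
  define I where "I = {\<alpha>. mi_size \<alpha> < Suc n}"
  obtain E where E: "\<And>\<alpha>. \<alpha> \<in> I \<Longrightarrow> E \<alpha> \<ge> 0" "\<And>\<alpha> f. \<alpha> \<in> I \<Longrightarrow> test_function f \<Longrightarrow> Lp_norm p (D_pow \<alpha> f) \<le> 1 * top_sum p n f + E \<alpha> * Lp_norm p f"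
    using each unfolding I_def mem_Collect_eq by metis
  show ?thesis unfolding weakly_coercive_def P_def[symmetric] \<Lambda>_def[symmetric]
  proof (intro exI allI impI)
    fix f assume f: "test_function f"
    have "(\<Sum>\<alpha>\<in>I. Lp_norm p (D_pow \<alpha> f)) \<le> (\<Sum>\<alpha>\<in>I. 1 * top_sum p n f + E \<alpha> * Lp_norm p f)"
      by (intro sum_mono E f)
    also have "\<dots> = of_nat (card I) * top_sum p n f + (\<Sum>\<alpha>\<in>I. E \<alpha>) * Lp_norm p f"
      by (simp add: sum.distrib sum_distrib_right)
    also have "\<dots> \<le> of_nat (card I) * (2 * T * Lp_norm p (apply_op P f) + 2 * (T * D + T) * Lp_norm p f) + (\<Sum>\<alpha>\<in>I. E \<alpha>) * Lp_norm p f"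
      by (intro add_right_mono mult_left_mono ts f) auto
    also have "\<dots> = (of_nat (card I) * (2 * T)) * Lp_norm p (apply_op P f) + (of_nat (card I) * (2 * (T * D + T)) + (\<Sum>\<alpha>\<in>I. E \<alpha>)) * Lp_norm p f"
      by (simp add: distrib_left distrib_right mult.assoc)
    finally show "(\<Sum>\<alpha> | mi_size \<alpha> < Suc n. Lp_norm p (D_pow \<alpha> f)) \<le> (of_nat (card I) * (2 * T)) * Lp_norm p (apply_op P f) + (of_nat (card I) * (2 * (T * D + T)) + (\<Sum>\<alpha>\<in>I. E \<alpha>)) * Lp_norm p f"
      unfolding I_def .
  qed
qed

subsection \<open>Symbols and forms\<close>

text \<open>The arguments are complex because the linear factors of an elliptic form come from
  non-real zeros; \<open>evr\<close> restricts to real directions.\<close>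

definition ev :: "complex \<Rightarrow> complex \<Rightarrow> diff_op \<Rightarrow> complex" where
  "ev x y P = (\<Sum>\<alpha>\<in>keys P. look P \<alpha> * x ^ fst \<alpha> * y ^ snd \<alpha>)"

lemma ev_superset:
  assumes "finite S" "keys P \<subseteq> S"
  shows "ev x y P = (\<Sum>\<alpha>\<in>S. look P \<alpha> * x ^ fst \<alpha> * y ^ snd \<alpha>)"
  unfolding ev_def by (rule sum.mono_neutral_left) (use assms in \<open>auto simp: in_keys_iff\<close>)

lemma ev_add: "ev x y (P + Q) = ev x y P + ev x y Q"
proof -
  let ?S = "keys P \<union> keys Q"
  have "keys (P + Q) \<subseteq> ?S" by (rule keys_add)
  then show ?thesis by (simp add: ev_superset[of ?S] lookup_add ring_distribs sum.distrib)
qed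

lemma ev_single: "ev x y (Poly_Mapping.single \<alpha> c) = c * x ^ fst \<alpha> * y ^ snd \<alpha>"
  by (simp add: ev_superset[of "{\<alpha>}"])

lemma ev_0 [simp]: "ev x y 0 = 0"
  by (simp add: ev_def)

lemma ev_cst [simp]: "ev x y (cst c) = c"
  and ev_X [simp]: "ev x y X1 = x" "ev x y X2 = y"
  by (simp_all add: cst_def X1_def X2_def ev_single)

lemma ev_mult: "ev x y (P * Q) = ev x y P * ev x y Q"
proof (induction P rule: diff_op_induct_single)
  case (single \<alpha> c)
  show ?case
    by (induction Q rule: diff_op_induct_single)
       (simp_all add: ev_add ring_distribs mult_single ev_single power_add mult_ac)
qed (simp add: ev_add ring_distribs)

lemma ev_1 [simp]: "ev x y 1 = 1"
  using ev_cst[of x y 1] by simp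

lemma ev_prod: "ev x y (\<Prod>k\<in>S. F k) = (\<Prod>k\<in>S. ev x y (F k))"
  by (induction S rule: infinite_finite_induct) (simp_all add: ev_mult)

lemma ev_sum: "ev x y (\<Sum>k\<in>S. F k) = (\<Sum>k\<in>S. ev x y (F k))"
  by (induction S rule: infinite_finite_induct) (simp_all add: ev_add)

lemma ev_minus: "ev x y (P - Q) = ev x y P - ev x y Q"
  using ev_add[of x y "P - Q" Q] by simp

text \<open>\<open>hform k n P\<close>: every monomial has degree \<open>n - k\<close>; \<open>deg_le k n P\<close>: every monomial has degree at most
  \<open>n - k\<close>. In both cases \<open>P = 0\<close> if \<open>n < k\<close>, which truncated subtraction would not give.\<close>

definition hform :: "nat \<Rightarrow> nat \<Rightarrow> diff_op \<Rightarrow> bool" where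
  "hform k n P \<longleftrightarrow> (\<forall>\<alpha>\<in>keys P. mi_size \<alpha> + k = n)"

definition deg_le :: "nat \<Rightarrow> nat \<Rightarrow> diff_op \<Rightarrow> bool" where
  "deg_le k n P \<longleftrightarrow> (\<forall>\<alpha>\<in>keys P. mi_size \<alpha> + k \<le> n)"

lemma mi_size_add: "mi_size (\<alpha> + \<beta>) = mi_size \<alpha> + mi_size \<beta>"
  by (simp add: mi_size_def)

lemma hform_0 [simp]: "hform k n 0" and deg_le_0 [simp]: "deg_le k n 0"
  by (simp_all add: hform_def deg_le_def)

lemma hform_add: "hform k n P \<Longrightarrow> hform k n Q \<Longrightarrow> hform k n (P + Q)"
  using keys_add[of P Q] by (auto simp: hform_def)

lemma deg_le_add: "deg_le k n P \<Longrightarrow> deg_le k n Q \<Longrightarrow> deg_le k n (P + Q)"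
  using keys_add[of P Q] by (auto simp: deg_le_def)

lemma hform_mult: "hform k n P \<Longrightarrow> hform k' n' Q \<Longrightarrow> hform (k + k') (n + n') (P * Q)"
  unfolding hform_def
proof
  fix \<gamma> assume *: "\<forall>\<alpha>\<in>keys P. mi_size \<alpha> + k = n" "\<forall>\<alpha>\<in>keys Q. mi_size \<alpha> + k' = n'" "\<gamma> \<in> keys (P * Q)"
  then obtain \<alpha> \<beta> where "\<alpha> \<in> keys P" "\<beta> \<in> keys Q" "\<gamma> = \<alpha> + \<beta>" using keys_mult[of P Q] by blast
  with * have "mi_size \<gamma> = mi_size \<alpha> + mi_size \<beta>" "mi_size \<alpha> + k = n" "mi_size \<beta> + k' = n'"
    by (auto simp: mi_size_add)
  then show "mi_size \<gamma> + (k + k') = n + n'" by linarith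
qed

lemma deg_le_mult: "deg_le k n P \<Longrightarrow> deg_le k' n' Q \<Longrightarrow> deg_le (k + k') (n + n') (P * Q)"
  unfolding deg_le_def
proof
  fix \<gamma> assume *: "\<forall>\<alpha>\<in>keys P. mi_size \<alpha> + k \<le> n" "\<forall>\<alpha>\<in>keys Q. mi_size \<alpha> + k' \<le> n'" "\<gamma> \<in> keys (P * Q)"
  then obtain \<alpha> \<beta> where "\<alpha> \<in> keys P" "\<beta> \<in> keys Q" "\<gamma> = \<alpha> + \<beta>" using keys_mult[of P Q] by blast
  with * have "mi_size \<gamma> = mi_size \<alpha> + mi_size \<beta>" "mi_size \<alpha> + k \<le> n" "mi_size \<beta> + k' \<le> n'"
    by (auto simp: mi_size_add)
  then show "mi_size \<gamma> + (k + k') \<le> n + n'" by linarith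
qed

lemma keys_uminus: "keys (- P) = keys (P :: diff_op)"
  by (auto simp: in_keys_iff)

lemma deg_le_uminus: "deg_le k n P \<Longrightarrow> deg_le k n (- P)"
  by (simp add: deg_le_def keys_uminus)

lemma deg_le_diff: "deg_le k n P \<Longrightarrow> deg_le k n Q \<Longrightarrow> deg_le k n (P - Q)"
  using deg_le_add[OF _ deg_le_uminus, of k n P Q] by simp

lemma hform_uminus: "hform k n P \<Longrightarrow> hform k n (- P)"
  by (simp add: hform_def keys_uminus)

lemma hform_diff: "hform k n P \<Longrightarrow> hform k n Q \<Longrightarrow> hform k n (P - Q)"
  using hform_add[OF _ hform_uminus, of k n P Q] by simp

lemma deg_le_mono: "deg_le k n P \<Longrightarrow> n + k' \<le> n' + k \<Longrightarrow> deg_le k' n' P"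
  by (fastforce simp: deg_le_def)

lemma hform_shift: "hform k n P \<Longrightarrow> n + k' = n' + k \<Longrightarrow> hform k' n' P"
  by (fastforce simp: hform_def)

lemma hform_deg_le: "hform k n P \<Longrightarrow> deg_le k n P"
  by (auto simp: hform_def deg_le_def)

lemma hform_sum: "(\<And>i. i \<in> I \<Longrightarrow> hform k n (F i)) \<Longrightarrow> hform k n (\<Sum>i\<in>I. F i)"
  by (induction I rule: infinite_finite_induct) (auto intro: hform_add)

lemma deg_le_sum: "(\<And>i. i \<in> I \<Longrightarrow> deg_le k n (F i)) \<Longrightarrow> deg_le k n (\<Sum>i\<in>I. F i)"
  by (induction I rule: infinite_finite_induct) (auto intro: deg_le_add)

lemma hform_cst: "hform 0 0 (cst c)"
  by (simp add: hform_def cst_def mi_size_def)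

lemma hform_X: "hform 0 1 X1" "hform 0 1 X2"
  by (simp_all add: hform_def X1_def X2_def mi_size_def)

lemma hform_cst_mult: "hform k n P \<Longrightarrow> hform k n (cst c * P)"
  using hform_mult[OF hform_cst] by fastforce

lemma hform_linear: "hform 0 1 (linear_op v 0)"
  unfolding linear_op_eq cst_0 add_0_right by (intro hform_add hform_cst_mult hform_X)

lemma hform_prod: "finite S \<Longrightarrow> (\<And>k. k \<in> S \<Longrightarrow> hform 0 1 (F k)) \<Longrightarrow> hform 0 (card S) (\<Prod>k\<in>S. F k)"
proof (induction S rule: finite_induct)
  case empty then show ?case using hform_cst[of 1] by simp
next
  case (insert x S)
  then show ?case using hform_mult[of 0 1 "F x" 0 "card S"] by simp
qed

lemma hform_degree_zero: "hform 0 0 P \<Longrightarrow> \<exists>c. P = cst c"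
proof -
  assume "hform 0 0 P"
  then have "keys P \<subseteq> {0}" by (auto simp: hform_def mi_size_def zero_prod_def)
  then have "P = Poly_Mapping.single 0 (look P 0)"
    by (intro poly_mapping_eqI) (auto simp: lookup_single when_def in_keys_iff)
  then show ?thesis by (auto simp: cst_def)
qed

definition hpart :: "nat \<Rightarrow> diff_op \<Rightarrow> diff_op" where
  "hpart n P = (\<Sum>\<alpha>\<in>{\<alpha>\<in>keys P. mi_size \<alpha> = n}. Poly_Mapping.single \<alpha> (look P \<alpha>))"

lemma look_hpart: "look (hpart n P) \<alpha> = (if mi_size \<alpha> = n then look P \<alpha> else 0)"
  by (auto simp: hpart_def lookup_sum lookup_single when_def in_keys_iff)

lemma keys_hpart: "keys (hpart n P) = {\<alpha>\<in>keys P. mi_size \<alpha> = n}"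
  by (auto simp: in_keys_iff look_hpart split: if_splits)

lemma hform_hpart: "hform 0 n (hpart n P)"
  by (simp add: hform_def keys_hpart)

lemma homogeneous_symbol_eq: "homogeneous_symbol P n \<xi> = ev (of_real (fst \<xi>)) (of_real (snd \<xi>)) (hpart n P)"
  unfolding homogeneous_symbol_def ev_def keys_hpart by (rule sum.cong) (auto simp: look_hpart)

lemma deg_le_minus_hpart: "deg_le k n P \<Longrightarrow> deg_le (Suc k) n (P - hpart (n - k) P)"
  unfolding deg_le_def
proof
  fix \<alpha> assume *: "\<forall>\<alpha>\<in>keys P. mi_size \<alpha> + k \<le> n" "\<alpha> \<in> keys (P - hpart (n - k) P)"
  then have "look P \<alpha> \<noteq> 0" "mi_size \<alpha> \<noteq> n - k"
    by (auto simp: in_keys_iff lookup_minus look_hpart split: if_splits)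
  moreover have "mi_size \<alpha> + k \<le> n" using * calculation(1) by (simp add: in_keys_iff)
  ultimately show "mi_size \<alpha> + Suc k \<le> n" by linarith
qed

lemma order_le_deg: "order_le P n \<longleftrightarrow> deg_le 0 n P"
  by (simp add: order_le_def deg_le_def)

section \<open>Division and factorization of binary forms\<close>

lemma division_monomial:
  assumes "p * a + q * b = (1::complex)"
  defines "W \<equiv> cst b * X1 - cst a * X2" and "V \<equiv> cst p * X1 + cst q * X2"
  shows "\<exists>G. X1 ^ i * X2 ^ j = W * G + cst (a ^ i * b ^ j) * V ^ (i + j) \<and> hform 1 (i + j) G"
proof -
  \<comment> \<open>W vanishes at (a, b) and V takes the value 1 there. Modulo W the generators
    become a V and b V, so a monomial becomes its value at (a, b) times a power of V.\<close>
  have "cst a * V + cst q * W = cst (p * a + q * b) * X1" "cst b * V - cst p * W = cst (p * a + q * b) * X2"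
    by (simp_all add: W_def V_def cst_add cst_mult algebra_simps)
  then have X: "X1 = cst a * V + cst q * W" "X2 = cst b * V - cst p * W"
    using assms(1) by simp_all
  have V: "hform 0 n (V ^ n)" for n
  proof (induction n)
    case 0 then show ?case using hform_cst[of 1] by simp
  next
    case (Suc n)
    have "hform 0 1 V" unfolding V_def by (intro hform_add hform_cst_mult hform_X)
    then show ?case using hform_mult[OF _ Suc, of 0 1 V] by simp
  qed
  have 2: "\<exists>G. X2 ^ j = W * G + cst (b ^ j) * V ^ j \<and> hform 1 j G" for j
  proof (induction j)
    case 0 then show ?case by (intro exI[of _ 0]) simp
  next
    case (Suc j)
    then obtain G where G: "X2 ^ j = W * G + cst (b ^ j) * V ^ j" "hform 1 j G" by blast
    have "X2 ^ Suc j = X2 * (W * G) + (cst b * V - cst p * W) * (cst (b ^ j) * V ^ j)"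
      unfolding power_Suc G(1) distrib_left using X(2) by simp
    also have "\<dots> = W * (X2 * G + cst (- p * b ^ j) * V ^ j) + cst (b ^ Suc j) * V ^ Suc j"
      by (simp add: cst_mult cst_uminus algebra_simps)
    finally have "X2 ^ Suc j = W * (X2 * G + cst (- p * b ^ j) * V ^ j) + cst (b ^ Suc j) * V ^ Suc j" .
    moreover have "hform 1 (Suc j) (X2 * G + cst (- p * b ^ j) * V ^ j)"
      using hform_mult[OF hform_X(2) G(2)] hform_shift[OF V[of j], of 1 "Suc j"]
      by (intro hform_add hform_cst_mult) auto
    ultimately show ?case by blast
  qed
  show ?thesis
  proof (induction i)
    case 0 then show ?case using 2[of j] by simp
  next
    case (Suc i)
    then obtain G where G: "X1 ^ i * X2 ^ j = W * G + cst (a ^ i * b ^ j) * V ^ (i + j)" "hform 1 (i + j) G" by blast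
    have "X1 ^ Suc i * X2 ^ j = X1 * (W * G) + (cst a * V + cst q * W) * (cst (a ^ i * b ^ j) * V ^ (i + j))"
      unfolding power_Suc mult.assoc G(1) distrib_left using X(1) by simp
    also have "\<dots> = W * (X1 * G + cst (q * (a ^ i * b ^ j)) * V ^ (i + j)) + cst (a ^ Suc i * b ^ j) * V ^ (Suc i + j)"
      by (simp add: cst_mult algebra_simps)
    finally have "X1 ^ Suc i * X2 ^ j = W * (X1 * G + cst (q * (a ^ i * b ^ j)) * V ^ (i + j)) + cst (a ^ Suc i * b ^ j) * V ^ (Suc i + j)" .
    moreover have "hform 1 (Suc i + j) (X1 * G + cst (q * (a ^ i * b ^ j)) * V ^ (i + j))"
      using hform_mult[OF hform_X(1) G(2)] hform_shift[OF V[of "i + j"], of 1 "Suc i + j"]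
      by (intro hform_add hform_cst_mult) auto
    ultimately show ?case by blast
  qed
qed

text \<open>All monomials of a form have the same degree, so their remainders modulo W are multiples
  of one power of V and add up to the value of F at (a, b), which is zero.\<close>

lemma form_division:
  assumes "hform k n F" "ev a b F = 0" "a \<noteq> 0 \<or> b \<noteq> 0"
  shows "\<exists>G. F = (cst b * X1 - cst a * X2) * G \<and> hform (Suc k) n G"
proof -
  have "\<exists>p q. p * a + q * b = 1"
  proof (cases "a = 0")
    case True then show ?thesis using assms(3) by (intro exI[of _ 0] exI[of _ "1 / b"]) simp
  next
    case False then show ?thesis by (intro exI[of _ "1 / a"] exI[of _ 0]) simp
  qed
  then obtain p q where pq: "p * a + q * b = 1" by blast
  define W V where "W = cst b * X1 - cst a * X2" and "V = cst p * X1 + cst q * X2"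
  have "\<exists>G. X1 ^ fst \<alpha> * X2 ^ snd \<alpha> = W * G + cst (a ^ fst \<alpha> * b ^ snd \<alpha>) * V ^ mi_size \<alpha> \<and> hform 1 (mi_size \<alpha>) G" for \<alpha>
    unfolding W_def V_def mi_size_def by (rule division_monomial[OF pq])
  then obtain g where g: "\<And>\<alpha>. X1 ^ fst \<alpha> * X2 ^ snd \<alpha> = W * g \<alpha> + cst (a ^ fst \<alpha> * b ^ snd \<alpha>) * V ^ mi_size \<alpha>"
     "\<And>\<alpha>. hform 1 (mi_size \<alpha>) (g \<alpha>)" by metis
  have "F = (\<Sum>\<alpha>\<in>keys F. cst (look F \<alpha>) * (W * g \<alpha> + cst (a ^ fst \<alpha> * b ^ snd \<alpha>) * V ^ mi_size \<alpha>))"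
    unfolding g(1)[symmetric] by (rule diff_op_sum')
  also have "\<dots> = (\<Sum>\<alpha>\<in>keys F. W * (cst (look F \<alpha>) * g \<alpha>) + cst (look F \<alpha> * a ^ fst \<alpha> * b ^ snd \<alpha>) * V ^ (n - k))"
    using assms(1) by (intro sum.cong) (auto simp: hform_def cst_mult algebra_simps)
  also have "\<dots> = W * (\<Sum>\<alpha>\<in>keys F. cst (look F \<alpha>) * g \<alpha>) + (\<Sum>\<alpha>\<in>keys F. cst (look F \<alpha> * a ^ fst \<alpha> * b ^ snd \<alpha>)) * V ^ (n - k)"
    by (simp add: sum.distrib sum_distrib_left sum_distrib_right)
  also have "(\<Sum>\<alpha>\<in>A. cst (h \<alpha>)) = cst (\<Sum>\<alpha>\<in>A. h \<alpha>)" for A and h :: "multi_index \<Rightarrow> complex"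
    by (induction A rule: infinite_finite_induct) (simp_all add: cst_add)
  also have "cst (\<Sum>\<alpha>\<in>keys F. look F \<alpha> * a ^ fst \<alpha> * b ^ snd \<alpha>) = 0"
    using assms(2) by (simp add: ev_def)
  finally have "F = W * (\<Sum>\<alpha>\<in>keys F. cst (look F \<alpha>) * g \<alpha>)" by simp
  moreover have "hform (Suc k) n (\<Sum>\<alpha>\<in>keys F. cst (look F \<alpha>) * g \<alpha>)"
  proof (intro hform_sum hform_cst_mult)
    fix \<alpha> assume "\<alpha> \<in> keys F"
    then have "mi_size \<alpha> + k = n" using assms(1) by (simp add: hform_def)
    then show "hform (Suc k) n (g \<alpha>)" by (intro hform_shift[OF g(2)]) simp
  qed
  ultimately show ?thesis unfolding W_def by blast
qed

definition evr :: "diff_op \<Rightarrow> real \<times> real \<Rightarrow> complex" where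
  "evr P \<xi> = ev (of_real (fst \<xi>)) (of_real (snd \<xi>)) P"

text \<open>The direction in which \<open>v\<^sub>1 D\<^sub>1 + v\<^sub>2 D\<^sub>2\<close> is characteristic.\<close>

definition perp :: "real \<times> real \<Rightarrow> real \<times> real" where
  "perp v = (- snd v, fst v)"

lemma perp_nonzero: "v \<noteq> 0 \<Longrightarrow> perp v \<noteq> 0"
  by (auto simp: perp_def prod_eq_iff)

lemma evr_mult: "evr (P * Q) \<xi> = evr P \<xi> * evr Q \<xi>"
  and evr_prod: "evr (\<Prod>k\<in>S. F k) \<xi> = (\<Prod>k\<in>S. evr (F k) \<xi>)"
  and evr_sum: "evr (\<Sum>k\<in>S. F k) \<xi> = (\<Sum>k\<in>S. evr (F k) \<xi>)"
  and evr_minus: "evr (P - Q) \<xi> = evr P \<xi> - evr Q \<xi>"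
  and evr_cst: "evr (cst c) \<xi> = c"
  by (simp_all add: evr_def ev_mult ev_prod ev_sum ev_minus)

lemma evr_linear: "evr (linear_op v a) \<xi> = of_real (fst v * fst \<xi> + snd v * snd \<xi>) + a"
  by (simp add: evr_def linear_op_eq ev_add ev_mult)

lemma real_form_division:
  assumes "hform k n F" "evr F (perp v) = 0" "v \<noteq> 0"
  shows "\<exists>G. F = linear_op v 0 * G \<and> hform (Suc k) n G"
proof -
  have "linear_op v 0 = cst (of_real (fst v)) * X1 - cst (of_real (- snd v)) * X2"
    by (simp add: linear_op_eq cst_uminus)
  then show ?thesis
    using form_division[OF assms(1), of "of_real (- snd v)" "of_real (fst v)"] assms(2,3)
    by (auto simp: evr_def perp_def prod_eq_iff)
qed

text \<open>The polynomial F(x, 1) has F(1, 0) \<noteq> 0 as its leading coefficient and is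
  therefore not constant. Its root x is not real by ellipticity and splits off the factor
  \<open>ell (- x)\<close>; the quotient is elliptic again.\<close>

lemma elliptic_form_factors:
  assumes "hform 0 n F" "\<And>\<xi>. \<xi> \<noteq> 0 \<Longrightarrow> evr F \<xi> \<noteq> 0"
  shows "\<exists>c M. c \<noteq> 0 \<and> size M = n \<and> (\<forall>z\<in>#M. z \<notin> \<real>) \<and> F = cst c * (\<Prod>z\<in>#M. ell z)"
  using assms
proof (induction n arbitrary: F)
  case 0
  then obtain c where c: "F = cst c" using hform_degree_zero by blast
  have "c \<noteq> 0" using 0(2)[of "(1, 0)"] by (simp add: c evr_cst prod_eq_iff)
  then show ?case using c by (intro exI[of _ c] exI[of _ "{#}"]) simp
next
  case (Suc n)
  define q where "q = (\<Sum>\<alpha>\<in>keys F. monom (look F \<alpha>) (fst \<alpha>))"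
  have q: "poly q x = ev x 1 F" for x
    by (simp add: q_def ev_def poly_sum poly_monom)
  have snd0: "mi_size \<alpha> = Suc n \<Longrightarrow> (fst \<alpha> = Suc n \<longleftrightarrow> snd \<alpha> = 0)" for \<alpha> by (auto simp: mi_size_def)
  have "coeff q (Suc n) = (\<Sum>\<alpha>\<in>keys F. if fst \<alpha> = Suc n then look F \<alpha> else 0)"
    by (simp add: q_def coeff_sum)
  also have "\<dots> = (\<Sum>\<alpha>\<in>keys F. look F \<alpha> * 1 ^ fst \<alpha> * 0 ^ snd \<alpha>)"
    using Suc.prems(1) snd0 by (intro sum.cong) (auto simp: hform_def power_0_left)
  also have "\<dots> = evr F (1, 0)" by (simp add: evr_def ev_def)
  also have "\<dots> \<noteq> 0" using Suc.prems(2)[of "(1, 0)"] by (simp add: prod_eq_iff)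
  finally have "Suc n \<le> degree q" by (rule le_degree)
  then have "degree q \<noteq> 0" by simp
  then obtain x where x: "poly q x = 0"
    using fundamental_theorem_of_algebra constant_degree by metis
  have "x \<notin> \<real>"
  proof
    assume "x \<in> \<real>"
    then obtain r where r: "x = of_real r" by (auto elim: Reals_cases)
    have "evr F (r, 1) \<noteq> 0" by (rule Suc.prems(2)) (simp add: prod_eq_iff)
    then show False using x q r by (simp add: evr_def)
  qed
  then have z: "- x \<notin> \<real>" by (simp add: Reals_minus_iff)
  obtain G where G: "F = (cst 1 * X1 - cst x * X2) * G" "hform 1 (Suc n) G"
    using form_division[OF Suc.prems(1), of x 1] x q by auto
  have F: "F = ell (- x) * G" using G(1) by (simp add: ell_def cst_uminus)
  have "hform 0 n G" by (rule hform_shift[OF G(2)]) simp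
  moreover have "evr G \<xi> \<noteq> 0" if "\<xi> \<noteq> 0" for \<xi>
    using Suc.prems(2)[OF that] by (auto simp: F evr_mult)
  ultimately obtain c M where "c \<noteq> 0" "size M = n" "\<forall>z\<in>#M. z \<notin> \<real>" "G = cst c * (\<Prod>z\<in>#M. ell z)"
    using Suc.IH by blast
  then show ?case using z F by (intro exI[of _ c] exI[of _ "add_mset (- x) M"]) (simp add: mult_ac)
qed

text \<open>Real zeros are split off until none is left. The directions may still be repeated here;
  only coercivity makes them pairwise independent.\<close>

lemma real_linear_factors:
  assumes "hform 0 n F" "F \<noteq> 0"
  shows "\<exists>m v R. m \<le> n \<and> (\<forall>k\<in>{1..m}. v k \<noteq> 0) \<and> hform m n R \<and> (\<forall>\<xi>. \<xi> \<noteq> 0 \<longrightarrow> evr R \<xi> \<noteq> 0) \<and>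
    F = R * (\<Prod>k=1..m. linear_op (v k) 0)"
  using assms
proof (induction n arbitrary: F)
  case 0
  then obtain c where c: "F = cst c" using hform_degree_zero by blast
  then have "c \<noteq> 0" using 0(2) by auto
  then show ?case using c 0 by (intro exI[of _ 0] exI[of _ "\<lambda>_. 0"] exI[of _ F]) (auto simp: evr_cst)
next
  case (Suc n)
  show ?case
  proof (cases "\<forall>\<xi>. \<xi> \<noteq> 0 \<longrightarrow> evr F \<xi> \<noteq> 0")
    case True
    then show ?thesis using Suc.prems by (intro exI[of _ 0] exI[of _ "\<lambda>_. 0"] exI[of _ F]) auto
  next
    case False
    then obtain \<xi> where \<xi>: "\<xi> \<noteq> 0" "evr F \<xi> = 0" by blast
    define w where "w = (snd \<xi>, - fst \<xi>)"
    have w: "w \<noteq> 0" "perp w = \<xi>" using \<xi> by (auto simp: w_def perp_def prod_eq_iff)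
    obtain G where G: "F = linear_op w 0 * G" "hform 1 (Suc n) G"
      using real_form_division[OF Suc.prems(1) _ w(1)] w(2) \<xi>(2) by auto
    have "hform 0 n G" by (rule hform_shift[OF G(2)]) simp
    moreover have "G \<noteq> 0" using Suc.prems(2) G(1) by auto
    ultimately obtain m v R where *: "m \<le> n" "\<forall>k\<in>{1..m}. v k \<noteq> 0" "hform m n R" "\<forall>\<xi>. \<xi> \<noteq> 0 \<longrightarrow> evr R \<xi> \<noteq> 0"
      "G = R * (\<Prod>k=1..m. linear_op (v k) 0)" using Suc.IH by blast
    have "(\<Prod>k=1..m. linear_op ((v(Suc m := w)) k) 0) = (\<Prod>k=1..m. linear_op (v k) 0)"
      by (rule prod.cong) auto
    then have e: "F = R * (\<Prod>k=1..Suc m. linear_op ((v(Suc m := w)) k) 0)"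
      using G(1) *(5) by (simp add: mult_ac)
    have h: "hform (Suc m) (Suc n) R" by (rule hform_shift[OF *(3)]) simp
    have nz: "\<forall>k\<in>{1..Suc m}. (v(Suc m := w)) k \<noteq> 0" using *(2) w(1) by auto
    show ?thesis
      by (intro exI[of _ "Suc m"] exI[of _ "v(Suc m := w)"] exI[of _ R] conjI e h nz *(4)) (use *(1) in simp)
  qed
qed

lemma evr_linear_perp_self: "evr (linear_op v 0) (perp v) = 0"
  by (simp add: evr_linear perp_def)

lemma evr_linear_perp: 
  assumes "v \<noteq> 0" "\<not> collinear {0, v, w}"
  shows "evr (linear_op v 0) (perp w) \<noteq> 0"
proof -
  have "evr (linear_op v 0) (perp w) = of_real (- (fst v * snd w - fst w * snd v))"
    by (simp add: evr_linear perp_def)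
  then show ?thesis using not_collinear_det[OF assms] by (simp del: of_real_minus of_real_diff of_real_mult)
qed

text \<open>The factors already removed do not vanish in the next characteristic direction, so the
  zero of F is inherited by the quotient.\<close>

lemma division_by_product:
  fixes m :: nat
  assumes "hform k n F" "\<forall>j\<in>{1..m}. v j \<noteq> 0" "\<forall>i\<in>{1..m}. \<forall>j\<in>{1..m}. i \<noteq> j \<longrightarrow> \<not> collinear {0, v i, v j}"
    "\<forall>j\<in>{1..m}. evr F (perp (v j)) = 0"
  shows "\<exists>G. F = G * (\<Prod>j=1..m. linear_op (v j) 0) \<and> hform (k + m) n G"
  using assms(2-4)
proof (induction m)
  case 0
  then show ?case using assms(1) by (intro exI[of _ F]) simp
next
  case (Suc m)
  then obtain G where G: "F = G * (\<Prod>j=1..m. linear_op (v j) 0)" "hform (k + m) n G" by fastforce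
  have "evr (linear_op (v j) 0) (perp (v (Suc m))) \<noteq> 0" if "j \<in> {1..m}" for j
    using Suc.prems(1,2) that by (intro evr_linear_perp) auto
  then have "(\<Prod>j=1..m. evr (linear_op (v j) 0) (perp (v (Suc m)))) \<noteq> 0" by simp
  moreover have "evr F (perp (v (Suc m))) = 0" using Suc.prems(3) by simp
  ultimately have "evr G (perp (v (Suc m))) = 0" by (simp add: G(1) evr_mult evr_prod)
  then obtain H where "G = linear_op (v (Suc m)) 0 * H" "hform (Suc (k + m)) n H"
    using real_form_division[OF G(2)] Suc.prems(1) by fastforce
  then show ?case using G(1) by (intro exI[of _ H]) (simp add: mult_ac)
qed

text \<open>Expansion by the number of constants \<open>a k\<close> chosen from the factors: none,
  exactly one, or at least two. The terms of the last kind have degree at most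
  \<open>card S - 2\<close> and form E.\<close>

lemma product_expansion:
  assumes "finite S"
  shows "\<exists>E. (\<Prod>k\<in>S. linear_op (v k) (a k)) = (\<Prod>k\<in>S. linear_op (v k) 0)
    + (\<Sum>k\<in>S. cst (a k) * (\<Prod>j\<in>S - {k}. linear_op (v j) 0)) + E \<and> deg_le 2 (card S) E"
  using assms
proof (induction S rule: finite_induct)
  case empty then show ?case by (intro exI[of _ 0]) simp
next
  case (insert x S)
  let ?L = "\<lambda>k. linear_op (v k) 0"
  define T where "T = (\<Prod>k\<in>S. ?L k)"
  define U where "U = (\<Sum>k\<in>S. cst (a k) * (\<Prod>j\<in>S - {k}. ?L j))"
  obtain E where E: "(\<Prod>k\<in>S. linear_op (v k) (a k)) = T + U + E" "deg_le 2 (card S) E"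
    using insert.IH unfolding T_def U_def by blast
  have lin: "linear_op (v x) (a x) = ?L x + cst (a x)" by (simp add: linear_op_eq)
  have "(\<Sum>k\<in>insert x S. cst (a k) * (\<Prod>j\<in>insert x S - {k}. ?L j)) = cst (a x) * T + (\<Sum>k\<in>S. cst (a k) * (\<Prod>j\<in>insert x S - {k}. ?L j))"
    using insert.hyps by (simp add: T_def)
  also have "(\<Sum>k\<in>S. cst (a k) * (\<Prod>j\<in>insert x S - {k}. ?L j)) = (\<Sum>k\<in>S. ?L x * (cst (a k) * (\<Prod>j\<in>S - {k}. ?L j)))"
  proof (rule sum.cong)
    fix k assume "k \<in> S"
    then have "insert x S - {k} = insert x (S - {k})" using insert.hyps by auto
    then show "cst (a k) * (\<Prod>j\<in>insert x S - {k}. ?L j) = ?L x * (cst (a k) * (\<Prod>j\<in>S - {k}. ?L j))"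
      using insert.hyps by (simp add: mult_ac)
  qed simp
  also have "\<dots> = ?L x * U" by (simp add: U_def sum_distrib_left)
  finally have S': "(\<Sum>k\<in>insert x S. cst (a k) * (\<Prod>j\<in>insert x S - {k}. ?L j)) = cst (a x) * T + ?L x * U" .
  have "(\<Prod>k\<in>insert x S. linear_op (v k) (a k)) = (?L x + cst (a x)) * (T + U + E)"
    using insert.hyps E(1) lin by simp
  also have "\<dots> = ?L x * T + (cst (a x) * T + ?L x * U) + (cst (a x) * U + (?L x * E + cst (a x) * E))"
    by (simp add: algebra_simps)
  finally have "(\<Prod>k\<in>insert x S. linear_op (v k) (a k)) = (\<Prod>k\<in>insert x S. ?L k)
    + (\<Sum>k\<in>insert x S. cst (a k) * (\<Prod>j\<in>insert x S - {k}. ?L j)) + (cst (a x) * U + (?L x * E + cst (a x) * E))"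
    unfolding S' using insert.hyps by (simp add: T_def)
  moreover have "deg_le 2 (card (insert x S)) (cst (a x) * U + (?L x * E + cst (a x) * E))"
  proof (intro deg_le_add)
    have c: "deg_le 1 1 (cst (a x))" using hform_deg_le[OF hform_cst] by (rule deg_le_mono) simp
    have "deg_le 1 (card S) U" unfolding U_def
    proof (intro deg_le_sum)
      fix k assume k: "k \<in> S"
      have "hform 0 (card (S - {k})) (\<Prod>j\<in>S - {k}. ?L j)"
        using insert.hyps by (intro hform_prod hform_linear) auto
      then have "hform 0 (card (S - {k})) (cst (a k) * (\<Prod>j\<in>S - {k}. ?L j))" by (rule hform_cst_mult)
      then show "deg_le 1 (card S) (cst (a k) * (\<Prod>j\<in>S - {k}. ?L j))"
        using card_Suc_Diff1[OF insert.hyps(1) k] by (intro deg_le_mono[OF hform_deg_le]) auto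
    qed
    from deg_le_mult[OF c this] show "deg_le 2 (card (insert x S)) (cst (a x) * U)"
      by (rule deg_le_mono) (use insert.hyps in simp)
    from deg_le_mult[OF hform_deg_le[OF hform_linear] E(2)]
    show "deg_le 2 (card (insert x S)) (?L x * E)" by (rule deg_le_mono) (use insert.hyps in simp)
    from deg_le_mult[OF c E(2)] show "deg_le 2 (card (insert x S)) (cst (a x) * E)"
      by (rule deg_le_mono) (use insert.hyps in simp)
  qed
  ultimately show ?case by blast
qed

subsection \<open>Plane waves\<close>

text \<open>The polynomial \<open>P(\<xi> + s D)\<close> in s, with operators as coefficients. At s
  = 1 / t its coefficients give the expansion of P on a wave of frequency t \<xi>.\<close>

definition shift_op :: "real \<times> real \<Rightarrow> diff_op \<Rightarrow> diff_op poly" where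
  "shift_op \<xi> P = (\<Sum>\<alpha>\<in>keys P. [:cst (look P \<alpha>):] * ([:cst (of_real (fst \<xi>)), X1:] ^ fst \<alpha> * [:cst (of_real (snd \<xi>)), X2:] ^ snd \<alpha>))"

lemma shift_superset:
  assumes "finite S" "keys P \<subseteq> S"
  shows "shift_op \<xi> P = (\<Sum>\<alpha>\<in>S. [:cst (look P \<alpha>):] * ([:cst (of_real (fst \<xi>)), X1:] ^ fst \<alpha> * [:cst (of_real (snd \<xi>)), X2:] ^ snd \<alpha>))"
  unfolding shift_op_def by (rule sum.mono_neutral_left) (use assms in \<open>auto simp: in_keys_iff\<close>)

lemma shift_add: "shift_op \<xi> (P + Q) = shift_op \<xi> P + shift_op \<xi> Q"
proof -
  let ?S = "keys P \<union> keys Q"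
  have "keys (P + Q) \<subseteq> ?S" by (rule keys_add)
  moreover have "[:cst (a + b):] = [:cst a:] + [:cst b:]" for a b by (simp add: cst_add)
  ultimately show ?thesis by (simp only: shift_superset[of ?S] lookup_add distrib_right sum.distrib finite_UnI finite_keys Un_upper1 Un_upper2)
qed

lemma shift_single: "shift_op \<xi> (Poly_Mapping.single \<alpha> c)
    = [:cst c:] * ([:cst (of_real (fst \<xi>)), X1:] ^ fst \<alpha> * [:cst (of_real (snd \<xi>)), X2:] ^ snd \<alpha>)"
  by (subst shift_superset[of "{\<alpha>}"]) auto

lemma shift_cst: "shift_op \<xi> (cst c) = [:cst c:]"
  and shift_X: "shift_op \<xi> X1 = [:cst (of_real (fst \<xi>)), X1:]" "shift_op \<xi> X2 = [:cst (of_real (snd \<xi>)), X2:]"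
  by (simp_all only: cst_def[of c] X1_def X2_def shift_single) (simp_all flip: cst_def X1_def X2_def add: one_pCons)

lemma shift_mult: "shift_op \<xi> (P * Q) = shift_op \<xi> P * shift_op \<xi> Q"
proof (induction P rule: diff_op_induct_single)
  case (single \<alpha> c)
  show ?case
  proof (induction Q rule: diff_op_induct_single)
    case (single \<beta> d)
    have "[:cst (c * d):] = [:cst c:] * [:cst d:]" by (simp add: cst_mult)
    then show ?case
      unfolding mult_single shift_single fst_add snd_add power_add by (simp only: mult_ac)
  qed (simp add: shift_add ring_distribs)
qed (simp add: shift_add ring_distribs)

lemma shift_coeff_0: "coeff (shift_op \<xi> P) 0 = cst (evr P \<xi>)"
  by (induction P rule: diff_op_induct)
     (simp_all add: shift_mult shift_add shift_X shift_cst evr_def ev_mult ev_add cst_mult cst_add coeff_mult)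

lemma shift_coeff_linear:
  "coeff (shift_op \<xi> (linear_op v 0)) 1 = linear_op v 0"
  by (simp add: linear_op_eq shift_add shift_mult shift_X shift_cst)

text \<open>The product rule at a zero of L: the term in which L is evaluated at \<xi> drops out,
  and L is the factor that acts as an operator.\<close>

lemma shift_coeff_1:
  assumes "evr (linear_op v 0) \<xi> = 0"
  shows "coeff (shift_op \<xi> (linear_op v 0 * G)) 1 = cst (evr G \<xi>) * linear_op v 0"
proof -
  have "coeff (p * q) 1 = coeff p 0 * coeff q 1 + coeff p 1 * coeff q 0" for p q :: "diff_op poly"
    by (simp add: coeff_mult)
  then show ?thesis unfolding shift_mult by (simp add: shift_coeff_0 shift_coeff_linear[simplified] assms mult.commute)
qed

lemma poly_shift_expansion:
  fixes p :: "diff_op poly"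
  shows "\<exists>q. \<forall>x. poly p x = coeff p 0 + x * poly q x"
    "\<exists>q. \<forall>x. poly p x = coeff p 0 + x * (coeff p 1 + x * poly q x)"
proof -
  obtain a q where q: "p = pCons a q" by (cases p)
  obtain b r where r: "q = pCons b r" by (cases q)
  show "\<exists>q. \<forall>x. poly p x = coeff p 0 + x * poly q x" using q by (intro exI[of _ q]) simp
  show "\<exists>q. \<forall>x. poly p x = coeff p 0 + x * (coeff p 1 + x * poly q x)" using q r by (intro exI[of _ r]) simp
qed

lemma test_bounded: "test_function f \<Longrightarrow> \<exists>M\<ge>0. \<forall>x. norm (f x) \<le> M"
  by (rule Cc_bounded[OF test_Cc])

text \<open>Uniformity over s between 0 and 1 is uniformity over t \<ge> 1; this is what makes the
  remainders of the wave expansions uniform.\<close>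

lemma poly_apply_bounded:
  assumes "test_function f"
  shows "\<exists>C\<ge>0. \<forall>s\<in>{0..1}. \<forall>x. norm (apply_op (poly q (cst (of_real s))) f x) \<le> C"
proof (induction q)
  case 0 then show ?case by (intro exI[of _ 0]) simp
next
  case (pCons a q)
  obtain C where C: "C \<ge> 0" "\<And>s x. s \<in> {0..1} \<Longrightarrow> norm (apply_op (poly q (cst (of_real s))) f x) \<le> C" using pCons by blast
  obtain M where M: "M \<ge> 0" "\<And>x. norm (apply_op a f x) \<le> M" using test_bounded[OF test_apply_op[OF assms]] by blast
  have "norm (apply_op (poly (pCons a q) (cst (of_real s))) f x) \<le> M + C" if "s \<in> {0..1}" for s x
  proof -
    have "apply_op (poly (pCons a q) (cst (of_real s))) f x = apply_op a f x + of_real s * apply_op (poly q (cst (of_real s))) f x"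
      using assms by (simp add: apply_op_add apply_op_mult test_smooth)
    also have "norm \<dots> \<le> M + 1 * C"
    proof (intro order_trans[OF norm_triangle_ineq] add_mono M)
      show "norm (of_real s * apply_op (poly q (cst (of_real s))) f x) \<le> 1 * C"
        unfolding norm_mult using that by (intro mult_mono C) auto
    qed
    finally show ?thesis by simp
  qed
  then show ?case using C(1) M(1) by (intro exI[of _ "M + C"]) auto
qed

definition wave :: "real \<Rightarrow> real \<times> real \<Rightarrow> real \<times> real \<Rightarrow> complex" where
  "wave t \<xi> = (\<lambda>x. exp (\<i> * of_real t * (of_real (fst \<xi>) * of_real (fst x) + of_real (snd \<xi>) * of_real (snd x))))"

lemma norm_wave [simp]: "norm (wave t \<xi> x) = 1"
  by (simp add: wave_def norm_exp_eq_Re)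

lemma wave_0 [simp]: "wave t \<xi> 0 = 1"
  by (simp add: wave_def)

lemma wave_grad: "grad (wave t \<xi>) (\<lambda>x. wave t \<xi> x * (\<i> * of_real t * of_real (fst \<xi>))) (\<lambda>x. wave t \<xi> x * (\<i> * of_real t * of_real (snd \<xi>)))"
proof -
  have "grad (\<lambda>x. \<i> * of_real t * (of_real (fst \<xi>) * of_real (fst x) + of_real (snd \<xi>) * of_real (snd x)))
     (\<lambda>x. \<i> * of_real t * (of_real (fst \<xi>) * 1 + of_real (snd \<xi>) * 0)) (\<lambda>x. \<i> * of_real t * (of_real (fst \<xi>) * 0 + of_real (snd \<xi>) * 1))"
    by (intro grad_cmult grad_add grad_fst grad_snd)
  from grad_exp[OF this] show ?thesis by (simp add: wave_def)
qed

lemma smooth_wave: "smooth (wave t \<xi>)"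
  unfolding wave_def by (intro smooth_exp smooth_mult smooth_add smooth_const smooth_fst smooth_snd)

lemma D_wave: "D1 (wave t \<xi>) = (\<lambda>x. of_real t * of_real (fst \<xi>) * wave t \<xi> x)"
  "D2 (wave t \<xi>) = (\<lambda>x. of_real t * of_real (snd \<xi>) * wave t \<xi> x)"
  by (simp_all add: grad_D1[OF wave_grad] grad_D2[OF wave_grad] fun_eq_iff mult_ac)

text \<open>Pulling the wave through one derivative replaces \<open>D\<^sub>j\<close> by \<open>t
  \<xi>\<^sub>j + D\<^sub>j = t (\<xi>\<^sub>j + D\<^sub>j / t)\<close>; homogeneity collects the
  powers of t in front.\<close>

lemma wave_conjugation:
  assumes t: "t > 0" and f: "test_function f" and F: "hform 0 n F"
  shows "apply_op F (\<lambda>x. wave t \<xi> x * f x)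
    = (\<lambda>x. wave t \<xi> x * (of_real t ^ n * apply_op (poly (shift_op \<xi> F) (cst (of_real (1 / t)))) f x))"
proof -
  let ?s = "cst (of_real (1 / t))"
  define Pr where "Pr n F \<longleftrightarrow> apply_op F (\<lambda>x. wave t \<xi> x * f x)
    = (\<lambda>x. wave t \<xi> x * (of_real t ^ n * apply_op (poly (shift_op \<xi> F) ?s) f x))" for n F
  have sf: "smooth f" and sw: "smooth (\<lambda>x. wave t \<xi> x * f x)" using f by (simp_all add: test_smooth smooth_mult smooth_wave)
  have X: "Pr (Suc n) (X1 * A)" "Pr (Suc n) (X2 * A)" if A: "Pr n A" for n A
  proof -
    define g where "g = apply_op (poly (shift_op \<xi> A) ?s) f"
    have sg: "smooth g" unfolding g_def by (intro smooth_apply_op sf)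
    have eq: "apply_op A (\<lambda>x. wave t \<xi> x * f x) = (\<lambda>x. of_real t ^ n * (wave t \<xi> x * g x))"
      using A by (simp add: Pr_def g_def mult.left_commute)
    have D: "D1 (\<lambda>x. of_real t ^ n * (wave t \<xi> x * g x)) = (\<lambda>x. of_real t ^ n * (wave t \<xi> x * D1 g x + of_real t * of_real (fst \<xi>) * wave t \<xi> x * g x))"
      "D2 (\<lambda>x. of_real t ^ n * (wave t \<xi> x * g x)) = (\<lambda>x. of_real t ^ n * (wave t \<xi> x * D2 g x + of_real t * of_real (snd \<xi>) * wave t \<xi> x * g x))"
      by (simp_all add: D_cmult D_mult D_wave sg smooth_mult smooth_wave)
    have e: "apply_op (poly (shift_op \<xi> (X1 * A)) ?s) f = (\<lambda>x. of_real (fst \<xi>) * g x + of_real (1 / t) * D1 g x)"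
      "apply_op (poly (shift_op \<xi> (X2 * A)) ?s) f = (\<lambda>x. of_real (snd \<xi>) * g x + of_real (1 / t) * D2 g x)"
      by (simp_all add: shift_mult shift_X apply_op_mult apply_op_add apply_op_X sf smooth_apply_op distrib_right g_def[symmetric] del: of_real_divide)
    show "Pr (Suc n) (X1 * A)" "Pr (Suc n) (X2 * A)"
      unfolding Pr_def apply_op_mult[OF sw] eq apply_op_X D e using t by (simp_all add: fun_eq_iff field_simps)
  qed
  have "Pr 0 1" by (simp add: Pr_def shift_cst[of \<xi> 1, simplified])
  then have "Pr j (X2 ^ j)" for j by (induction j) (auto intro: X)
  then have mon: "Pr (i + j) (X1 ^ i * X2 ^ j)" for i j
    by (induction i) (auto intro: X simp: mult.assoc)
  have "Pr n F"
  proof (rule linear_closed_op[of "Pr n"])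
    show "Pr n 0" by (simp add: Pr_def shift_cst[of \<xi> 0, simplified])
    show "Pr n (A + B)" if "Pr n A" "Pr n B" for A B
      using that by (simp add: Pr_def apply_op_add shift_add distrib_left)
    show "Pr n (cst c * A)" if "Pr n A" for c A
      using that unfolding Pr_def apply_op_mult[OF sw] apply_op_cst shift_mult shift_cst poly_mult apply_op_mult[OF sf]
      by (simp add: mult.left_commute apply_op_mult[OF sf])
    show "Pr n (X1 ^ fst \<alpha> * X2 ^ snd \<alpha>)" if "\<alpha> \<in> keys F" for \<alpha>
      using F that mon[of "fst \<alpha>" "snd \<alpha>"] by (auto simp: hform_def mi_size_def)
  qed
  then show ?thesis by (simp add: Pr_def)
qed

lemma wave_form_asymptotics:
  assumes f: "test_function f" and F: "hform 0 n F"
  shows "\<exists>C\<ge>0. \<forall>t\<ge>1. \<forall>x. norm (apply_op F (\<lambda>x. wave t \<xi> x * f x) x - wave t \<xi> x * (of_real t ^ n * (evr F \<xi> * f x))) \<le> C * t ^ n / t"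
proof -
  obtain q where q: "\<And>x. poly (shift_op \<xi> F) x = cst (evr F \<xi>) + x * poly q x"
    using poly_shift_expansion(1)[of "shift_op \<xi> F"] shift_coeff_0 by metis
  obtain C where C: "C \<ge> 0" "\<And>s x. s \<in> {0..1} \<Longrightarrow> norm (apply_op (poly q (cst (of_real s))) f x) \<le> C"
    using poly_apply_bounded[OF f] by blast
  have "norm (apply_op F (\<lambda>x. wave t \<xi> x * f x) x - wave t \<xi> x * (of_real t ^ n * (evr F \<xi> * f x))) \<le> C * t ^ n / t" if t: "t \<ge> 1" for t x
  proof -
    have t0: "t > 0" using t by simp
    have "apply_op F (\<lambda>x. wave t \<xi> x * f x) x - wave t \<xi> x * (of_real t ^ n * (evr F \<xi> * f x))
      = wave t \<xi> x * (of_real t ^ n * (of_real (1 / t) * apply_op (poly q (cst (of_real (1 / t)))) f x))"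
      unfolding wave_conjugation[OF t0 f F] q using f
      by (simp add: apply_op_add apply_op_mult test_smooth distrib_left del: of_real_divide)
    also have "norm \<dots> = t ^ n * (1 / t * norm (apply_op (poly q (cst (of_real (1 / t)))) f x))"
      using t by (simp add: norm_mult norm_power norm_divide)
    also have "\<dots> \<le> t ^ n * (1 / t * C)"
      using t by (intro mult_left_mono C) auto
    finally show ?thesis by (simp add: mult_ac)
  qed
  then show ?thesis using C(1) by blast
qed

lemma wave_low_order:
  assumes f: "test_function f" and P: "deg_le k l P" and "k \<le> l"
  shows "\<exists>C\<ge>0. \<forall>t\<ge>1. \<forall>x. norm (apply_op P (\<lambda>x. wave t \<xi> x * f x) x) \<le> C * t ^ (l - k)"
proof (rule linear_closed_op[of "\<lambda>P. \<exists>C\<ge>0. \<forall>t\<ge>1. \<forall>x. norm (apply_op P (\<lambda>x. wave t \<xi> x * f x) x) \<le> C * t ^ (l - k)"])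
  have sw: "smooth (\<lambda>x. wave t \<xi> x * f x)" for t using f by (simp add: test_smooth smooth_mult smooth_wave)
  show "\<exists>C\<ge>0. \<forall>t\<ge>1. \<forall>x. norm (apply_op 0 (\<lambda>x. wave t \<xi> x * f x) x) \<le> C * t ^ (l - k)"
    by (intro exI[of _ 0]) simp
  show "\<exists>C\<ge>0. \<forall>t\<ge>1. \<forall>x. norm (apply_op (A + B) (\<lambda>x. wave t \<xi> x * f x) x) \<le> C * t ^ (l - k)"
    if AB: "\<exists>C\<ge>0. \<forall>t\<ge>1. \<forall>x. norm (apply_op A (\<lambda>x. wave t \<xi> x * f x) x) \<le> C * t ^ (l - k)"
      "\<exists>C\<ge>0. \<forall>t\<ge>1. \<forall>x. norm (apply_op B (\<lambda>x. wave t \<xi> x * f x) x) \<le> C * t ^ (l - k)" for A B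
  proof -
    obtain C where C: "C \<ge> 0" "\<And>t x. t \<ge> 1 \<Longrightarrow> norm (apply_op A (\<lambda>x. wave t \<xi> x * f x) x) \<le> C * t ^ (l - k)" using AB(1) by blast
    obtain D where D: "D \<ge> 0" "\<And>t x. t \<ge> 1 \<Longrightarrow> norm (apply_op B (\<lambda>x. wave t \<xi> x * f x) x) \<le> D * t ^ (l - k)" using AB(2) by blast
    have "norm (apply_op (A + B) (\<lambda>x. wave t \<xi> x * f x) x) \<le> (C + D) * t ^ (l - k)" if "t \<ge> 1" for t x
      unfolding apply_op_add distrib_right using C(2)[OF that, of x] D(2)[OF that, of x] by (intro order_trans[OF norm_triangle_ineq] add_mono)
    then show ?thesis using C(1) D(1) by (intro exI[of _ "C + D"]) auto
  qed
  show "\<exists>C\<ge>0. \<forall>t\<ge>1. \<forall>x. norm (apply_op (cst c * A) (\<lambda>x. wave t \<xi> x * f x) x) \<le> C * t ^ (l - k)"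
    if A: "\<exists>C\<ge>0. \<forall>t\<ge>1. \<forall>x. norm (apply_op A (\<lambda>x. wave t \<xi> x * f x) x) \<le> C * t ^ (l - k)" for c A
  proof -
    obtain C where C: "C \<ge> 0" "\<And>t x. t \<ge> 1 \<Longrightarrow> norm (apply_op A (\<lambda>x. wave t \<xi> x * f x) x) \<le> C * t ^ (l - k)" using A by blast
    have "norm (apply_op (cst c * A) (\<lambda>x. wave t \<xi> x * f x) x) \<le> norm c * C * t ^ (l - k)" if "t \<ge> 1" for t x
      unfolding apply_op_mult[OF sw] apply_op_cst norm_mult mult.assoc by (intro mult_left_mono C that) auto
    then show ?thesis using C(1) by (intro exI[of _ "norm c * C"]) auto
  qed
  fix \<alpha> assume \<alpha>: "\<alpha> \<in> keys P"
  define n where "n = mi_size \<alpha>"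
  have n: "n \<le> l - k" using P \<alpha> by (fastforce simp: deg_le_def n_def)
  have F: "hform 0 n (X1 ^ fst \<alpha> * X2 ^ snd \<alpha>)"
    by (simp add: X_powers hform_def n_def)
  obtain C where C: "C \<ge> 0" "\<And>s x. s \<in> {0..1} \<Longrightarrow> norm (apply_op (poly (shift_op \<xi> (X1 ^ fst \<alpha> * X2 ^ snd \<alpha>)) (cst (of_real s))) f x) \<le> C"
    using poly_apply_bounded[OF f] by blast
  have "norm (apply_op (X1 ^ fst \<alpha> * X2 ^ snd \<alpha>) (\<lambda>x. wave t \<xi> x * f x) x) \<le> C * t ^ (l - k)" if t: "t \<ge> 1" for t x
  proof -
    have "norm (apply_op (X1 ^ fst \<alpha> * X2 ^ snd \<alpha>) (\<lambda>x. wave t \<xi> x * f x) x) = t ^ n * norm (apply_op (poly (shift_op \<xi> (X1 ^ fst \<alpha> * X2 ^ snd \<alpha>)) (cst (of_real (1 / t)))) f x)"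
      using wave_conjugation[OF _ f F, of t \<xi>] t by (simp add: norm_mult norm_power)
    also have "\<dots> \<le> t ^ (l - k) * C"
      using t n by (intro mult_mono C power_increasing) auto
    finally show ?thesis by (simp add: mult.commute)
  qed
  then show "\<exists>C\<ge>0. \<forall>t\<ge>1. \<forall>x. norm (apply_op (X1 ^ fst \<alpha> * X2 ^ snd \<alpha>) (\<lambda>x. wave t \<xi> x * f x) x) \<le> C * t ^ (l - k)"
    using C(1) by blast
qed

text \<open>The part of degree l contributes the first two terms of its expansion, the part of
  degree l - 1 only the first, and everything else is
  \<open>O(t\<^sup>l\<^sup>-\<^sup>2)\<close>.\<close>

lemma wave_asymptotics:
  assumes f: "test_function f" and P: "order_le P l" and l: "l \<ge> 2"
  shows "\<exists>C\<ge>0. \<forall>t\<ge>1. \<forall>x. norm (apply_op P (\<lambda>x. wave t \<xi> x * f x) x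
      - wave t \<xi> x * (of_real t ^ l * (evr (hpart l P) \<xi> * f x) +
          of_real t ^ (l - 1) * (apply_op (coeff (shift_op \<xi> (hpart l P)) 1) f x + evr (hpart (l - 1) P) \<xi> * f x))) \<le> C * t ^ (l - 2)"
proof -
  define F where "F = hpart l P"
  define G where "G = hpart (l - 1) P"
  define Q where "Q = P - F - G"
  have "deg_le 1 l (P - F)" using deg_le_minus_hpart[of 0 l P] P by (simp add: order_le_deg F_def)
  moreover have "hpart (l - 1) (P - F) = G"
    unfolding F_def G_def using l by (intro poly_mapping_eqI) (auto simp: look_hpart lookup_minus)
  ultimately have Q: "deg_le 2 l Q" using deg_le_minus_hpart[of 1 l "P - F"] by (simp add: Q_def numeral_2_eq_2)
  have F: "hform 0 l F" and G: "hform 0 (l - 1) G" by (simp_all add: F_def G_def hform_hpart)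
  obtain q where q: "\<And>x. poly (shift_op \<xi> F) x = cst (evr F \<xi>) + x * (coeff (shift_op \<xi> F) 1 + x * poly q x)"
    using poly_shift_expansion(2)[of "shift_op \<xi> F"] shift_coeff_0 by metis
  obtain C1 where C1: "C1 \<ge> 0" "\<And>s x. s \<in> {0..1} \<Longrightarrow> norm (apply_op (poly q (cst (of_real s))) f x) \<le> C1"
    using poly_apply_bounded[OF f] by blast
  obtain C2 where C2: "C2 \<ge> 0" "\<And>t x. t \<ge> 1 \<Longrightarrow> norm (apply_op G (\<lambda>x. wave t \<xi> x * f x) x - wave t \<xi> x * (of_real t ^ (l - 1) * (evr G \<xi> * f x))) \<le> C2 * t ^ (l - 1) / t"
    using wave_form_asymptotics[OF f G] by blast
  obtain C3 where C3: "C3 \<ge> 0" "\<And>t x. t \<ge> 1 \<Longrightarrow> norm (apply_op Q (\<lambda>x. wave t \<xi> x * f x) x) \<le> C3 * t ^ (l - 2)"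
    using wave_low_order[OF f Q l] by blast
  obtain m where m: "l = Suc (Suc m)" using l by (metis add_2_eq_Suc le_Suc_ex)
  have "norm (apply_op P (\<lambda>x. wave t \<xi> x * f x) x
      - wave t \<xi> x * (of_real t ^ l * (evr F \<xi> * f x) +
          of_real t ^ (l - 1) * (apply_op (coeff (shift_op \<xi> F) 1) f x + evr G \<xi> * f x))) \<le> (C1 + C2 + C3) * t ^ (l - 2)"
    if t: "t \<ge> 1" for t x
  proof -
    let ?w = "wave t \<xi> x" and ?r = "apply_op (poly q (cst (of_real (1 / t)))) f x"
    have t0: "t > 0" using t by simp
    have PFGQ: "P = F + G + Q" by (simp add: Q_def)
    have "apply_op F (\<lambda>x. wave t \<xi> x * f x) x = ?w * (of_real t ^ l * (evr F \<xi> * f x + of_real (1 / t) * (apply_op (coeff (shift_op \<xi> F) 1) f x + of_real (1 / t) * ?r)))"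
      unfolding wave_conjugation[OF t0 f F] q using f
      by (simp add: apply_op_add apply_op_mult test_smooth smooth_apply_op del: of_real_divide)
    also have "\<dots> = ?w * (of_real t ^ l * (evr F \<xi> * f x) + of_real t ^ (l - 1) * apply_op (coeff (shift_op \<xi> F) 1) f x) + ?w * of_real (t ^ m) * ?r"
      using t0 by (simp add: m distrib_left mult_ac)
    finally have "apply_op P (\<lambda>x. wave t \<xi> x * f x) x
      - ?w * (of_real t ^ l * (evr F \<xi> * f x) + of_real t ^ (l - 1) * (apply_op (coeff (shift_op \<xi> F) 1) f x + evr G \<xi> * f x))
      = ?w * of_real (t ^ m) * ?r + (apply_op G (\<lambda>x. wave t \<xi> x * f x) x - ?w * (of_real t ^ (l - 1) * (evr G \<xi> * f x))) + apply_op Q (\<lambda>x. wave t \<xi> x * f x) x"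
      unfolding PFGQ apply_op_add by (simp add: distrib_left)
    also have "norm \<dots> \<le> C1 * t ^ m + C2 * t ^ m + C3 * t ^ m"
    proof (intro order_trans[OF norm_triangle_ineq] add_mono)
      have "norm (?w * of_real (t ^ m) * ?r) = t ^ m * norm ?r" using t0 by (simp add: norm_mult norm_power)
      also have "\<dots> \<le> t ^ m * C1" using t by (intro mult_left_mono C1) auto
      finally show "norm (?w * of_real (t ^ m) * ?r) \<le> C1 * t ^ m" by (simp add: mult.commute)
      show "norm (apply_op G (\<lambda>x. wave t \<xi> x * f x) x - ?w * (of_real t ^ (l - 1) * (evr G \<xi> * f x))) \<le> C2 * t ^ m"
        using C2(2)[OF t, of x] t0 by (simp add: m)
      show "norm (apply_op Q (\<lambda>x. wave t \<xi> x * f x) x) \<le> C3 * t ^ m" using C3(2)[OF t, of x] by (simp add: m)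
    qed
    finally show ?thesis by (simp add: m distrib_right)
  qed
  then show ?thesis unfolding F_def G_def using C1(1) C2(1) C3(1) by (intro exI[of _ "C1 + C2 + C3"]) auto
qed

subsection \<open>Necessity\<close>

lemma coercive_pointwise:
  assumes "weakly_coercive \<infinity> l P"
  shows "\<exists>C\<ge>0. \<forall>\<alpha> f M N x. mi_size \<alpha> < l \<longrightarrow> test_function f \<longrightarrow> (\<forall>x. norm (apply_op P f x) \<le> M) \<longrightarrow>
    (\<forall>x. norm (f x) \<le> N) \<longrightarrow> norm (D_pow \<alpha> f x) \<le> C * M + C * N"
proof -
  obtain c1 c2 where c: "\<And>f. test_function f \<Longrightarrow> (\<Sum>\<alpha> | mi_size \<alpha> < l. Lp_norm \<infinity> (D_pow \<alpha> f))
      \<le> c1 * Lp_norm \<infinity> (apply_op P f) + c2 * Lp_norm \<infinity> f"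
    using assms unfolding weakly_coercive_def by blast
  \<comment> \<open>Absolute values, since the constants in \<open>weakly_coercive\<close> may be
    negative.\<close>
  define C where "C = max \<bar>c1\<bar> \<bar>c2\<bar>"
  have "norm (D_pow \<alpha> f x) \<le> C * M + C * N"
    if \<alpha>: "mi_size \<alpha> < l" and f: "test_function f" and M: "\<forall>x. norm (apply_op P f x) \<le> M" and N: "\<forall>x. norm (f x) \<le> N" for \<alpha> f M N x
  proof -
    have "M \<ge> 0" "N \<ge> 0" using M N norm_ge_zero order_trans by blast+
    then have le: "Lp_norm \<infinity> (apply_op P f) \<le> M" "Lp_norm \<infinity> f \<le> N"
      using Linf_le[OF test_Cc[OF test_apply_op[OF f]]] Linf_le[OF test_Cc[OF f]] M N by blast+
    have "norm (D_pow \<alpha> f x) \<le> Lp_norm \<infinity> (D_pow \<alpha> f)"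
      unfolding D_pow_eq_apply by (intro Linf_ge test_Cc test_apply_op f)
    also have "\<dots> \<le> (\<Sum>\<alpha> | mi_size \<alpha> < l. Lp_norm \<infinity> (D_pow \<alpha> f))"
      using \<alpha> by (intro member_le_sum) (auto simp: Lp_nonneg)
    also have "\<dots> \<le> c1 * Lp_norm \<infinity> (apply_op P f) + c2 * Lp_norm \<infinity> f" by (rule c[OF f])
    also have "\<dots> \<le> C * M + C * N"
      unfolding C_def by (intro add_mono mult_mono le Lp_nonneg) auto
    finally show ?thesis .
  qed
  moreover have "C \<ge> 0" by (simp add: C_def)
  ultimately show ?thesis by blast
qed

lemma monomial_nonzero:
  assumes "\<xi> \<noteq> 0"
  shows "\<exists>\<alpha>. mi_size \<alpha> = n \<and> evr (X1 ^ fst \<alpha> * X2 ^ snd \<alpha>) \<xi> \<noteq> 0"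
proof -
  have e: "evr (X1 ^ a * X2 ^ b) \<xi> = of_real (fst \<xi>) ^ a * of_real (snd \<xi>) ^ b" for a b
    by (simp add: X_powers evr_def ev_single)
  consider "fst \<xi> \<noteq> 0" | "snd \<xi> \<noteq> 0" using assms by (auto simp: prod_eq_iff)
  then show ?thesis
  proof cases
    case 1 then show ?thesis by (intro exI[of _ "(n, 0)"]) (simp add: e mi_size_def del: power_0 power.simps)
  next
    case 2 then show ?thesis by (intro exI[of _ "(0, n)"]) (simp add: e mi_size_def del: power.simps)
  qed
qed

lemma test_scale:
  assumes "test_function f" "s > 0"
  shows "test_function (\<lambda>x. f (s *\<^sub>R x))" "D1 (\<lambda>x. f (s *\<^sub>R x)) = (\<lambda>x. of_real s * D1 f (s *\<^sub>R x))"
    "D2 (\<lambda>x. f (s *\<^sub>R x)) = (\<lambda>x. of_real s * D2 f (s *\<^sub>R x))"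
proof -
  obtain r where "supp_in r f" using assms by (auto simp: test_function_iff)
  then have "supp_in (r / s) (\<lambda>x. f (s *\<^sub>R x))"
    using assms(2) by (auto simp: supp_in_def divide_less_eq mult.commute)
  then show "test_function (\<lambda>x. f (s *\<^sub>R x))"
    using smooth_affine_arg[OF test_smooth[OF assms(1)], of 0 s] by (auto simp: test_function_iff)
  have g: "grad (\<lambda>x. f (s *\<^sub>R x)) (\<lambda>x. of_real s * partial1 f (s *\<^sub>R x)) (\<lambda>x. of_real s * partial2 f (s *\<^sub>R x))"
    using grad_affine_arg[OF smooth_grad[OF test_smooth[OF assms(1)]], of 0 s] by simp
  show "D1 (\<lambda>x. f (s *\<^sub>R x)) = (\<lambda>x. of_real s * D1 f (s *\<^sub>R x))"
    "D2 (\<lambda>x. f (s *\<^sub>R x)) = (\<lambda>x. of_real s * D2 f (s *\<^sub>R x))"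
    unfolding grad_D1[OF g] grad_D2[OF g] by (simp_all add: D1_def D2_def mult_ac)
qed

lemma hpart_shift_coeff:
  assumes "hpart l P = linear_op v 0 * G"
  shows "coeff (shift_op (perp v) (hpart l P)) 1 = cst (evr G (perp v)) * linear_op v 0" "evr (hpart l P) (perp v) = 0"
  unfolding assms using shift_coeff_1[OF evr_linear_perp_self, of v G] evr_linear_perp_self[of v] by (simp_all add: evr_mult)

text \<open>If the subprincipal term at the characteristic direction \<open>\<xi>\<close> can be removed by a real shift \<open>\<eta>\<close>, then
  \<open>P(t \<xi> + \<eta>) = O(t\<^sup>l\<^sup>-\<^sup>2)\<close>, while some monomial of degree \<open>l - 1\<close> has size \<open>t\<^sup>l\<^sup>-\<^sup>1\<close>.\<close>

lemma no_real_shift: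
  assumes wc: "weakly_coercive \<infinity> l P" and l: "l \<ge> 2" and P: "order_le P l" and v: "v \<noteq> 0"
    and G: "hpart l P = linear_op v 0 * G"
    and \<eta>: "evr G (perp v) * of_real (fst v * fst \<eta> + snd v * snd \<eta>) + evr (hpart (l - 1) P) (perp v) = 0"
  shows False
proof -
  define \<xi> where "\<xi> = perp v"
  define g where "g = evr G \<xi>"
  define e where "e = evr (hpart (l - 1) P) \<xi>"
  obtain K where K: "K \<ge> 0" "\<And>\<alpha> f M N x. mi_size \<alpha> < l \<Longrightarrow> test_function f \<Longrightarrow> (\<forall>x. norm (apply_op P f x) \<le> M) \<Longrightarrow>
    (\<forall>x. norm (f x) \<le> N) \<Longrightarrow> norm (D_pow \<alpha> f x) \<le> K * M + K * N"
    using coercive_pointwise[OF wc] by blast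
  obtain \<alpha> where \<alpha>: "mi_size \<alpha> = l - 1" "evr (X1 ^ fst \<alpha> * X2 ^ snd \<alpha>) \<xi> \<noteq> 0"
    using monomial_nonzero[OF perp_nonzero[OF v]] unfolding \<xi>_def by blast
  define A where "A = norm (evr (X1 ^ fst \<alpha> * X2 ^ snd \<alpha>) \<xi>)"
  have A: "A > 0" using \<alpha>(2) by (simp add: A_def)
  obtain \<phi> where \<phi>: "test_function \<phi>" "\<phi> 0 = 1" "\<And>x. norm (\<phi> x) \<le> 1" using bump_exists by blast
  obtain M where M: "M \<ge> 0" "\<And>x. norm (apply_op (linear_op v 0) \<phi> x) \<le> M"
    using test_bounded[OF test_apply_op[OF \<phi>(1)]] by blast
  \<comment> \<open>The cutoff is stretched by 1 / s, so its derivative along v is at most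
    \<open>s * M\<close>. The choice of s makes the resulting term, after multiplication by K, at
    most half of the size A of the monomial.\<close>
  define s where "s = A / (2 * (K * (norm g * M) + 1))"
  have KgM: "K * (norm g * M) \<ge> 0" using K(1) M(1) by simp
  then have s: "s > 0" using A by (simp add: s_def add_nonneg_pos)
  have Ks: "K * (norm g * (s * M)) \<le> A / 2"
  proof -
    have "s * (2 * (K * (norm g * M) + 1)) = A" using KgM by (simp add: s_def)
    then show ?thesis using s by (simp add: algebra_simps)
  qed
  define f where "f = (\<lambda>x. wave 1 \<eta> x * \<phi> (s *\<^sub>R x))"
  note ts = test_scale[OF \<phi>(1) s]
  have f: "test_function f" unfolding f_def by (intro test_mult smooth_wave ts)
  have Lf: "apply_op (linear_op v 0) f x = wave 1 \<eta> x * (of_real (fst v * fst \<eta> + snd v * snd \<eta>) * \<phi> (s *\<^sub>R x) + of_real s * apply_op (linear_op v 0) \<phi> (s *\<^sub>R x))" for x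
    unfolding apply_linear_op f_def D_mult[OF smooth_wave test_smooth[OF ts(1)]] D_wave ts(2,3)
    by (simp add: algebra_simps)
  \<comment> \<open>f carries the extra frequency \<eta>. By the choice of \<eta> the terms that
    contain the undifferentiated cutoff cancel, and only its slow derivative is left.\<close>
  have sub: "apply_op (cst g * linear_op v 0) f x + e * f x = wave 1 \<eta> x * (g * (of_real s * apply_op (linear_op v 0) \<phi> (s *\<^sub>R x)))" for x
  proof -
    have "apply_op (cst g * linear_op v 0) f x + e * f x = g * apply_op (linear_op v 0) f x + e * f x"
      using f by (simp add: apply_op_mult test_smooth)
    also have "\<dots> = wave 1 \<eta> x * (g * (of_real s * apply_op (linear_op v 0) \<phi> (s *\<^sub>R x)))
       + (g * of_real (fst v * fst \<eta> + snd v * snd \<eta>) + e) * (wave 1 \<eta> x * \<phi> (s *\<^sub>R x))"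
      unfolding Lf unfolding f_def by (simp only: distrib_left distrib_right mult_ac add_ac)
    also have "g * of_real (fst v * fst \<eta> + snd v * snd \<eta>) + e = 0" using \<eta> by (simp add: g_def e_def \<xi>_def)
    finally show ?thesis by simp
  qed
  have nsub: "norm (apply_op (cst g * linear_op v 0) f x + e * f x) \<le> norm g * (s * M)" for x
    unfolding sub using s M(2)[of "s *\<^sub>R x"] by (simp add: norm_mult mult_left_mono)
  obtain C where C: "C \<ge> 0" "\<And>t x. t \<ge> 1 \<Longrightarrow> norm (apply_op P (\<lambda>x. wave t \<xi> x * f x) x
      - wave t \<xi> x * (of_real t ^ l * (evr (hpart l P) \<xi> * f x) +
          of_real t ^ (l - 1) * (apply_op (coeff (shift_op \<xi> (hpart l P)) 1) f x + evr (hpart (l - 1) P) \<xi> * f x))) \<le> C * t ^ (l - 2)"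
    using wave_asymptotics[OF f P l, of \<xi>] by blast
  have F: "hform 0 (l - 1) (X1 ^ fst \<alpha> * X2 ^ snd \<alpha>)" using \<alpha>(1) by (simp add: X_powers hform_def)
  obtain D where D: "D \<ge> 0" "\<And>t x. t \<ge> 1 \<Longrightarrow> norm (apply_op (X1 ^ fst \<alpha> * X2 ^ snd \<alpha>) (\<lambda>x. wave t \<xi> x * f x) x
      - wave t \<xi> x * (of_real t ^ (l - 1) * (evr (X1 ^ fst \<alpha> * X2 ^ snd \<alpha>) \<xi> * f x))) \<le> D * t ^ (l - 1) / t"
    using wave_form_asymptotics[OF f F, of \<xi>] by blast
  obtain m where m: "l = Suc (Suc m)" using l by (metis add_2_eq_Suc le_Suc_ex)
  have main: "t * (A / 2) \<le> D + K * C + K" if t: "t \<ge> 1" for t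
  proof -
    let ?h = "\<lambda>x. wave t \<xi> x * f x"
    have th: "test_function ?h" by (intro test_mult smooth_wave f)
    have tm: "t ^ m \<ge> 1" using t by simp
    have "norm (apply_op P ?h x) \<le> t ^ Suc m * (norm g * (s * M)) + C * t ^ m" for x
    proof -
      have "norm (apply_op P ?h x - wave t \<xi> x * (of_real t ^ Suc m * (apply_op (cst g * linear_op v 0) f x + e * f x))) \<le> C * t ^ m"
        using C(2)[OF t, of x] hpart_shift_coeff[OF G] by (simp add: m \<xi>_def g_def e_def)
      moreover have "norm (wave t \<xi> x * (of_real t ^ Suc m * (apply_op (cst g * linear_op v 0) f x + e * f x))) \<le> t ^ Suc m * (norm g * (s * M))"
        unfolding norm_mult[of "wave t \<xi> x"] norm_mult[of "of_real t ^ Suc m"] using t nsub[of x]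
        by (simp add: norm_power mult_left_mono del: power_Suc)
      ultimately show ?thesis using norm_triangle_sub[of "apply_op P ?h x"
        "wave t \<xi> x * (of_real t ^ Suc m * (apply_op (cst g * linear_op v 0) f x + e * f x))"] by linarith
    qed
    moreover have "norm (?h x) \<le> 1" for x
      using \<phi>(3) by (simp add: norm_mult f_def)
    ultimately have "norm (D_pow \<alpha> ?h 0) \<le> K * (t ^ Suc m * (norm g * (s * M)) + C * t ^ m) + K * 1"
      using \<alpha>(1) l by (intro K(2) th allI) auto
    moreover have "t ^ Suc m * A \<le> norm (D_pow \<alpha> ?h 0) + D * t ^ m"
    proof -
      have "norm (D_pow \<alpha> ?h 0 - of_real t ^ Suc m * evr (X1 ^ fst \<alpha> * X2 ^ snd \<alpha>) \<xi>) \<le> D * t ^ m"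
        using D(2)[OF t, of 0] \<phi>(2) t unfolding D_pow_eq_apply by (simp add: f_def m)
      moreover have "norm (of_real t ^ Suc m * evr (X1 ^ fst \<alpha> * X2 ^ snd \<alpha>) \<xi>) = t ^ Suc m * A"
        unfolding norm_mult A_def using t by (simp add: norm_power norm_mult)
      ultimately show ?thesis
        using norm_triangle_sub[of "of_real t ^ Suc m * evr (X1 ^ fst \<alpha> * X2 ^ snd \<alpha>) \<xi>" "D_pow \<alpha> ?h 0"]
        by (simp only: norm_minus_commute)
    qed
    ultimately have "t ^ Suc m * A \<le> t ^ Suc m * (K * (norm g * (s * M))) + K * C * t ^ m + K + D * t ^ m"
      by (simp add: algebra_simps)
    moreover have "t ^ Suc m * (K * (norm g * (s * M))) \<le> t ^ Suc m * (A / 2)"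
      using Ks t by (intro mult_left_mono) auto
    moreover have "K \<le> K * t ^ m" using mult_left_mono[OF tm K(1)] by simp
    moreover have "t ^ Suc m * A = 2 * (t ^ Suc m * (A / 2))" by simp
    moreover have "(D + K * C + K) * t ^ m = D * t ^ m + K * C * t ^ m + K * t ^ m"
      by (simp add: distrib_right)
    ultimately have "t ^ Suc m * (A / 2) \<le> (D + K * C + K) * t ^ m" by linarith
    then have "t ^ m * (t * (A / 2)) \<le> t ^ m * (D + K * C + K)" by (simp add: mult_ac)
    then show ?thesis using tm by (simp add: mult_le_cancel_left)
  qed
  define B where "B = D + K * C + K"
  have B: "B \<ge> 0" using D(1) K(1) C(1) by (simp add: B_def)
  have "(2 * (B + 1) / A + 1) * (A / 2) \<le> B" unfolding B_def
    by (rule main) (use B A in \<open>simp add: B_def\<close>)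
  moreover have "(2 * (B + 1) / A + 1) * (A / 2) = B + 1 + A / 2" using A by (simp add: field_simps)
  ultimately show False using A by simp
qed

text \<open>To leading order P(D) multiplies the wave in the double direction by
  \<open>c t\<^sup>l\<^sup>-\<^sup>1\<close> and the other one by \<open>d t\<^sup>l\<close>.
  Divided by these factors, the two waves have images close to wave times cutoff: bounded, and equal
  at the origin. A derivative of order l - 1 is of size 1 on the first wave but
  \<open>O(1 / t)\<close> on the second, so it survives in the difference.\<close>

lemma oscillating_hump:
  assumes l: "l \<ge> 2" and P: "order_le P l" and v: "v \<noteq> 0"
    and G: "hpart l P = linear_op v 0 * G" and g0: "evr G (perp v) = 0"
    and c: "evr (hpart (l - 1) P) (perp v) \<noteq> 0" and d: "evr (hpart l P) \<xi>' \<noteq> 0"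
    and \<alpha>: "mi_size \<alpha> = l - 1" "evr (X1 ^ fst \<alpha> * X2 ^ snd \<alpha>) (perp v) \<noteq> 0"
  shows "\<exists>K. \<forall>\<delta>>0. \<forall>\<epsilon>>0. \<exists>u. test_function u \<and> supp_in \<delta> u \<and> (\<forall>x. norm (apply_op P u x) \<le> K) \<and>
    norm (apply_op P u 0) \<le> \<epsilon> \<and> (\<forall>x. norm (u x) \<le> \<epsilon>) \<and> norm (D_pow \<alpha> u 0 - 1) \<le> 1 / 2"
proof -
  define \<xi> where "\<xi> = perp v"
  define c where "c = evr (hpart (l - 1) P) \<xi>"
  define d where "d = evr (hpart l P) \<xi>'"
  define \<rho> where "\<rho> = evr (X1 ^ fst \<alpha> * X2 ^ snd \<alpha>) \<xi>"
  \<comment> \<open>\<kappa> scales the derivative of the first normalized wave at the origin from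
    about \<rho> / c to about 1.\<close>
  define \<kappa> where "\<kappa> = c / \<rho>"
  have nz: "c \<noteq> 0" "d \<noteq> 0" "\<rho> \<noteq> 0" using assms by (auto simp: c_def d_def \<rho>_def \<xi>_def)
  obtain m where m: "l = Suc (Suc m)" using l by (metis add_2_eq_Suc le_Suc_ex)
  obtain \<phi>0 where \<phi>0: "test_function \<phi>0" "\<phi>0 0 = 1" "\<And>x. norm (\<phi>0 x) \<le> 1" "supp_in 1 \<phi>0" using bump_exists by blast
  have "\<exists>u. test_function u \<and> supp_in \<delta> u \<and> (\<forall>x. norm (apply_op P u x) \<le> 2 * norm \<kappa> + 1) \<and>
    norm (apply_op P u 0) \<le> \<epsilon> \<and> (\<forall>x. norm (u x) \<le> \<epsilon>) \<and> norm (D_pow \<alpha> u 0 - 1) \<le> 1 / 2"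
    if \<delta>: "\<delta> > 0" and \<epsilon>: "\<epsilon> > 0" for \<delta> \<epsilon>
  proof -
    define \<phi> where "\<phi> = (\<lambda>x. \<phi>0 ((1 / \<delta>) *\<^sub>R x))"
    have t\<phi>: "test_function \<phi>" unfolding \<phi>_def using test_scale(1)[OF \<phi>0(1), of "1 / \<delta>"] \<delta> by simp
    have \<phi>: "\<phi> 0 = 1" "\<And>x. norm (\<phi> x) \<le> 1" using \<phi>0 by (simp_all add: \<phi>_def)
    have s\<phi>: "supp_in \<delta> \<phi>"
      using \<phi>0(4) \<delta> by (auto simp: \<phi>_def supp_in_def less_divide_eq)
    have sm: "smooth (\<lambda>x. wave t \<zeta> x * \<phi> x)" for t \<zeta> using t\<phi> by (simp add: smooth_mult smooth_wave test_smooth)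
    obtain B1 where B1: "B1 \<ge> 0" "\<And>t x. t \<ge> 1 \<Longrightarrow> norm (apply_op P (\<lambda>x. wave t \<xi> x * \<phi> x) x - wave t \<xi> x * (of_real t ^ Suc m * (c * \<phi> x))) \<le> B1 * t ^ m"
    proof -
      obtain C where "C \<ge> 0" "\<And>t x. t \<ge> 1 \<Longrightarrow> norm (apply_op P (\<lambda>x. wave t \<xi> x * \<phi> x) x
        - wave t \<xi> x * (of_real t ^ l * (evr (hpart l P) \<xi> * \<phi> x) +
          of_real t ^ (l - 1) * (apply_op (coeff (shift_op \<xi> (hpart l P)) 1) \<phi> x + evr (hpart (l - 1) P) \<xi> * \<phi> x))) \<le> C * t ^ (l - 2)"
        using wave_asymptotics[OF t\<phi> P l, of \<xi>] by blast
      then show ?thesis using that[of C] hpart_shift_coeff[OF G] g0 by (simp add: m \<xi>_def c_def)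
    qed
    have F: "hform 0 (Suc m) (X1 ^ fst \<alpha> * X2 ^ snd \<alpha>)" using \<alpha>(1) by (simp add: X_powers hform_def m)
    obtain B2 where B2: "B2 \<ge> 0" "\<And>t x. t \<ge> 1 \<Longrightarrow> norm (apply_op (X1 ^ fst \<alpha> * X2 ^ snd \<alpha>) (\<lambda>x. wave t \<xi> x * \<phi> x) x
        - wave t \<xi> x * (of_real t ^ Suc m * (\<rho> * \<phi> x))) \<le> B2 * t ^ Suc m / t"
      using wave_form_asymptotics[OF t\<phi> F, of \<xi>] unfolding \<rho>_def by blast
    obtain B3 where B3: "B3 \<ge> 0" "\<And>t x. t \<ge> 1 \<Longrightarrow> norm (apply_op (hpart l P) (\<lambda>x. wave t \<xi>' x * \<phi> x) x
        - wave t \<xi>' x * (of_real t ^ l * (d * \<phi> x))) \<le> B3 * t ^ l / t"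
      using wave_form_asymptotics[OF t\<phi> hform_hpart, of l P \<xi>'] unfolding d_def by blast
    have "deg_le 1 l (P - hpart l P)" using deg_le_minus_hpart[of 0 l P] P by (simp add: order_le_deg)
    then obtain B4 where B4: "B4 \<ge> 0" "\<And>t x. t \<ge> 1 \<Longrightarrow> norm (apply_op (P - hpart l P) (\<lambda>x. wave t \<xi>' x * \<phi> x) x) \<le> B4 * t ^ (l - 1)"
      using wave_low_order[OF t\<phi>, of 1 l "P - hpart l P" \<xi>'] l by auto
    have l1: "1 \<le> l" using l by simp
    have "deg_le 1 l (X1 ^ fst \<alpha> * X2 ^ snd \<alpha>)" by (rule deg_le_mono[OF hform_deg_le[OF F]]) (simp add: m)
    then obtain B5 where B5: "B5 \<ge> 0" "\<And>t x. t \<ge> 1 \<Longrightarrow> norm (apply_op (X1 ^ fst \<alpha> * X2 ^ snd \<alpha>) (\<lambda>x. wave t \<xi>' x * \<phi> x) x) \<le> B5 * t ^ (l - 1)"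
      using wave_low_order[OF t\<phi> _ l1, of _ \<xi>'] by blast
    define E where "E = norm \<kappa> * (B1 / norm c + (B3 + B4) / norm d + (1 / norm c + 1 / norm d) + (B2 / norm c + B5 / norm d))"
    have E: "E \<ge> 0" unfolding E_def using B1(1) B2(1) B3(1) B4(1) B5(1) by simp
    \<comment> \<open>E adds the errors for P u, for the size of u and for its derivative. The
      constants B1 to B5 depend on the cutoff, hence on \<delta>, but t is chosen after them; thus
      the bound \<open>2 * norm \<kappa> + 1\<close> is the same for all \<delta> and
      \<epsilon>.\<close>
    define t where "t = max 1 (E / min \<epsilon> (1 / 2))"
    have t: "t \<ge> 1" by (simp add: t_def)
    then have t0: "t > 0" by simp
    have mp: "min \<epsilon> (1 / 2) > 0" using \<epsilon> by simp
    have "E / min \<epsilon> (1 / 2) \<le> t" by (simp add: t_def)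
    then have "E \<le> t * min \<epsilon> (1 / 2)" using mp by (subst (asm) pos_divide_le_eq)
    then have Et: "E / t \<le> min \<epsilon> (1 / 2)" by (subst pos_divide_le_eq[OF t0]) (simp only: mult.commute)
    then have Et': "E / t \<le> \<epsilon>" "E / t \<le> 1 / 2" by simp_all
    define p where "p = inverse (c * of_real t ^ Suc m)"
    define q where "q = inverse (d * of_real t ^ l)"
    have np: "norm p = 1 / (norm c * t ^ Suc m)" and nq: "norm q = 1 / (norm d * t ^ l)"
      using t0 by (simp_all add: p_def q_def norm_inverse norm_mult norm_power norm_divide inverse_eq_divide)
    define u where "u = (\<lambda>x. \<kappa> * (p * (wave t \<xi> x * \<phi> x)) + - \<kappa> * (q * (wave t \<xi>' x * \<phi> x)))"
    have uop: "apply_op A u x = \<kappa> * (p * apply_op A (\<lambda>x. wave t \<xi> x * \<phi> x) x) + - \<kappa> * (q * apply_op A (\<lambda>x. wave t \<xi>' x * \<phi> x) x)" for A x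
      unfolding u_def by (simp only: apply_op_fun_add apply_op_fun_cmult smooth_mult smooth_const sm)
    have tu: "test_function u" unfolding u_def by (intro test_add test_cmult test_mult smooth_wave t\<phi>)
    have su: "supp_in \<delta> u" unfolding u_def by (intro supp_in_add supp_in_mult s\<phi>)
    have pc: "p * (of_real t ^ Suc m * c) = 1" and qd: "q * (of_real t ^ l * d) = 1"
      using nz t0 by (simp_all add: p_def q_def field_simps)
    have err1: "norm (p * apply_op P (\<lambda>x. wave t \<xi> x * \<phi> x) x - wave t \<xi> x * \<phi> x) \<le> B1 / norm c / t" for x
    proof -
      have "p * apply_op P (\<lambda>x. wave t \<xi> x * \<phi> x) x - wave t \<xi> x * \<phi> x
        = p * (apply_op P (\<lambda>x. wave t \<xi> x * \<phi> x) x - wave t \<xi> x * (of_real t ^ Suc m * (c * \<phi> x)))"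
        using pc by (simp add: right_diff_distrib) (metis mult.assoc mult.left_commute mult_1)
      also have "norm \<dots> \<le> norm p * (B1 * t ^ m)" unfolding norm_mult by (intro mult_left_mono B1 t) auto
      also have "\<dots> = B1 / norm c / t" using t0 by (simp add: np)
      finally show ?thesis .
    qed
    have err2: "norm (q * apply_op P (\<lambda>x. wave t \<xi>' x * \<phi> x) x - wave t \<xi>' x * \<phi> x) \<le> (B3 + B4) / norm d / t" for x
    proof -
      let ?w = "\<lambda>x. wave t \<xi>' x * \<phi> x"
      have "apply_op P ?w x = apply_op (hpart l P) ?w x + apply_op (P - hpart l P) ?w x"
        using fun_cong[OF apply_op_add[of "hpart l P" "P - hpart l P" ?w], of x] by simp
      then have "q * apply_op P ?w x - ?w x
        = q * ((apply_op (hpart l P) ?w x - wave t \<xi>' x * (of_real t ^ l * (d * \<phi> x))) + apply_op (P - hpart l P) ?w x)"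
        using qd by (simp add: right_diff_distrib distrib_left)
      also have "norm \<dots> \<le> norm q * (B3 * t ^ l / t + B4 * t ^ (l - 1))"
        unfolding norm_mult by (intro mult_left_mono order_trans[OF norm_triangle_ineq] add_mono B3 B4 t) auto
      also have "\<dots> = (B3 + B4) / norm d / t" using t0 nz by (simp add: nq m field_simps)
      finally show ?thesis .
    qed
    have Pu: "norm (apply_op P u x - \<kappa> * (wave t \<xi> x * \<phi> x - wave t \<xi>' x * \<phi> x)) \<le> E / t" for x
    proof -
      have "apply_op P u x - \<kappa> * (wave t \<xi> x * \<phi> x - wave t \<xi>' x * \<phi> x)
        = \<kappa> * ((p * apply_op P (\<lambda>x. wave t \<xi> x * \<phi> x) x - wave t \<xi> x * \<phi> x) - (q * apply_op P (\<lambda>x. wave t \<xi>' x * \<phi> x) x - wave t \<xi>' x * \<phi> x))"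
        unfolding uop by (simp add: algebra_simps)
      also have "norm \<dots> \<le> norm \<kappa> * (B1 / norm c / t + (B3 + B4) / norm d / t)"
        unfolding norm_mult[of \<kappa>] by (intro mult_left_mono order_trans[OF norm_triangle_ineq4] add_mono err1 err2) auto
      also have "\<dots> = norm \<kappa> * (B1 / norm c + (B3 + B4) / norm d) / t"
        by (simp only: add_divide_distrib[symmetric] times_divide_eq_right)
      also have "\<dots> \<le> E / t" unfolding E_def using t0 B2(1) B5(1)
        by (intro divide_right_mono mult_left_mono) auto
      finally show ?thesis .
    qed
    have "norm (apply_op P u x) \<le> 2 * norm \<kappa> + 1" for x
    proof -
      have "norm (wave t \<xi> x * \<phi> x - wave t \<xi>' x * \<phi> x) \<le> norm (wave t \<xi> x * \<phi> x) + norm (wave t \<xi>' x * \<phi> x)"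
        by (rule norm_triangle_ineq4)
      also have "\<dots> \<le> 2" using \<phi>(2)[of x] by (simp add: norm_mult)
      finally have "norm (\<kappa> * (wave t \<xi> x * \<phi> x - wave t \<xi>' x * \<phi> x)) \<le> norm \<kappa> * 2"
        unfolding norm_mult[of \<kappa>] by (intro mult_left_mono) auto
      then show ?thesis using Pu[of x] Et'(2) norm_triangle_sub[of "apply_op P u x" "\<kappa> * (wave t \<xi> x * \<phi> x - wave t \<xi>' x * \<phi> x)"]
        by linarith
    qed
    moreover have "norm (apply_op P u 0) \<le> \<epsilon>" using Pu[of 0] Et'(1) by simp
    moreover have "norm (u x) \<le> \<epsilon>" for x
    proof -
      have pow: "t \<le> t ^ Suc m" "t \<le> t ^ l" using t power_increasing[of 1 "Suc m" t] power_increasing[of 1 l t] by (simp_all add: m)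
      have "norm p \<le> 1 / (norm c * t)" "norm q \<le> 1 / (norm d * t)"
        unfolding np nq using nz t0 pow by (intro divide_left_mono mult_left_mono mult_pos_pos; simp)+
      then have "norm (p * (wave t \<xi> x * \<phi> x)) \<le> 1 / (norm c * t) * 1" "norm (q * (wave t \<xi>' x * \<phi> x)) \<le> 1 / (norm d * t) * 1"
        unfolding norm_mult using \<phi>(2)[of x] t0 by (intro mult_mono; simp)+
      then have pq: "norm (p * (wave t \<xi> x * \<phi> x)) \<le> 1 / (norm c * t)" "norm (q * (wave t \<xi>' x * \<phi> x)) \<le> 1 / (norm d * t)"
        by simp_all
      have "norm (u x) \<le> norm (\<kappa> * (p * (wave t \<xi> x * \<phi> x))) + norm (- \<kappa> * (q * (wave t \<xi>' x * \<phi> x)))"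
        unfolding u_def by (rule norm_triangle_ineq)
      also have "\<dots> = norm \<kappa> * norm (p * (wave t \<xi> x * \<phi> x)) + norm \<kappa> * norm (q * (wave t \<xi>' x * \<phi> x))"
        by (simp add: norm_mult)
      also have "\<dots> \<le> norm \<kappa> * (1 / (norm c * t)) + norm \<kappa> * (1 / (norm d * t))"
        by (intro add_mono mult_left_mono pq) auto
      also have "\<dots> = norm \<kappa> * (1 / norm c + 1 / norm d) / t"
        unfolding divide_divide_eq_left[symmetric] distrib_left[symmetric]
        by (simp only: add_divide_distrib[symmetric] times_divide_eq_right)
      also have "\<dots> \<le> E / t" unfolding E_def using t0 B1(1) B2(1) B3(1) B4(1) B5(1)
        by (intro divide_right_mono mult_left_mono) auto
      finally show ?thesis using Et'(1) by simp
    qed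
    moreover have "norm (D_pow \<alpha> u 0 - 1) \<le> 1 / 2"
    proof -
      let ?a = "apply_op (X1 ^ fst \<alpha> * X2 ^ snd \<alpha>) (\<lambda>x. wave t \<xi> x * \<phi> x) 0"
      let ?b = "apply_op (X1 ^ fst \<alpha> * X2 ^ snd \<alpha>) (\<lambda>x. wave t \<xi>' x * \<phi> x) 0"
      have a: "norm (?a - of_real t ^ Suc m * \<rho>) \<le> B2 * t ^ m" using B2(2)[OF t, of 0] \<phi>(1) t0 by simp
      have b: "norm ?b \<le> B5 * t ^ Suc m" using B5(2)[OF t, of 0] by (simp add: m)
      have "\<kappa> * (p * (of_real t ^ Suc m * \<rho>)) = 1" using nz t0 by (simp add: \<kappa>_def p_def field_simps)
      then have "D_pow \<alpha> u 0 - 1 = \<kappa> * (p * (?a - of_real t ^ Suc m * \<rho>) - q * ?b)"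
        unfolding D_pow_eq_apply uop by (simp add: right_diff_distrib)
      also have "norm \<dots> \<le> norm \<kappa> * (norm p * (B2 * t ^ m) + norm q * (B5 * t ^ Suc m))"
        unfolding norm_mult[of \<kappa>]
      proof (intro mult_left_mono order_trans[OF norm_triangle_ineq4] add_mono)
        show "norm (p * (?a - of_real t ^ Suc m * \<rho>)) \<le> norm p * (B2 * t ^ m)"
          unfolding norm_mult[of p] by (intro mult_left_mono a) auto
        show "norm (q * ?b) \<le> norm q * (B5 * t ^ Suc m)"
          unfolding norm_mult[of q] by (intro mult_left_mono b) auto
      qed auto
      also have "\<dots> = norm \<kappa> * (B2 / norm c + B5 / norm d) / t" using t0 nz by (simp add: np nq m field_simps)
      also have "\<dots> \<le> E / t" unfolding E_def using t0 B1(1) B3(1) B4(1)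
        by (intro divide_right_mono mult_left_mono) auto
      finally show ?thesis using Et'(2) by linarith
    qed
    ultimately show ?thesis using tu su by blast
  qed
  then show ?thesis by blast
qed

text \<open>Gliding hump: humps are added inside balls on which all previous \<open>P u\<close> are small, so the sum of \<open>J\<close>
  humps keeps \<open>P F\<close> bounded while the derivative at the origin grows like \<open>J\<close>.\<close>

lemma no_double_root:
  assumes wc: "weakly_coercive \<infinity> l P" and l: "l \<ge> 2" and P: "order_le P l" and v: "v \<noteq> 0"
    and G: "hpart l P = linear_op v 0 * G" and g0: "evr G (perp v) = 0" and d: "evr (hpart l P) \<xi>' \<noteq> 0"
  shows False
proof (cases "evr (hpart (l - 1) P) (perp v) = 0")
  case True
  \<comment> \<open>The subprincipal term already vanishes in this direction, so the trivial shift
    suffices.\<close>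
  then show False using no_real_shift[OF wc l P v G, of 0] by simp
next
  case False
  obtain \<alpha> where \<alpha>: "mi_size \<alpha> = l - 1" "evr (X1 ^ fst \<alpha> * X2 ^ snd \<alpha>) (perp v) \<noteq> 0"
    using monomial_nonzero[OF perp_nonzero[OF v]] by blast
  obtain K where K: "\<And>\<delta> \<epsilon>. \<delta> > 0 \<Longrightarrow> \<epsilon> > 0 \<Longrightarrow> \<exists>u. test_function u \<and> supp_in \<delta> u \<and> (\<forall>x. norm (apply_op P u x) \<le> K) \<and>
    norm (apply_op P u 0) \<le> \<epsilon> \<and> (\<forall>x. norm (u x) \<le> \<epsilon>) \<and> norm (D_pow \<alpha> u 0 - 1) \<le> 1 / 2"
    using oscillating_hump[OF l P v G g0 False d \<alpha>] by blast
  obtain u0 where "\<forall>x. norm (apply_op P u0 x) \<le> K" using K[of 1 1] by auto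
  then have K0: "K \<ge> 0" using norm_ge_zero order_trans by blast
  \<comment> \<open>The quantifier over \<epsilon> belongs to the induction statement: stage J + 1
    uses stage J with \<epsilon> / 4, which keeps the bound K + \<epsilon> independent of J.\<close>
  have sums: "\<forall>\<epsilon>>0. \<exists>F. test_function F \<and> (\<forall>x. norm (apply_op P F x) \<le> K + \<epsilon>) \<and> norm (apply_op P F 0) \<le> \<epsilon> \<and>
     (\<forall>x. norm (F x) \<le> \<epsilon>) \<and> Re (D_pow \<alpha> F 0) \<ge> of_nat J / 2" for J :: nat
  proof (induction J)
    case 0
    show ?case
    proof (intro allI impI exI[of _ "\<lambda>x. 0"])
      fix \<epsilon> :: real assume "\<epsilon> > 0"
      have "apply_op A (\<lambda>x. 0) = (\<lambda>x. 0)" for A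
        using apply_op_fun_cmult[of "\<lambda>x. 0" A 0] by simp
      then show "test_function (\<lambda>x. 0) \<and> (\<forall>x. norm (apply_op P (\<lambda>x. 0) x) \<le> K + \<epsilon>) \<and> norm (apply_op P (\<lambda>x. 0) 0) \<le> \<epsilon> \<and>
         (\<forall>x. norm ((\<lambda>x. 0::complex) (x :: real \<times> real)) \<le> \<epsilon>) \<and> Re (D_pow \<alpha> (\<lambda>x. 0) 0) \<ge> of_nat 0 / 2"
        using \<open>\<epsilon> > 0\<close> K0 by (simp add: D_pow_eq_apply)
    qed
  next
    case (Suc J)
    show ?case
    proof (intro allI impI)
      fix \<epsilon> :: real assume \<epsilon>: "\<epsilon> > 0"
      then have "\<epsilon> / 4 > 0" by simp
      then obtain F where F: "test_function F" "\<forall>x. norm (apply_op P F x) \<le> K + \<epsilon> / 4" "norm (apply_op P F 0) \<le> \<epsilon> / 4"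
        "\<forall>x. norm (F x) \<le> \<epsilon> / 4" "Re (D_pow \<alpha> F 0) \<ge> of_nat J / 2"
        using Suc by blast
      obtain \<delta> where \<delta>: "\<delta> > 0" "\<And>x y. norm (x - y) < \<delta> \<Longrightarrow> norm (apply_op P F x - apply_op P F y) < \<epsilon> / 4"
        using Cc_uniformly_continuous[OF test_Cc[OF test_apply_op[OF F(1)]] \<open>\<epsilon> / 4 > 0\<close>] by blast
      obtain u where u: "test_function u" "supp_in (\<delta> / 2) u" "\<forall>x. norm (apply_op P u x) \<le> K"
        "norm (apply_op P u 0) \<le> \<epsilon> / 4" "\<forall>x. norm (u x) \<le> \<epsilon> / 4" "norm (D_pow \<alpha> u 0 - 1) \<le> 1 / 2"
        using K[of "\<delta> / 2" "\<epsilon> / 4"] \<delta>(1) \<epsilon> by auto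
      have add: "apply_op A (\<lambda>x. F x + u x) = (\<lambda>x. apply_op A F x + apply_op A u x)" for A
        by (intro apply_op_fun_add test_smooth F u)
      show "\<exists>F. test_function F \<and> (\<forall>x. norm (apply_op P F x) \<le> K + \<epsilon>) \<and> norm (apply_op P F 0) \<le> \<epsilon> \<and>
        (\<forall>x. norm (F x) \<le> \<epsilon>) \<and> Re (D_pow \<alpha> F 0) \<ge> of_nat (Suc J) / 2"
      proof (intro exI[of _ "\<lambda>x. F x + u x"] conjI allI)
        show "test_function (\<lambda>x. F x + u x)" by (intro test_add F u)
        show "norm (apply_op P (\<lambda>x. F x + u x) x) \<le> K + \<epsilon>" for x
        proof (cases "norm x < \<delta>")
          case True
          have "norm (apply_op P F x - apply_op P F 0) < \<epsilon> / 4" by (rule \<delta>(2)) (use True in simp)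
          then have "norm (apply_op P F x) \<le> \<epsilon> / 2"
            using F(3) norm_triangle_sub[of "apply_op P F x" "apply_op P F 0"] by linarith
          then show ?thesis unfolding add using u(3)[rule_format, of x] \<epsilon> norm_triangle_ineq[of "apply_op P F x" "apply_op P u x"]
            by linarith
        next
          case False
          have "apply_op P u x = 0"
            using supp_in_apply_op[OF test_smooth[OF u(1)] u(2), of P] False \<delta>(1) by (simp add: supp_in_def)
          then show ?thesis unfolding add using F(2)[rule_format, of x] \<epsilon> by simp
        qed
        show "norm (apply_op P (\<lambda>x. F x + u x) 0) \<le> \<epsilon>"
          unfolding add using F(3) u(4) \<epsilon> norm_triangle_ineq[of "apply_op P F 0" "apply_op P u 0"] by linarith
        show "norm (F x + u x) \<le> \<epsilon>" for x
          using F(4)[rule_format, of x] u(5)[rule_format, of x] \<epsilon> norm_triangle_ineq[of "F x" "u x"] by linarith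
        have "\<bar>Re (D_pow \<alpha> u 0 - 1)\<bar> \<le> 1 / 2" using u(6) abs_Re_le_cmod order_trans by blast
        then have "Re (D_pow \<alpha> u 0 - 1) \<ge> - 1 / 2" by linarith
        then have "Re (D_pow \<alpha> u 0) \<ge> 1 / 2" by simp
        then show "Re (D_pow \<alpha> (\<lambda>x. F x + u x) 0) \<ge> of_nat (Suc J) / 2"
          using F(5) unfolding D_pow_eq_apply add by (simp add: add_divide_distrib)
      qed
    qed
  qed
  obtain C where C: "C \<ge> 0" "\<And>\<alpha> f M N x. mi_size \<alpha> < l \<Longrightarrow> test_function f \<Longrightarrow> (\<forall>x. norm (apply_op P f x) \<le> M) \<Longrightarrow>
    (\<forall>x. norm (f x) \<le> N) \<Longrightarrow> norm (D_pow \<alpha> f x) \<le> C * M + C * N"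
    using coercive_pointwise[OF wc] by blast
  define X where "X = C * (K + 1) + C * 1"
  obtain J :: nat where J: "2 * X < of_nat J" using reals_Archimedean2 by blast
  obtain F where F: "test_function F" "\<forall>x. norm (apply_op P F x) \<le> K + 1" "\<forall>x. norm (F x) \<le> 1" "Re (D_pow \<alpha> F 0) \<ge> of_nat J / 2"
    using sums[of J] zero_less_one by blast
  have "norm (D_pow \<alpha> F 0) \<le> X"
    unfolding X_def using \<alpha>(1) l by (intro C(2) F) auto
  then have "Re (D_pow \<alpha> F 0) \<le> X" using complex_Re_le_cmod order_trans by blast
  then show False using F(4) J by linarith
qed

subsection \<open>The characterization\<close>

lemma subleading_deg_le:
  assumes "finite S"
  shows "deg_le 1 (card S) (\<Sum>k\<in>S. cst (a k) * (\<Prod>j\<in>S - {k}. linear_op (v j) 0))"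
proof (intro deg_le_sum)
  fix k assume k: "k \<in> S"
  have "hform 0 (card (S - {k})) (\<Prod>j\<in>S - {k}. linear_op (v j) 0)"
    using assms by (intro hform_prod hform_linear) auto
  then have "hform 0 (card (S - {k})) (cst (a k) * (\<Prod>j\<in>S - {k}. linear_op (v j) 0))" by (rule hform_cst_mult)
  then show "deg_le 1 (card S) (cst (a k) * (\<Prod>j\<in>S - {k}. linear_op (v j) 0))"
    using card_Suc_Diff1[OF assms k] by (intro deg_le_mono[OF hform_deg_le]) auto
qed

lemma hpart_eq:
  assumes "hform k l F" "deg_le (Suc k) l G" "k \<le> l"
  shows "hpart (l - k) (F + G) = F"
proof (rule poly_mapping_eqI)
  fix \<alpha>
  show "look (hpart (l - k) (F + G)) \<alpha> = look F \<alpha>"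
  proof (cases "mi_size \<alpha> = l - k")
    case True
    then have "\<alpha> \<notin> keys G" using assms(2,3) by (fastforce simp: deg_le_def)
    then show ?thesis using True by (simp add: look_hpart lookup_add in_keys_iff)
  next
    case False
    then have "\<alpha> \<notin> keys F" using assms(1) by (fastforce simp: hform_def)
    then show ?thesis using False by (simp add: look_hpart in_keys_iff)
  qed
qed

lemma has_order_iff: "has_order P n \<longleftrightarrow> deg_le 0 n P \<and> hpart n P \<noteq> 0"
proof -
  have "hpart n P \<noteq> 0 \<longleftrightarrow> keys (hpart n P) \<noteq> {}" by simp
  then show ?thesis unfolding keys_hpart by (auto simp: has_order_def order_le_deg)
qed

text \<open>The exact order is automatic: a homogeneous part whose symbol is non-zero at (1, 0) is
  not zero.\<close>

lemma elliptic_iff: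
  "elliptic_of_order R n \<longleftrightarrow> deg_le 0 n R \<and> (\<forall>\<xi>. \<xi> \<noteq> 0 \<longrightarrow> evr (hpart n R) \<xi> \<noteq> 0)"
proof -
  have "(1, 0) \<noteq> (0 :: real \<times> real)" by (simp add: prod_eq_iff)
  moreover have "evr 0 \<xi> = 0" for \<xi> by (simp add: evr_def)
  ultimately show ?thesis
    unfolding elliptic_of_order_def has_order_iff homogeneous_symbol_eq evr_def[symmetric] by metis
qed

text \<open>Among the directions (1, s) each line excludes at most one s. The result is the
  non-characteristic direction for the humps and, conversely, shows that the product form has order
  l.\<close>

lemma avoid_lines:
  assumes "finite S" "\<forall>k\<in>S. v k \<noteq> 0"
  shows "\<exists>\<xi>. \<xi> \<noteq> 0 \<and> (\<forall>k\<in>S. evr (linear_op (v k) 0) \<xi> \<noteq> 0)"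
proof -
  define B where "B k = {s. fst (v k) + snd (v k) * s = 0}" for k
  have "finite (B k)" if "k \<in> S" for k
  proof (cases "snd (v k) = 0")
    case True
    then have "B k = {}" using assms(2) that by (auto simp: B_def prod_eq_iff)
    then show ?thesis by simp
  next
    case False
    then have "B k \<subseteq> {- fst (v k) / snd (v k)}" by (auto simp: B_def field_simps add_eq_0_iff)
    then show ?thesis using finite_subset by blast
  qed
  then have "finite (\<Union>k\<in>S. B k)" using assms(1) by blast
  then obtain s where "s \<notin> (\<Union>k\<in>S. B k)" using ex_new_if_finite infinite_UNIV_char_0 by blast
  then have "\<forall>k\<in>S. evr (linear_op (v k) 0) (1, s) \<noteq> 0"
    by (auto simp: evr_linear B_def simp del: of_real_add of_real_mult)
  then show ?thesis by (intro exI[of _ "(1, s)"]) (simp add: prod_eq_iff)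
qed

lemma collinear_evr_zero:
  assumes "v \<noteq> 0" "collinear {0, v, w}"
  shows "evr (linear_op v 0) (perp w) = 0"
proof -
  obtain c where "w = c *\<^sub>R v" using assms collinear_lemma by (metis scaleR_zero_left)
  then show ?thesis by (simp add: evr_linear perp_def)
qed

lemma product_form_necessary:
  assumes l: "l \<ge> 2" and ord: "has_order P l" and wc: "weakly_coercive \<infinity> l P"
  shows "product_form l P"
proof -
  define F where "F = hpart l P"
  have P: "order_le P l" and F0: "F \<noteq> 0" using ord by (auto simp: has_order_iff order_le_deg F_def)
  obtain m v R0 where m: "m \<le> l" and v: "\<forall>k\<in>{1..m}. v k \<noteq> 0" and R0: "hform m l R0"
    and ell: "\<forall>\<xi>. \<xi> \<noteq> 0 \<longrightarrow> evr R0 \<xi> \<noteq> 0" and F: "F = R0 * (\<Prod>k=1..m. linear_op (v k) 0)"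
    using real_linear_factors[OF _ F0, of l] hform_hpart[of l P] unfolding F_def by blast
  define L where "L k = linear_op (v k) 0" for k
  define S where "S = {1..m}"
  define G where "G k = R0 * (\<Prod>j\<in>S - {k}. L j)" for k
  have fin: "finite S" and cS: "card S = m" by (simp_all add: S_def)
  have FG: "hpart l P = linear_op (v k) 0 * G k" if "k \<in> S" for k
    using F that fin unfolding F_def[symmetric] G_def S_def[symmetric] L_def[symmetric]
    by (simp add: prod.remove mult_ac)
  obtain \<xi>' where "\<xi>' \<noteq> 0" "\<forall>k\<in>S. evr (L k) \<xi>' \<noteq> 0"
    using avoid_lines[OF fin, of v] v unfolding L_def S_def by blast
  then have \<xi>': "evr (hpart l P) \<xi>' \<noteq> 0"
    using ell fin F unfolding F_def[symmetric] by (simp add: evr_mult evr_prod L_def S_def)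
  have G0: "evr (G k) (perp (v k)) \<noteq> 0" if "k \<in> S" for k
    using no_double_root[OF wc l P _ FG[OF that] _ \<xi>'] v that by (auto simp: S_def)
  \<comment> \<open>A repeated direction would leave a vanishing factor in \<open>G k\<close> and
    contradict \<open>G0\<close>.\<close>
  have nc: "\<not> collinear {0, v j, v k}" if "j \<in> S" "k \<in> S" "j \<noteq> k" for j k
  proof
    assume "collinear {0, v j, v k}"
    then have "evr (L j) (perp (v k)) = 0" unfolding L_def using v that by (intro collinear_evr_zero) (auto simp: S_def)
    then have "evr (G k) (perp (v k)) = 0" using that fin by (auto simp: G_def evr_mult evr_prod)
    then show False using G0 that by blast
  qed
  define a where "a k = evr (hpart (l - 1) P) (perp (v k)) / evr (G k) (perp (v k))" for k
  have a: "a k \<notin> \<real>" if k: "k \<in> S" for k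
  proof
    assume "a k \<in> \<real>"
    then obtain r where r: "a k = of_real r" by (auto elim: Reals_cases)
    have vk: "v k \<noteq> 0" using v k by (simp add: S_def)
    define n where "n = (fst (v k))\<^sup>2 + (snd (v k))\<^sup>2"
    have n: "n \<noteq> 0" using vk by (auto simp: n_def prod_eq_iff sum_power2_eq_zero_iff)
    \<comment> \<open>\<eta> is the multiple of v whose inner product with v is - r; it would remove
      a real quotient.\<close>
    define \<eta> where "\<eta> = (- r / n) *\<^sub>R v k"
    have "fst (v k) * (q * fst (v k)) + snd (v k) * (q * snd (v k)) = q * n" for q
      unfolding n_def by algebra
    then have "fst (v k) * fst \<eta> + snd (v k) * snd \<eta> = (- r / n) * n"
      by (simp only: \<eta>_def fst_scaleR snd_scaleR real_scaleR_def)
    then have "fst (v k) * fst \<eta> + snd (v k) * snd \<eta> = - r" using n by simp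
    moreover have "evr (G k) (perp (v k)) * a k = evr (hpart (l - 1) P) (perp (v k))"
      using G0[OF k] by (simp add: a_def)
    ultimately show False using no_real_shift[OF wc l P vk FG[OF k], of \<eta>] r by simp
  qed
  define F1 where "F1 = hpart (l - 1) P - (\<Sum>k\<in>S. cst (a k) * G k)"
  have "hform 1 l F1"
    unfolding F1_def
  proof (intro hform_diff hform_sum hform_cst_mult)
    show "hform 1 l (hpart (l - 1) P)" by (rule hform_shift[OF hform_hpart]) (use l in simp)
    fix k assume k: "k \<in> S"
    have "hform 0 (card (S - {k})) (\<Prod>j\<in>S - {k}. L j)" unfolding L_def using fin by (intro hform_prod hform_linear) auto
    from hform_mult[OF R0 this] show "hform 1 l (G k)" unfolding G_def
      by (rule hform_shift) (use card_Suc_Diff1[OF fin k] cS in simp)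
  qed
  moreover have "\<forall>k\<in>{1..m}. evr F1 (perp (v k)) = 0"
  proof
    fix k assume "k \<in> {1..m}"
    then have k: "k \<in> S" by (simp add: S_def)
    \<comment> \<open>For j \<noteq> k the product in \<open>G j\<close> still contains
      \<open>L k\<close>.\<close>
    have "evr (G j) (perp (v k)) = 0" if "j \<noteq> k" for j
    proof -
      have "(\<Prod>i\<in>S - {j}. evr (L i) (perp (v k))) = 0"
        using k fin that evr_linear_perp_self[of "v k"] by (intro prod_zero) (auto simp: L_def)
      then show ?thesis by (simp add: G_def evr_mult evr_prod)
    qed
    then have "(\<Sum>j\<in>S. a j * evr (G j) (perp (v k))) = a k * evr (G k) (perp (v k))"
      using fin k by (subst sum.remove[of _ k]) auto
    then show "evr F1 (perp (v k)) = 0"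
      using G0[OF k] by (simp add: F1_def evr_minus evr_sum evr_mult evr_cst a_def)
  qed
  ultimately obtain R' where R': "F1 = R' * (\<Prod>j=1..m. linear_op (v j) 0)" "hform (1 + m) l R'"
    using division_by_product[of 1 l F1 m v] v nc unfolding S_def by blast
  define T0 where "T0 = (\<Prod>k\<in>S. L k)"
  define U0 where "U0 = (\<Sum>k\<in>S. cst (a k) * (\<Prod>j\<in>S - {k}. L j))"
  obtain E where E: "(\<Prod>k\<in>S. linear_op (v k) (a k)) = T0 + U0 + E" "deg_le 2 m E"
    using product_expansion[OF fin, of v a] unfolding L_def[symmetric] T0_def[symmetric] U0_def[symmetric] cS by blast
  have U1: "deg_le 1 m U0" using subleading_deg_le[OF fin, of a v] unfolding cS U0_def L_def .
  define W where "W = P - hpart l P - hpart (l - 1) P"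
  \<comment> \<open>In \<open>(R0 + R') * (T0 + U0 + E)\<close> the term \<open>R0 * T0\<close> is
    the part of P of degree l, and \<open>R0 * U0 + R' * T0\<close> is the part of degree l - 1. The
    other three products have order at most l - 2 and are compensated in Q.\<close>
  define Q where "Q = W - R0 * E - R' * U0 - R' * E"
  have "R0 * U0 = (\<Sum>k\<in>S. cst (a k) * G k)" by (simp add: U0_def G_def sum_distrib_left mult_ac)
  then have "hpart (l - 1) P = R' * T0 + R0 * U0" using R'(1) by (simp add: F1_def T0_def L_def S_def algebra_simps)
  moreover have "hpart l P = R0 * T0" using F by (simp add: F_def T0_def L_def S_def)
  ultimately have "P = (R0 + R') * (\<Prod>k\<in>S. linear_op (v k) (a k)) + Q"
    unfolding E(1) Q_def W_def by (simp add: algebra_simps)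
  moreover have "elliptic_of_order (R0 + R') (l - m)"
  proof -
    have R'd: "deg_le (Suc m) l R'" using hform_deg_le[OF R'(2)] by simp
    have "hpart (l - m) (R0 + R') = R0" by (rule hpart_eq[OF R0 R'd m])
    moreover have "deg_le 0 (l - m) (R0 + R')"
      by (intro deg_le_add deg_le_mono[OF hform_deg_le[OF R0]] deg_le_mono[OF R'd]) (use m in auto)
    ultimately show ?thesis using ell by (simp add: elliptic_iff)
  qed
  moreover have "order_le Q (l - 2)"
  proof -
    have "deg_le 1 l (P - hpart l P)" using deg_le_minus_hpart[of 0 l P] P by (simp add: order_le_deg)
    moreover have "hpart (l - 1) (P - hpart l P) = hpart (l - 1) P"
      using l by (intro poly_mapping_eqI) (auto simp: look_hpart lookup_minus)
    ultimately have "deg_le 2 l W" using deg_le_minus_hpart[of 1 l "P - hpart l P"] by (simp add: W_def numeral_2_eq_2)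
    moreover have "deg_le 2 l (R0 * E)" by (rule deg_le_mono[OF deg_le_mult[OF hform_deg_le[OF R0] E(2)]]) simp
    moreover have "deg_le 2 l (R' * U0)" by (rule deg_le_mono[OF deg_le_mult[OF hform_deg_le[OF R'(2)] U1]]) simp
    moreover have "deg_le 2 l (R' * E)" by (rule deg_le_mono[OF deg_le_mult[OF hform_deg_le[OF R'(2)] E(2)]]) simp
    ultimately have "deg_le 2 l Q" unfolding Q_def by (intro deg_le_diff)
    then show ?thesis unfolding order_le_deg by (rule deg_le_mono) (use l in simp)
  qed
  ultimately show ?thesis unfolding product_form_def
    using m v a nc by (intro exI[of _ m] exI[of _ "R0 + R'"] exI[of _ Q] exI[of _ v] exI[of _ a]) (simp add: S_def)
qed

lemma product_form_sufficient:
  assumes l: "l \<ge> 2" and "product_form l P"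
  shows "has_order P l \<and> (\<forall>p\<ge>1. weakly_coercive p l P)"
proof -
  obtain m R Q v a where m: "m \<le> l" and R: "elliptic_of_order R (l - m)" and Q: "order_le Q (l - 2)"
    and a: "\<forall>k\<in>{1..m}. a k \<notin> \<real>" and v: "\<forall>k\<in>{1..m}. v k \<noteq> 0"
    and nc: "\<forall>j\<in>{1..m}. \<forall>k\<in>{1..m}. j \<noteq> k \<longrightarrow> \<not> collinear {0, v j, v k}"
    and P: "P = R * (\<Prod>k=1..m. linear_op (v k) (a k)) + Q"
    using assms(2) unfolding product_form_def by blast
  define R0 where "R0 = hpart (l - m) R"
  define R' where "R' = R - R0"
  have Rd: "deg_le 0 (l - m) R" and ell: "\<And>\<xi>. \<xi> \<noteq> 0 \<Longrightarrow> evr R0 \<xi> \<noteq> 0" using R by (auto simp: elliptic_iff R0_def)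
  have R0h: "hform 0 (l - m) R0" by (simp add: R0_def hform_hpart)
  have R'd: "deg_le 1 (l - m) R'" using deg_le_minus_hpart[OF Rd] by (simp add: R'_def R0_def)
  \<comment> \<open>Because l \<ge> 2, the truncated difference l - 2 is a true one.\<close>
  have Qd: "deg_le 2 l Q" using Q unfolding order_le_deg by (rule deg_le_mono) (use l in simp)
  obtain c M where cM: "c \<noteq> 0" "size M = l - m" "\<forall>z\<in>#M. z \<notin> \<real>" "R0 = cst c * (\<Prod>z\<in>#M. ell z)"
    using elliptic_form_factors[OF R0h ell] by blast
  define T0 where "T0 = (\<Prod>k=1..m. linear_op (v k) 0)"
  define U0 where "U0 = (\<Sum>k\<in>{1..m}. cst (a k) * (\<Prod>j\<in>{1..m} - {k}. linear_op (v j) 0))"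
  obtain E where E: "(\<Prod>k=1..m. linear_op (v k) (a k)) = T0 + U0 + E" "deg_le 2 m E"
    using product_expansion[of "{1..m}" v a] unfolding T0_def U0_def by auto
  have U1: "deg_le 1 m U0" using subleading_deg_le[of "{1..m}" a v] by (simp add: U0_def)
  have T0h: "hform 0 m T0" using hform_prod[of "{1..m}" "\<lambda>k. linear_op (v k) 0"] hform_linear by (simp add: T0_def)
  have top: "hform 0 l (R0 * T0)" using hform_mult[OF R0h T0h] m by simp
  define N where "N = R' * T0 + R * (U0 + E) + Q"
  have PN: "P = R0 * T0 + N" unfolding P E(1) N_def R'_def by (simp add: algebra_simps)
  have N: "deg_le 1 l N" unfolding N_def
  proof (intro deg_le_add)
    show "deg_le 1 l (R' * T0)" by (rule deg_le_mono[OF deg_le_mult[OF R'd hform_deg_le[OF T0h]]]) (use m in simp)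
    have "deg_le 1 m (U0 + E)" by (intro deg_le_add U1 deg_le_mono[OF E(2)]) simp
    from deg_le_mult[OF Rd this] show "deg_le 1 l (R * (U0 + E))" by (rule deg_le_mono) (use m in simp)
    show "deg_le 1 l Q" by (rule deg_le_mono[OF Qd]) simp
  qed
  \<comment> \<open>In a direction off all the lines the form \<open>R0 * T0\<close> is not zero, so
    no cancellation lowers the order of P below l.\<close>
  obtain \<xi> where "\<xi> \<noteq> 0" "\<forall>k\<in>{1..m}. evr (linear_op (v k) 0) \<xi> \<noteq> 0"
    using avoid_lines[of "{1..m}" v] v by auto
  then have "evr (R0 * T0) \<xi> \<noteq> 0" using ell by (simp add: evr_mult evr_prod T0_def)
  then have "R0 * T0 \<noteq> 0" by (auto simp: evr_def)
  moreover have "hpart (l - 0) (R0 * T0 + N) = R0 * T0" by (rule hpart_eq[OF top]) (use N in auto)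
  moreover have "deg_le 0 l P" unfolding PN by (intro deg_le_add hform_deg_le[OF top] deg_le_mono[OF N]) simp
  ultimately have "has_order P l" by (simp add: has_order_iff PN)
  moreover have "weakly_coercive p l P" if p: "p \<ge> 1" for p
  proof -
    have "weakly_coercive p (Suc (l - 1)) (R * (\<Prod>k\<in>{1..m}. linear_op (v k) (a k)) + Q)"
    proof (rule product_coercive[OF p _ cM(3) a v nc _ cM(1)])
      show "size M + card {1..m} = Suc (l - 1)" using cM(2) m l by simp
      show "R = cst c * (\<Prod>z\<in>#M. ell z) + R'" by (simp add: R'_def cM(4)[symmetric])
      show "\<forall>\<alpha>\<in>keys R'. mi_size \<alpha> < size M" using R'd cM(2) by (auto simp: deg_le_def)
      show "\<forall>\<alpha>\<in>keys Q. mi_size \<alpha> < l - 1" using Qd by (fastforce simp: deg_le_def)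
    qed simp
    then show ?thesis using l by (simp add: P)
  qed
  ultimately show ?thesis by blast
qed

theorem theorem5p1:
  fixes l :: nat
  assumes "l \<ge> 2"
  shows "(\<forall>P. has_order P l \<and> weakly_coercive \<infinity> l P \<longrightarrow> product_form l P) \<and>
    (\<forall>P. product_form l P \<longrightarrow> has_order P l \<and> (\<forall>p\<ge>1. weakly_coercive p l P))"
  using product_form_necessary[OF assms] product_form_sufficient[OF assms] by blast

end
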